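(* Let $G$ be a cubic tricirculant graph. Then $G$ is a nut graph if and only if $G$ is isomorphic to some $T_1(n,a,b)$ with $n$ even and $0 \le a < b < n$ such that (i) $\gcd\left(\frac{n}{2}, a\right) = \gcd\left(\frac{n}{2}, b\right) = 1$; (ii) $a \not\equiv \frac{n}{2} \pmod 2$ and $b \not\equiv \frac{n}{2} \pmod 2$; (iii) $v_2(b-a) \ge v_2(n)$; or $G$ is isomorphic to some $T_4(n,a,b)$ with $n$ even and $0 < a \le b < \frac{n}{2}$ such that (iv) $\gcd\left(\frac{n}{2}, a, b\right) = 1$; (v) if $4 \nmid n$, then at least one of $a, b$ is even; (vi) if $4 \mid n$, then $a$ and $b$ are of different parities; (vii) if $10 \mid n$, then at least one of $a, b, a-b, a+b$ is divisible by $5$.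
   Context: All graphs are simple. A nut graph is a graph whose adjacency matrix has the eigenvalue $0$ with multiplicity one (nullity one) and whose null space is spanned by a vector with no zero entries. A graph is cubic if it is $3$-regular. A tricirculant graph is a graph admitting a cyclic group of automorphisms having exactly three orbits on vertices, all of equal size. For $n$ even, the graphs below have vertex set $\{x_j, y_j, z_j : j \in \mathbb{Z}_n\}$ (indices modulo $n$): $T_1(n,a,b)$ has edge set $\{x_j y_{j+a}, x_j y_{j+b}, x_j z_j, y_j z_j, z_j z_{j+n/2} : j \in \mathbb{Z}_n\}$, and $T_4(n,a,b)$ has edge set $\{x_j x_{j+a}, x_j z_j, y_j y_{j+b}, y_j z_j, z_j z_{j+n/2} : j \in \mathbb{Z}_n\}$. For a nonzero integer $x$, $v_2(x)$ denotes the exponent of $2$ in the prime factorization of $|x|$. *)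

theory Defs
  imports
    "HOL-Algebra.Algebra"
    "HOL-Number_Theory.Cong"
    "Graph_Theory.Graph_Theory"
    "Jordan_Normal_Form.Matrix_Kernel"
begin

text \<open>
  Finite simple graphs are rendered as \<^locale>\<open>pair_graph\<close>: a finite vertex set together with
  a symmetric irreflexive set of ordered pairs, an edge \<open>uv\<close> being the two arcs \<open>(u, v)\<close>, \<open>(v, u)\<close>.
  Isomorphism is \<^const>\<open>digraph_iso\<close>.
\<close>

definition cubic :: "'a pair_pre_digraph \<Rightarrow> bool" where
  "cubic G \<longleftrightarrow> (\<forall>v \<in> pverts G. out_degree (with_proj G) v = 3)"

definition automorphism_group :: "'a pair_pre_digraph \<Rightarrow> ('a \<Rightarrow> 'a) monoid" where
  "automorphism_group G = (BijGroup (pverts G))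
     \<lparr>carrier := {\<sigma> \<in> Bij (pverts G).
        \<forall>u \<in> pverts G. \<forall>v \<in> pverts G. (\<sigma> u, \<sigma> v) \<in> parcs G \<longleftrightarrow> (u, v) \<in> parcs G}\<rparr>"

definition tricirculant :: "'a pair_pre_digraph \<Rightarrow> bool" where
  "tricirculant G \<longleftrightarrow>
     (\<exists>H. subgroup H (automorphism_group G) \<and>
          cyclic_group ((automorphism_group G)\<lparr>carrier := H\<rparr>) \<and>
          (let \<O> = Group_Action.orbits ((automorphism_group G)\<lparr>carrier := H\<rparr>) (pverts G) (\<lambda>\<sigma>. \<sigma>)
           in card \<O> = 3 \<and> (\<forall>A \<in> \<O>. \<forall>B \<in> \<O>. card A = card B)))"

definition adjacency_matrix :: "'a pair_pre_digraph \<Rightarrow> 'a list \<Rightarrow> real mat" where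
  "adjacency_matrix G vs =
     mat (length vs) (length vs) (\<lambda>(i, j). if (vs ! i, vs ! j) \<in> parcs G then 1 else 0)"

text \<open>
  The list \<open>vs\<close> enumerates the vertices; other enumerations only permute rows and columns
  simultaneously, so its choice is immaterial.
\<close>

definition nut_graph :: "'a pair_pre_digraph \<Rightarrow> bool" where
  "nut_graph G \<longleftrightarrow>
     (\<exists>vs. distinct vs \<and> set vs = pverts G \<and>
        kernel_dim (adjacency_matrix G vs) = 1 \<and>
        (\<exists>x \<in> carrier_vec (length vs).
           mat_kernel (adjacency_matrix G vs) = range (\<lambda>c. c \<cdot>\<^sub>v x) \<and>
           (\<forall>i < length vs. x $ i \<noteq> 0)))"

datatype tri_vertex = VX nat | VY nat | VZ nat

definition tri_graph :: "nat \<Rightarrow> (tri_vertex \<times> tri_vertex) set \<Rightarrow> tri_vertex pair_pre_digraph" where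
  "tri_graph n E = \<lparr>pverts = VX ` {..<n} \<union> VY ` {..<n} \<union> VZ ` {..<n}, parcs = E \<union> E\<inverse>\<rparr>"

text \<open>
  \<open>\<int>\<^sub>n\<close> is represented by \<open>{..<n}\<close>. Both graphs are meant for even \<open>n\<close> only.
\<close>

definition T1 :: "nat \<Rightarrow> nat \<Rightarrow> nat \<Rightarrow> tri_vertex pair_pre_digraph" where
  "T1 n a b = tri_graph n (\<Union>j<n.
     {(VX j, VY ((j + a) mod n)), (VX j, VY ((j + b) mod n)),
      (VX j, VZ j), (VY j, VZ j), (VZ j, VZ ((j + n div 2) mod n))})"

definition T4 :: "nat \<Rightarrow> nat \<Rightarrow> nat \<Rightarrow> tri_vertex pair_pre_digraph" where
  "T4 n a b = tri_graph n (\<Union>j<n.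
     {(VX j, VX ((j + a) mod n)), (VX j, VZ j),
      (VY j, VY ((j + b) mod n)), (VY j, VZ j), (VZ j, VZ ((j + n div 2) mod n))})"

end

theory Submission
  imports Defs "HOL-Number_Theory.Number_Theory" "Jordan_Normal_Form.Char_Poly"
begin

text \<open>
  A generator of the cyclic group labels the vertices \<open>v i j\<close> with \<open>i < 3\<close> and \<open>j\<close> modulo \<open>n\<close>, and
  a discrete Fourier transform splits the null space of the adjacency matrix into the kernels of
  \<open>3 \<times> 3\<close> symbol matrices \<open>M(w)\<close>, one for each \<open>w\<close> with \<open>w ^ n = 1\<close>. The null vector of a nut
  graph spans a one-dimensional shift-invariant real space, so it comes from some \<open>w = 1\<close> or
  \<open>w = - 1\<close>; this excludes every pattern of connection sets except those of \<open>T\<^sub>1\<close> and \<open>T\<^sub>4\<close>. For these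
  two families \<open>M(1)\<close> has the kernel spanned by \<open>(1, 1, - 2)\<close>, so the graph is a nut graph iff \<open>M(w)\<close>
  is regular for all \<open>w \<noteq> 1\<close>. The determinant of \<open>T\<^sub>1\<close> factors into binomials. With
  \<open>u = w ^ (n / 2 + a)\<close> and \<open>v = w ^ (n / 2 + b)\<close>, the determinant of \<open>T\<^sub>4\<close> vanishes iff
  \<open>(u + 1 / u - 1) (v + 1 / v - 1) = 1\<close>. This relation survives Galois conjugation, so \<open>u\<close> of order
  \<open>m\<close> may be taken to be the root of unity nearest to \<open>1\<close>, where size considerations force
  \<open>m \<le> 5\<close>; \<open>m = 5\<close> is the source of condition (vii).
\<close>

text \<open>The edges between opposite \<open>z\<close> vertices contribute the entry
  \<open>e = w ^ (n / 2)\<close>, which is a sign. Since \<open>e e = 1\<close>, it can be moved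
  into \<open>e w ^ a\<close> and \<open>e w ^ b\<close>; this is where the exponents
  \<open>n / 2 + a\<close> and \<open>n / 2 + b\<close> come from. Conjugation acts on
  \<open>u\<close> and \<open>v\<close> simultaneously because both are powers of one root
  \<open>w\<close>: a relation between them is an integer polynomial equation in \<open>w\<close>,
  and Dedekind's argument transfers it to \<open>w ^ k\<close> for \<open>k\<close> prime to
  \<open>n\<close>. The bound on the order is one-sided: for \<open>m \<ge> 6\<close> the factor
  \<open>2 cos (2 pi / m) - 1\<close> lies in \<open>[0, 1)\<close>, while the other factor is at
  most \<open>1\<close>. The orders 2 and 3 pass this bound; a second conjugation, which brings
  \<open>v\<close> instead of \<open>u\<close> nearest to \<open>1\<close>, excludes them. Patterns
  are classified by the numbers of arcs between different orbits. Each row sums to 3, so in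
  descending order these numbers are \<open>2, 1, 1\<close> (\<open>T1\<close>),
  \<open>1, 1, 0\<close> (\<open>T4\<close>), \<open>2, 1, 0\<close>, \<open>1, 1, 1\<close>, or
  they isolate an orbit.\<close>

hide_const (open) Divisibility.prime

subsection \<open>Galois conjugation of relations between roots of unity\<close>

text \<open>Frobenius modulo \<open>p\<close>: in the expansion of \<open>(a + X f) ^ p\<close> the
  inner binomial coefficients are multiples of \<open>p\<close>, and \<open>a ^ p\<close> is
  congruent to \<open>a\<close> by Fermat. The explicit quotient \<open>h\<close> keeps the identity
  over the integers, so that it can be evaluated at a complex number.\<close>

lemma frobenius_poly_int:
  fixes f :: "int poly"
  assumes p: "prime p"
  shows "\<exists>h. f \<circ>\<^sub>p Polynomial.monom 1 p = f ^ p + Polynomial.smult (int p) h"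
proof (induction f)
  case 0
  then show ?case using p by (intro exI[of _ 0]) (simp add: prime_gt_0_nat zero_power)
next
  case (pCons a f)
  then obtain h where h: "f \<circ>\<^sub>p Polynomial.monom 1 p = f ^ p + Polynomial.smult (int p) h" by blast
  let ?X = "Polynomial.monom 1 1 :: int poly"
  have p0: "p > 0" using p prime_gt_0_nat by blast
  have ch: "\<exists>k. int (p choose i) = int p * k" if "i \<in> {1..<p}" for i
  proof -
    have "p dvd p choose i" using that p by (intro dvd_choose_prime) auto
    then show ?thesis by (metis dvdE of_nat_mult)
  qed
  then obtain k where k: "\<And>i. i \<in> {1..<p} \<Longrightarrow> int (p choose i) = int p * k i" by metis
  have X: "pCons a f = [:a:] + ?X * f" by (simp add: monom_altdef)
  have "(pCons a f) ^ p = (\<Sum>i\<le>p. of_nat (p choose i) * [:a:] ^ i * (?X * f) ^ (p - i))"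
    unfolding X by (rule binomial_ring)
  also have "{..p} = insert 0 (insert p {1..<p})" using p0 by auto
  also have "(\<Sum>i\<in>insert 0 (insert p {1..<p}). of_nat (p choose i) * [:a:] ^ i * (?X * f) ^ (p - i))
     = (?X * f) ^ p + ([:a:] ^ p + (\<Sum>i\<in>{1..<p}. of_nat (p choose i) * [:a:] ^ i * (?X * f) ^ (p - i)))"
    using p0 by (subst sum.insert) auto
  also have "(\<Sum>i\<in>{1..<p}. of_nat (p choose i) * [:a:] ^ i * (?X * f) ^ (p - i))
     = Polynomial.smult (int p) (\<Sum>i\<in>{1..<p}. Polynomial.smult (k i) ([:a:] ^ i * (?X * f) ^ (p - i)))"
    unfolding smult_sum2
  proof (intro sum.cong refl)
    fix i assume i: "i \<in> {1..<p}"
    have "(of_nat (p choose i) :: int poly) = [:int (p choose i):]" by (simp add: of_nat_poly)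
    then show "of_nat (p choose i) * [:a:] ^ i * (?X * f) ^ (p - i) =
      Polynomial.smult (int p) (Polynomial.smult (k i) ([:a:] ^ i * (?X * f) ^ (p - i)))"
      using k[OF i] by simp
  qed
  finally obtain s where s: "(pCons a f) ^ p = (?X * f) ^ p + ([:a:] ^ p + Polynomial.smult (int p) s)"
    by blast
  have "[a ^ p = a] (mod int p)"
  proof (cases "int p dvd a")
    case True
    then have "int p dvd a ^ p" using p0 by (meson dvd_power_le dvd_trans dvd_power)
    then show ?thesis using True by (metis cong_0_iff cong_sym cong_trans)
  next
    case False
    \<comment> \<open>Fermat's theorem concerns natural numbers, so \<open>a\<close>, possibly
      negative, is replaced by its least residue.\<close>
    define b where "b = nat (a mod int p)"
    have b: "int b = a mod int p" using p0 unfolding b_def by simp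
    have "\<not> p dvd b" using False b p0
      by (metis dvd_mod_iff dvd_refl int_dvd_int_iff)
    then have "[b ^ (p - 1) = 1] (mod p)" using fermat_theorem p by blast
    then have "[int b ^ (p - 1) = 1] (mod int p)" by (metis cong_int_iff of_nat_1 of_nat_power)
    then have "[int b ^ (p - 1) * int b = 1 * int b] (mod int p)" by (rule cong_scalar_right)
    then have "[int b ^ p = int b] (mod int p)"
      using p0 by (metis One_nat_def Suc_pred mult.left_neutral power_Suc2)
    moreover have "[int b = a] (mod int p)" using b by (simp add: cong_def)
    ultimately show ?thesis by (meson cong_pow cong_sym cong_trans)
  qed
  then obtain t where t: "a ^ p = a + int p * t"
    by (metis cong_iff_lin cong_sym)
  have "(pCons a f) \<circ>\<^sub>p Polynomial.monom 1 p = [:a:] + ?X ^ p * (f ^ p + Polynomial.smult (int p) h)"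
    using h by (simp add: pcompose_pCons monom_power)
  moreover have "[:a:] = [:a:] ^ p - Polynomial.smult (int p) [:t:]"
    using t by (simp add: poly_const_pow)
  ultimately have "(pCons a f) \<circ>\<^sub>p Polynomial.monom 1 p
     = (pCons a f) ^ p + Polynomial.smult (int p) (?X ^ p * h - [:t:] - s)"
    unfolding s by (simp add: power_mult_distrib algebra_simps smult_add_right smult_diff_right)
  then show ?case by blast
qed

abbreviation int_poly_at :: "int poly \<Rightarrow> complex \<Rightarrow> complex" where
  "int_poly_at P z \<equiv> poly (of_int_poly P) z"

text \<open>The integer polynomials vanishing at \<open>z\<close> form a principal ideal. A nonzero
  member of least degree is made primitive; pseudo-division then gives \<open>a Q = f q\<close>, and
  by Gauss's lemma on contents \<open>a\<close> divides \<open>q\<close>, so the factor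
  \<open>a\<close> cancels over the integers.\<close>

lemma primitive_minimal_int_poly:
  fixes z :: complex and P :: "int poly"
  assumes "P \<noteq> 0" "int_poly_at P z = 0"
  obtains f where "f \<noteq> 0" "\<And>Q. int_poly_at Q z = 0 \<longleftrightarrow> f dvd Q"
proof -
  define R where "R = (\<lambda>Q. Q \<noteq> 0 \<and> int_poly_at Q z = 0)"
  obtain g where g: "R g" and gmin: "\<And>Q. R Q \<Longrightarrow> Polynomial.degree g \<le> Polynomial.degree Q"
    using assms ex_has_least_nat[of R P Polynomial.degree] unfolding R_def by blast
  define f where "f = primitive_part g"
  have f0: "f \<noteq> 0" and cf: "content f = 1" using g by (auto simp: f_def R_def)
  have gf: "g = Polynomial.smult (content g) f" by (simp add: f_def)
  have "content g \<noteq> 0" using g by (simp add: R_def)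
  have "int_poly_at g z = of_int (content g) * int_poly_at f z"
    by (subst gf) (simp only: of_int_hom.map_poly_hom_smult poly_smult)
  with g \<open>content g \<noteq> 0\<close> have fz: "int_poly_at f z = 0"
    by (metis R_def mult_eq_0_iff of_int_eq_0_iff)
  have deg: "Polynomial.degree f = Polynomial.degree g" by (simp add: f_def)
  have "f dvd Q" if Q: "int_poly_at Q z = 0" for Q
  proof -
    obtain a q where a: "a \<noteq> 0" and q: "Polynomial.smult a Q = f * q + pseudo_mod Q f"
      using pseudo_mod(1)[OF f0] by blast
    have "int_poly_at (Polynomial.smult a Q) z = 0" using Q by (simp add: hom_distribs)
    then have "int_poly_at (pseudo_mod Q f) z = 0" unfolding q using fz by (simp add: hom_distribs)
    then have "pseudo_mod Q f = 0"
      using pseudo_mod(2)[OF f0, of Q] gmin[of "pseudo_mod Q f"] deg unfolding R_def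
      by (metis not_less)
    with q have q: "Polynomial.smult a Q = f * q" by simp
    then have "normalize a * content Q = content q" using cf by (metis content_mult content_smult mult_1)
    then have "a dvd content q" by (metis dvd_triv_left normalize_dvd_iff)
    then obtain b where "content q = a * b" by blast
    then have "q = Polynomial.smult a (Polynomial.smult b (primitive_part q))"
      by (metis content_times_primitive_part smult_smult)
    then have "Polynomial.smult a Q = Polynomial.smult a (f * Polynomial.smult b (primitive_part q))"
      using q by (metis mult_smult_right)
    then show ?thesis using a by (metis dvd_triv_left smult_cancel)
  qed
  moreover have "int_poly_at Q z = 0" if "f dvd Q" for Q
    using that fz by (auto elim!: dvdE simp: hom_distribs)
  ultimately show ?thesis using f0 that by blast
qed

text \<open>Dedekind's argument for cyclotomic polynomials. Let \<open>X ^ n - 1 = f g\<close> with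
  \<open>f\<close> generating the relations of \<open>z\<close>. If \<open>f (z ^ p)\<close> were
  nonzero, then \<open>g (z ^ p) = 0\<close>, and differentiating the factorisation at
  \<open>z ^ p\<close> gives \<open>n (z ^ p) ^ (n - 1) = f (z ^ p) g' (z ^ p)\<close>. By Frobenius
  \<open>f (z ^ p)\<close> is \<open>p\<close> times an integer polynomial in \<open>z\<close>, so
  \<open>p\<close> divides \<open>n\<close> in the ring generated by \<open>z\<close>, and hence
  among the integers.\<close>

lemma int_poly_root_of_unity_prime_power:
  fixes z :: complex and P :: "int poly"
  assumes n: "n > 0" "z ^ n = 1" and p: "prime p" "\<not> p dvd n" and P: "int_poly_at P z = 0"
  shows "int_poly_at P (z ^ p) = 0"
proof -
  define U :: "int poly" where "U = Polynomial.monom 1 n - 1"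
  have Uz: "int_poly_at U w = w ^ n - 1" for w
    by (simp add: U_def hom_distribs poly_monom)
  have lU: "Polynomial.coeff U n = 1" using n by (simp add: U_def)
  then have U0: "U \<noteq> 0" by auto
  have dU: "Polynomial.degree U = n"
    unfolding U_def using n by (metis degree_1 degree_add_eq_left degree_minus degree_monom_eq diff_conv_add_uminus one_neq_zero)
  obtain f where f0: "f \<noteq> 0" and f: "\<And>Q. int_poly_at Q z = 0 \<longleftrightarrow> f dvd Q"
    using primitive_minimal_int_poly[OF U0, of z] n Uz by auto
  have "f dvd U" using f[of U] Uz[of z] n(2) by simp
  then obtain g where g: "U = f * g" by blast
  have "lead_coeff f * lead_coeff g = 1" using lU dU g by (metis lead_coeff_mult)
  then have lf: "\<bar>lead_coeff f\<bar> = 1" using zmult_eq_1_iff by auto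
  have "int_poly_at f (z ^ p) = 0"
  proof (rule ccontr)
    assume fne: "int_poly_at f (z ^ p) \<noteq> 0"
    have zp: "(z ^ p) ^ n = 1" by (metis mult.commute n(2) power_mult power_one)
    then have gz: "int_poly_at g (z ^ p) = 0"
      using Uz[of "z ^ p"] fne unfolding g by (simp add: hom_distribs)
    obtain h where h: "f \<circ>\<^sub>p Polynomial.monom 1 p = f ^ p + Polynomial.smult (int p) h"
      using frobenius_poly_int[OF p(1)] by blast
    have "int_poly_at (f \<circ>\<^sub>p Polynomial.monom 1 p) z = int_poly_at f (z ^ p)"
      by (simp add: of_int_hom.map_poly_pcompose poly_pcompose poly_monom)
    moreover have "int_poly_at (f ^ p + Polynomial.smult (int p) h) z = of_nat p * int_poly_at h z"
      using f[of f] prime_gt_0_nat[OF p(1)] by (simp add: hom_distribs)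
    ultimately have fp: "int_poly_at f (z ^ p) = of_nat p * int_poly_at h z" using h by simp
    have "int_poly_at (pderiv U) (z ^ p) = int_poly_at f (z ^ p) * int_poly_at (pderiv g) (z ^ p)"
      unfolding g pderiv_mult using gz by (simp add: hom_distribs)
    moreover have "int_poly_at (pderiv U) (z ^ p) = of_nat n * (z ^ p) ^ (n - 1)"
      by (simp add: U_def pderiv_diff pderiv_monom poly_monom)
    ultimately have "of_nat n * (z ^ p) ^ (n - 1) * z ^ p = of_nat p * int_poly_at h z * int_poly_at (pderiv g) (z ^ p) * z ^ p"
      using fp by simp
    moreover have "(z ^ p) ^ (n - 1) * z ^ p = 1"
      using zp n by (metis One_nat_def Suc_pred power_Suc2)
    \<comment> \<open>Substituting \<open>X ^ p\<close> into the derivative of \<open>g\<close>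
      expresses the right-hand side as an integer polynomial in \<open>z\<close> itself, the point
      whose relations \<open>f\<close> controls.\<close>
    moreover define H where "H = h * (pderiv g \<circ>\<^sub>p Polynomial.monom 1 p) * Polynomial.monom 1 p"
    moreover have "int_poly_at H z = int_poly_at h z * int_poly_at (pderiv g) (z ^ p) * z ^ p"
      by (simp add: H_def hom_distribs of_int_hom.map_poly_pcompose poly_pcompose poly_monom)
    ultimately have nH: "of_nat n = of_nat p * int_poly_at H z"
      by (metis mult.assoc mult.right_neutral)
    \<comment> \<open>The leading coefficient of \<open>f\<close> is a unit, so the multiplier
      \<open>c\<close> of the pseudo-division is \<open>1\<close> or \<open>- 1\<close>. The
      remainder has smaller degree than \<open>f\<close>, which makes \<open>c n = p r\<close> an
      identity of polynomials and lets the constant terms be compared.\<close>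
    obtain q r where qr: "pseudo_divmod H f = (q, r)" by fastforce
    define c where "c = lead_coeff f ^ (Suc (Polynomial.degree H) - Polynomial.degree f)"
    have c: "Polynomial.smult c H = f * q + r" and r: "r = 0 \<or> Polynomial.degree r < Polynomial.degree f"
      using pseudo_divmod[OF f0 qr] unfolding c_def by auto
    have c1: "\<bar>c\<bar> = 1" unfolding c_def by (simp add: power_abs lf)
    have df: "Polynomial.degree f > 0"
    proof (rule ccontr)
      assume "\<not> ?thesis"
      then obtain d where d: "f = [:d:]" by (metis degree_eq_zeroE not_gr_zero)
      then have "int_poly_at f z = of_int d" by (simp add: hom_distribs)
      with f[of f] d f0 show False by simp
    qed
    have "of_int c * int_poly_at H z = int_poly_at (f * q + r) z" using c
      by (metis of_int_hom.map_poly_hom_smult poly_smult)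
    also have "\<dots> = int_poly_at r z" using f[of f] by (simp add: hom_distribs)
    finally have "of_int c * int_poly_at H z = int_poly_at r z" .
    then have "int_poly_at ([:c * int n:] - Polynomial.smult (int p) r) z = 0"
      using nH by (simp add: hom_distribs)
    then have "f dvd [:c * int n:] - Polynomial.smult (int p) r" using f by blast
    moreover have "Polynomial.degree ([:c * int n:] - Polynomial.smult (int p) r) < Polynomial.degree f"
      using r df by (intro degree_diff_less) (auto intro: le_less_trans[OF degree_smult_le])
    ultimately have "[:c * int n:] = Polynomial.smult (int p) r"
      by (metis dvd_imp_degree_le eq_iff_diff_eq_0 not_less)
    then have "c * int n = int p * Polynomial.coeff r 0" by (metis coeff_pCons_0 coeff_smult)
    then have "int p dvd \<bar>c\<bar> * int n" by (metis abs_dvd_iff abs_mult abs_of_nat dvd_abs_iff dvd_triv_left)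
    then show False using c1 p by simp
  qed
  moreover have "f dvd P" using f P by blast
  ultimately show ?thesis by (auto elim!: dvdE simp: hom_distribs)
qed

lemma int_poly_root_of_unity_coprime_power:
  fixes z :: complex and P :: "int poly"
  assumes "n > 0" "z ^ n = 1" "coprime k n" "k > 0" "int_poly_at P z = 0"
  shows "int_poly_at P (z ^ k) = 0"
  using assms(3-)
proof (induction k rule: prime_divisors_induct)
  case (factor p k)
  then have "coprime p n" "coprime k n" "k > 0" by auto
  then have "int_poly_at P (z ^ k) = 0" using factor by simp
  moreover have "(z ^ k) ^ n = 1" by (metis assms(2) mult.commute power_mult power_one)
  moreover have "\<not> p dvd n" using \<open>coprime p n\<close> factor(1) by (metis coprime_absorb_left not_prime_unit)
  ultimately have "int_poly_at P ((z ^ k) ^ p) = 0"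
    using int_poly_root_of_unity_prime_power assms(1) factor(1) by blast
  then show ?case by (simp add: mult.commute power_mult)
qed auto

subsection \<open>A cosine relation\<close>

text \<open>Units modulo \<open>m\<close> lift to units modulo \<open>n\<close>. A prime of
  \<open>n\<close> that divides \<open>m\<close> is kept away by \<open>k\<close>; the others are
  collected in \<open>c\<close>, and the Chinese remainder theorem prescribes the residue
  \<open>1\<close> modulo \<open>c\<close>.\<close>

lemma coprime_lift_modulus:
  fixes k m n :: nat
  assumes "coprime k m" "m dvd n" "n > 0"
  obtains l where "l > 0" "[l = k] (mod m)" "coprime l n"
proof -
  define S where "S = {p. prime p \<and> p dvd n \<and> \<not> p dvd m}"
  define c where "c = \<Prod>S"
  have "finite {d. d dvd n}" using assms(3) by (rule finite_divisors_nat)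
  then have fin: "finite S" by (rule rev_finite_subset) (auto simp only: S_def)
  have m0: "m > 0" using assms by (auto intro: Nat.gr0I)
  have "coprime m c" unfolding c_def
    by (intro prod_coprime_right) (auto simp: S_def prime_imp_coprime coprime_commute)
  then obtain x where x: "[x = k] (mod m)" "[x = 1] (mod c)"
    using binary_chinese_remainder_nat by blast
  \<comment> \<open>Adding \<open>m * c\<close> changes neither residue and makes \<open>l\<close>
    positive.\<close>
  define l where "l = x + m * c"
  have c0: "c > 0" unfolding c_def using fin by (intro prod_pos) (auto simp: S_def prime_gt_0_nat)
  have lk: "[l = k] (mod m)" using x(1) by (simp add: l_def cong_def)
  have l1: "[l = 1] (mod c)" using x(2) by (simp add: l_def cong_def)
  have "coprime l n"
  proof (rule ccontr)
    assume "\<not> coprime l n"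
    then obtain p where p: "prime p" "p dvd l" "p dvd n"
      by (metis coprime_def is_unit_gcd prime_factor_nat gcd_nat.boundedE nat_dvd_1_iff_1)
    show False
    proof (cases "p dvd m")
      case True
      then have "p dvd k" using lk p(2) by (metis cong_dvd_iff cong_dvd_modulus_nat)
      then show False using True assms(1) p(1) by (metis coprime_common_divisor not_prime_unit)
    next
      case False
      then have "p dvd c" unfolding c_def using p fin by (intro dvd_prodI[of S p "\<lambda>x. x", simplified]) (auto simp: S_def)
      then have "p dvd 1" using l1 p(2) by (metis cong_dvd_iff cong_dvd_modulus_nat)
      then show False using p(1) by simp
    qed
  qed
  then show thesis using that[of l] lk m0 c0 by (simp add: l_def)
qed

text \<open>With \<open>u = cis (2 pi q / m)\<close> in lowest terms, the inverse of
  \<open>q\<close> modulo \<open>m\<close> is an exponent that takes \<open>u\<close> to the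
  primitive root nearest to \<open>1\<close>. It is lifted to a unit modulo \<open>n\<close>,
  because the same exponent has to act on other \<open>n\<close>-th roots as well.\<close>

lemma root_of_unity_conjugate_cis:
  fixes u :: complex
  assumes "n > 0" "u ^ n = 1"
  obtains k m where "k > 0" "coprime k n" "m > 0" "m dvd n" "u ^ k = cis (2 * pi / real m)"
proof -
  obtain j where j: "j < n" "u = cis (2 * pi * real j / real n)"
    using bij_betw_roots_unity[OF assms(1)] assms(2) unfolding bij_betw_def by blast
  define d where "d = gcd j n"
  define m where "m = n div d"
  define q where "q = j div d"
  have d0: "d > 0" using assms(1) by (simp add: d_def)
  have n: "n = m * d" and jq: "j = q * d" by (simp_all add: m_def q_def d_def)
  have m0: "m > 0" using n assms(1) by (auto intro: Nat.gr0I)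
  have cop: "coprime q m" unfolding q_def m_def d_def using assms(1) by (intro div_gcd_coprime) auto
  then obtain k0 where k0: "[q * k0 = 1] (mod m)" using cong_solve_coprime_nat by (metis One_nat_def)
  then have "coprime k0 m" by (metis cong_imp_coprime cong_sym coprime_1_left coprime_mult_left_iff)
  then obtain k where k: "k > 0" "[k = k0] (mod m)" "coprime k n"
    using coprime_lift_modulus[of k0 m n] n assms(1) by auto
  have "[q * k = 1] (mod m)" using k(2) k0 by (meson cong_scalar_left cong_trans)
  then have "[int (q * k) = int 1] (mod int m)" by (simp only: cong_int_iff)
  then obtain t where t: "int (q * k) = 1 + int m * t" by (metis cong_iff_lin cong_sym of_nat_1)
  have "u = cis (2 * pi * real q / real m)" unfolding j(2) n jq using d0 m0 by (simp add: field_simps)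
  then have "u ^ k = cis (real k * (2 * pi * real q / real m))" by (simp only: DeMoivre)
  also have "real k * (2 * pi * real q / real m) = 2 * pi * real_of_int (int (q * k)) / real m"
    by simp
  also have "\<dots> = 2 * pi / real m + 2 * pi * of_int t" unfolding t using m0 by (simp add: field_simps)
  also have "cis \<dots> = cis (2 * pi / real m)"
    by (simp add: cis_mult[symmetric] cis_multiple_2pi)
  finally show thesis using that k m0 n by auto
qed

lemma add_inverse_eq_imp:
  fixes v w :: "'a :: field"
  assumes "v \<noteq> 0" "w \<noteq> 0" "v + 1 / v = w + 1 / w"
  shows "v = w \<or> v = 1 / w"
proof -
  have "(v - w) * (v * w - 1) = v * w * ((v + 1 / v) - (w + 1 / w))"
    using assms(1,2) by (simp add: field_simps)
  also have "\<dots> = 0" using assms(3) by simp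
  finally have "v - w = 0 \<or> v * w - 1 = 0" by simp
  then show ?thesis using assms by (auto simp: field_simps)
qed

lemma unit_complex_add_inverse:
  fixes u :: complex assumes "cmod u = 1"
  shows "u + 1 / u = of_real (2 * Re u)"
proof -
  have "1 / u = cnj u" using assms by (metis complex_div_cnj complex_norm_square div_by_1 mult_1 of_real_1 power_one)
  then show ?thesis by (simp add: complex_add_cnj)
qed

text \<open>Dividing \<open>u^4 + u^3 + u^2 + u + 1 = 0\<close> by \<open>u^2\<close> leaves a
  quadratic equation for \<open>u + 1 / u\<close>, whose positive root is the reciprocal of the
  golden ratio.\<close>

lemma cos_fifth_turn: "(2 * cos (2 * pi / 5))\<^sup>2 + 2 * cos (2 * pi / 5) = (1::real)"
proof -
  define u where "u = cis (2 * pi / 5)"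
  have u5: "u ^ 5 = 1" by (simp add: u_def DeMoivre)
  have "sin (2 * pi / 5) > 0" by (intro sin_gt_zero) auto
  then have u1: "u \<noteq> 1" by (auto simp: u_def complex_eq_iff)
  have u0: "u \<noteq> 0" by (simp add: u_def)
  have "(u - 1) * (u^4 + u^3 + u^2 + u + 1) = u ^ 5 - 1"
    by (simp add: algebra_simps eval_nat_numeral)
  then have s: "u^4 + u^3 + u^2 + u + 1 = 0" using u5 u1 by simp
  have "(u + 1 / u)\<^sup>2 + (u + 1 / u) - 1 = (u^4 + u^3 + u^2 + u + 1) / u\<^sup>2"
    using u0 by (simp add: field_simps power2_eq_square power3_eq_cube power4_eq_xxxx)
  then have "(u + 1 / u)\<^sup>2 + (u + 1 / u) = 1" using s by simp
  moreover have "u + 1 / u = of_real (2 * cos (2 * pi / 5))"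
    by (subst unit_complex_add_inverse) (auto simp: u_def)
  ultimately have "complex_of_real ((2 * cos (2 * pi / 5))\<^sup>2 + 2 * cos (2 * pi / 5)) = of_real 1"
    by (metis of_real_1 of_real_add of_real_power)
  then show ?thesis by (simp only: of_real_eq_iff)
qed

lemma cos_unit_fraction_le_5:
  fixes b :: real
  assumes "m > 0" "(2 * cos (2 * pi / real m) - 1) * (b - 1) = 1" "b \<le> 2"
  shows "m \<le> 5"
proof (rule ccontr)
  assume "\<not> m \<le> 5"
  then have m: "real m \<ge> 6" by simp
  have "2 * pi / real m \<le> 2 * pi / 6" using m by (intro divide_left_mono) auto
  then have "cos (pi / 3) \<le> cos (2 * pi / real m)" using m
    by (intro cos_monotone_0_pi_le) auto
  then have ge: "2 * cos (2 * pi / real m) - 1 \<ge> 0" by (simp add: cos_60)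
  have "cos (2 * pi / real m) < cos 0" using m
    by (intro cos_monotone_0_pi) (auto simp: field_simps)
  then have lt: "2 * cos (2 * pi / real m) - 1 < 1" by simp
  have "(2 * cos (2 * pi / real m) - 1) * (b - 1) \<le> (2 * cos (2 * pi / real m) - 1) * 1"
    using assms(3) ge by (intro mult_left_mono) auto
  with lt assms(2) show False by simp
qed

section \<open>Arithmetic of exponents of roots of unity\<close>

lemma root_of_unity_power_cong:
  fixes z :: "'a :: monoid_mult"
  assumes "z ^ n = 1" "[i = j] (mod n)"
  shows "z ^ i = z ^ j"
proof -
  have "z ^ i = z ^ (i mod n)" for i
    by (metis assms(1) mod_div_decomp mult.commute mult.left_neutral power_add power_mult power_one)
  then show ?thesis using assms(2) by (metis cong_def)
qed

lemma root_of_unity_gcd: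
  fixes z :: "'a :: monoid_mult"
  assumes "z ^ m = 1" "z ^ n = 1"
  shows "z ^ gcd m n = 1"
proof (cases "m = 0")
  case False
  then obtain x y where "m * x = n * y + gcd m n" using bezout_nat by blast
  then have "z ^ (n * y) * z ^ gcd m n = z ^ (m * x)" by (simp add: power_add)
  then show ?thesis using assms by (simp add: power_mult)
qed (use assms in simp)

text \<open>The inverse exponent is chosen once for all \<open>n\<close>-th roots of unity, so that
  the same \<open>l\<close> undoes a conjugation on \<open>u\<close> and on
  \<open>v\<close>.\<close>

lemma coprime_power_invertible:
  assumes "coprime k n"
  obtains l where "\<And>z :: 'a :: monoid_mult. z ^ n = 1 \<Longrightarrow> (z ^ k) ^ l = z"
proof -
  obtain l where l: "[k * l = 1] (mod n)" using cong_solve_coprime_nat[OF assms] by auto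
  then have "(z ^ k) ^ l = z" if "z ^ n = 1" for z :: 'a
    using root_of_unity_power_cong[OF that l] by (simp add: power_mult)
  then show thesis using that by blast
qed

text \<open>With \<open>a = u + 1/u\<close> and \<open>b = v + 1/v\<close>, the relation below says \<open>(a - 1) (b - 1) = 1\<close>,
  that is, \<open>a b = a + b\<close>.\<close>

definition cosine_relation :: "complex \<Rightarrow> complex \<Rightarrow> bool" where
  "cosine_relation u v \<longleftrightarrow> (u\<^sup>2 - u + 1) * (v\<^sup>2 - v + 1) = u * v"

lemma cosine_relation_commute: "cosine_relation u v \<longleftrightarrow> cosine_relation v u"
  by (simp add: cosine_relation_def mult.commute)

lemma cosine_relation_coprime_power:
  assumes "n > 0" "w ^ n = 1" "coprime k n" "k > 0" "cosine_relation (w ^ s) (w ^ t)"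
  shows "cosine_relation ((w ^ s) ^ k) ((w ^ t) ^ k)"
proof -
  define M where "M i = (Polynomial.monom 1 i :: int poly)" for i
  define P where "P = (M (2 * s) - M s + 1) * (M (2 * t) - M t + 1) - M s * M t"
  have P: "int_poly_at P z = ((z ^ s)\<^sup>2 - z ^ s + 1) * ((z ^ t)\<^sup>2 - z ^ t + 1) - z ^ s * z ^ t" for z
    by (simp add: P_def M_def hom_distribs poly_monom power_mult[symmetric] mult.commute)
  have "int_poly_at P (w ^ k) = 0"
    using assms by (intro int_poly_root_of_unity_coprime_power) (auto simp: P cosine_relation_def)
  then show ?thesis by (simp add: P cosine_relation_def power_mult[symmetric] mult.commute)
qed

lemma cosine_relation_Re:
  assumes "cosine_relation u v" "cmod u = 1" "cmod v = 1"
  shows "(2 * Re u - 1) * (2 * Re v - 1) = 1"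
proof -
  have nz: "u \<noteq> 0" "v \<noteq> 0" using assms by auto
  have "(u + 1 / u - 1) * (v + 1 / v - 1) = (u\<^sup>2 - u + 1) * (v\<^sup>2 - v + 1) / (u * v)"
    using nz by (simp add: field_simps power2_eq_square)
  also have "\<dots> = 1" using assms(1) nz by (simp add: cosine_relation_def)
  finally have "complex_of_real ((2 * Re u - 1) * (2 * Re v - 1)) = of_real 1"
    using assms by (simp add: unit_complex_add_inverse)
  then show ?thesis by (simp only: of_real_eq_iff)
qed

lemma cmod_1_Re_1: "cmod z = 1 \<Longrightarrow> Re z = 1 \<Longrightarrow> z = 1"
  by (simp add: cmod_def complex_eq_iff)

lemma cosine_relation_conjugate:
  assumes "n > 0" "w ^ n = 1" "cosine_relation (w ^ s) (w ^ t)"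
  obtains k m where "k > 0" "coprime k n" "m \<in> {1..5}"
    "(w ^ s) ^ k = cis (2 * pi / real m)" "cosine_relation ((w ^ s) ^ k) ((w ^ t) ^ k)"
    "cmod ((w ^ t) ^ k) = 1"
    "(2 * cos (2 * pi / real m) - 1) * (2 * Re ((w ^ t) ^ k) - 1) = 1"
proof -
  have "(w ^ s) ^ n = 1" by (metis assms(2) mult.commute power_mult power_one)
  then obtain k m where km: "k > 0" "coprime k n" "m > 0" "(w ^ s) ^ k = cis (2 * pi / real m)"
    using root_of_unity_conjugate_cis[OF assms(1)] by metis
  have rel: "cosine_relation ((w ^ s) ^ k) ((w ^ t) ^ k)"
    using cosine_relation_coprime_power assms km by blast
  have "cmod w = 1" using power_eq_1_iff[OF assms(2)] assms(1) by simp
  then have cm: "cmod ((w ^ t) ^ k) = 1" by (simp add: norm_power)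
  have eq: "(2 * cos (2 * pi / real m) - 1) * (2 * Re ((w ^ t) ^ k) - 1) = 1"
    using cosine_relation_Re[OF rel] cm km(4) by simp
  have "Re ((w ^ t) ^ k) \<le> 1" using complex_Re_le_cmod[of "(w ^ t) ^ k"] cm by simp
  then have "m \<le> 5" using cos_unit_fraction_le_5[OF km(3) eq] by simp
  then have "m \<in> {1..5}" using km(3) by auto
  then show thesis using that km rel cm eq by blast
qed

lemma cos_unit_fraction_values:
  assumes "m \<in> {1..5::nat}"
  defines "a \<equiv> 2 * cos (2 * pi / real m)"
  shows "a = 2 \<or> a = - 2 \<or> a = - 1 \<or> a = 0 \<or> a\<^sup>2 + a = 1"
proof -
  from assms(1) consider "m = 1" | "m = 2" | "m = 3" | "m = 4" | "m = 5" by force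
  then show ?thesis
  proof cases
    case 3
    then show ?thesis by (simp add: a_def cos_120)
  next
    case 4
    then show ?thesis by (simp add: a_def)
  next
    case 5
    then show ?thesis using cos_fifth_turn by (simp add: a_def)
  qed (auto simp: a_def)
qed

text \<open>The order \<open>m\<close> of \<open>u\<close> fixes \<open>b = 2 Re (v ^ k)\<close>: it
  is \<open>2\<close>, \<open>2 / 3\<close>, \<open>1 / 2\<close>, \<open>0\<close> for
  \<open>m = 1, 2, 3, 4\<close>, and the double-angle value \<open>a * a - 2\<close> for
  \<open>m = 5\<close>. The values \<open>2 / 3\<close> and \<open>1 / 2\<close> are impossible,
  since a conjugate of \<open>v\<close> must have one of the few values that belong to orders up to
  5.\<close>

lemma cosine_relation_roots_of_unity:
  assumes n: "n > 0" "w ^ n = 1" and rel: "cosine_relation (w ^ s) (w ^ t)"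
  defines "u \<equiv> w ^ s" and "v \<equiv> w ^ t"
  shows "u = 1 \<and> v = 1 \<or> u\<^sup>2 = - 1 \<and> v\<^sup>2 = - 1 \<or> u ^ 5 = 1 \<and> u \<noteq> 1 \<and> (v = u\<^sup>2 \<or> v = 1 / u\<^sup>2)"
proof -
  have un: "u ^ n = 1" and vn: "v ^ n = 1" unfolding u_def v_def
    by (metis n(2) mult.commute power_mult power_one)+
  obtain k m where k: "k > 0" "coprime k n" and m: "m \<in> {1..5}"
    and U: "u ^ k = cis (2 * pi / real m)" and relk: "cosine_relation (u ^ k) (v ^ k)"
    and cV: "cmod (v ^ k) = 1"
    and eq: "(2 * cos (2 * pi / real m) - 1) * (2 * Re (v ^ k) - 1) = 1"
    using cosine_relation_conjugate[OF n rel] unfolding u_def v_def by blast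
  obtain l where "\<And>z :: complex. z ^ n = 1 \<Longrightarrow> (z ^ k) ^ l = z" using coprime_power_invertible[OF k(2)] by blast
  then have ul: "(u ^ k) ^ l = u" and vl: "(v ^ k) ^ l = v" using un vn by blast+
  have um: "u ^ m = 1"
  proof -
    have "(u ^ k) ^ m = 1" unfolding U DeMoivre using m by simp
    then show ?thesis using ul by (metis mult.commute power_mult power_one)
  qed
  \<comment> \<open>The conjugation with exchanged roles: now \<open>v\<close> is brought nearest to
    \<open>1\<close>.\<close>
  obtain k' m' where k': "k' > 0" "coprime k' n" and m': "m' \<in> {1..5}"
    and V': "v ^ k' = cis (2 * pi / real m')"
    and cU': "cmod (u ^ k') = 1"
    and eq': "(2 * cos (2 * pi / real m') - 1) * (2 * Re (u ^ k') - 1) = 1"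
    using cosine_relation_conjugate[of n w t s] n rel unfolding u_def v_def
    by (metis cosine_relation_commute)
  obtain l' where "\<And>z :: complex. z ^ n = 1 \<Longrightarrow> (z ^ k') ^ l' = z" using coprime_power_invertible[OF k'(2)] by blast
  then have ul': "(u ^ k') ^ l' = u" using un by blast
  define c where "c = 2 * cos (2 * pi / real m')"
  have c: "c = 2 \<or> c = - 2 \<or> c = - 1 \<or> c = 0 \<or> c\<^sup>2 + c = 1"
    unfolding c_def by (rule cos_unit_fraction_values[OF m'])
  \<comment> \<open>\<open>- 3\<close> and \<open>- 2\<close> are the values of
    \<open>2 Re u - 1\<close> for \<open>u\<close> of order 2 and 3; all conjugates of such a
    \<open>u\<close> have the same real part.\<close>
  have "c = 2 / 3" if "2 * Re (u ^ k') - 1 = - 3" using eq' unfolding c_def[symmetric] that by simp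
  moreover have "c = 1 / 2" if "2 * Re (u ^ k') - 1 = - 2" using eq' unfolding c_def[symmetric] that by simp
  moreover have "c \<noteq> 2 / 3" "c \<noteq> 1 / 2"
    using c by (auto simp: power2_eq_square simp del: eq_divide_eq_numeral1 eq_divide_eq_1)
  ultimately have val': "2 * Re (u ^ k') - 1 \<noteq> - 3" "2 * Re (u ^ k') - 1 \<noteq> - 2"
    by blast+
  from m consider "m = 1" | "m = 2" | "m = 3" | "m = 4" | "m = 5" by force
  then show ?thesis
  proof cases
    case 1
    then have "u = 1" using um by simp
    moreover have "v ^ k = 1" using eq 1 cV by (intro cmod_1_Re_1) auto
    ultimately show ?thesis using vl by simp
  next
    case 2
    then have "u = 1 \<or> u = - 1" using um by (simp add: power2_eq_1_iff)
    moreover have "u \<noteq> 1" using U 2 by auto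
    ultimately have "u = - 1" by simp
    moreover have "u ^ k' \<noteq> 1" using \<open>u \<noteq> 1\<close> ul' by auto
    ultimately have "u ^ k' = - 1" by (metis power_minus1_even power_minus1_odd neg_one_even_power neg_one_odd_power)
    then show ?thesis using val' by simp
  next
    case 3
    have "(u ^ k') ^ 3 = 1" using um 3 by (metis mult.commute power_mult power_one)
    moreover have "u ^ k' \<noteq> 1"
    proof
      assume "u ^ k' = 1"
      then have "u = 1" using ul' by simp
      then show False using U 3 by (simp add: complex_eq_iff cos_120)
    qed
    moreover define z where "z = u ^ k'"
    moreover have "(z - 1) * (z\<^sup>2 + z + 1) = z ^ 3 - 1" by (simp add: algebra_simps eval_nat_numeral)
    ultimately have "z\<^sup>2 + z + 1 = 0" by simp
    moreover have "cmod z = 1" using cU' by (simp add: z_def)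
    moreover have "z \<noteq> 0" using \<open>cmod z = 1\<close> by auto
    ultimately have "z + 1 / z = - 1" by (simp add: field_simps power2_eq_square) (metis add.commute add_eq_0_iff2 add.assoc)
    then have "of_real (2 * Re z) = (of_real (- 1) :: complex)" using unit_complex_add_inverse[OF \<open>cmod z = 1\<close>] by simp
    then have "2 * Re z = - 1" by (simp only: of_real_eq_iff)
    then show ?thesis using val' by (simp add: z_def)
  next
    case 4
    \<comment> \<open>\<open>l\<close> inverts \<open>k\<close> on roots of order 4 and is therefore
      odd; so raising to the power \<open>l\<close> keeps the value \<open>- 1\<close> of a
      square.\<close>
    have "odd l"
    proof
      assume "even l"
      then obtain j where "l = 2 * j" by blast
      then have "u = ((u ^ k)\<^sup>2) ^ j" using ul by (simp add: power_mult)
      also have "(u ^ k)\<^sup>2 = - 1" unfolding U 4 by (simp add: DeMoivre)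
      finally have "u\<^sup>2 = 1" by (simp add: power_mult[symmetric] mult.commute)
      then have "(u ^ k)\<^sup>2 = 1" by (metis mult.commute power_mult power_one)
      then show False unfolding U 4 by (simp add: DeMoivre)
    qed
    have "(u ^ k)\<^sup>2 = - 1" unfolding U 4 by (simp add: DeMoivre)
    then have "u\<^sup>2 = - 1" using \<open>odd l\<close> ul by (metis mult.commute neg_one_odd_power power_mult)
    have "Re (v ^ k) = 0" using eq 4 by simp
    moreover from this have "\<bar>Im (v ^ k)\<bar> = 1" using cV by (simp add: cmod_def)
    then have "Im (v ^ k) * Im (v ^ k) = 1" by (metis abs_mult_self_eq mult_1)
    ultimately have "(v ^ k)\<^sup>2 = - 1" by (simp add: complex_eq_iff power2_eq_square)
    then have "v\<^sup>2 = - 1" using \<open>odd l\<close> vl by (metis mult.commute neg_one_odd_power power_mult)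
    with \<open>u\<^sup>2 = - 1\<close> show ?thesis by blast
  next
    case 5
    have "sin (2 * pi / 5) > 0" by (intro sin_gt_zero) auto
    then have "u \<noteq> 1" using U 5 by (auto simp: complex_eq_iff)
    define a where "a = 2 * cos (2 * pi / 5)"
    define b where "b = 2 * Re (v ^ k)"
    have aa: "a * a + a = 1" using cos_fifth_turn by (simp add: a_def power2_eq_square)
    have ab: "(a - 1) * (b - 1) = 1" using eq 5 by (simp add: a_def b_def)
    \<comment> \<open>The quadratic equation of \<open>a\<close> identifies
      \<open>1 / (a - 1)\<close> as \<open>- a - 2\<close>. Hence
      \<open>b = - a - 1 = a * a - 2\<close>, and \<open>v\<close> is the square of \<open>u\<close>
      up to inversion.\<close>
    have "(a - 1) * (- a - 2) = 1" using aa by (simp add: algebra_simps)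
    then have "b - 1 = - a - 2" using ab by (metis mult_cancel_left mult_zero_left zero_neq_one)
    then have b: "b = a * a - 2" using aa by simp
    have U2: "(u ^ k)\<^sup>2 = cis (2 * (2 * pi / 5))" unfolding U 5 DeMoivre by simp
    have "v ^ k + 1 / v ^ k = of_real b" using cV by (simp add: unit_complex_add_inverse b_def)
    also have "b = 2 * cos (2 * (2 * pi / 5))" unfolding b a_def cos_double_cos
      by (simp add: power2_eq_square)
    also have "of_real \<dots> = (u ^ k)\<^sup>2 + 1 / (u ^ k)\<^sup>2" unfolding U2
      by (subst unit_complex_add_inverse) auto
    finally have "v ^ k = (u ^ k)\<^sup>2 \<or> v ^ k = 1 / (u ^ k)\<^sup>2"
      using U2 by (intro add_inverse_eq_imp) (metis cV norm_zero zero_neq_one, auto)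
    then have "v = u\<^sup>2 \<or> v = 1 / u\<^sup>2"
    proof
      assume "v ^ k = (u ^ k)\<^sup>2"
      then have "v = ((u ^ k) ^ l)\<^sup>2" using vl by (metis mult.commute power_mult)
      then show ?thesis using ul by simp
    next
      assume "v ^ k = 1 / (u ^ k)\<^sup>2"
      then have "v = 1 / ((u ^ k) ^ l)\<^sup>2" using vl by (metis mult.commute power_mult power_one_over)
      then show ?thesis using ul by simp
    qed
    then show ?thesis using um 5 \<open>u \<noteq> 1\<close> by simp
  qed
qed

subsection \<open>Symbol kernels of the two families\<close>

lemma cis_fraction_power_eq_1:
  assumes "d > 0" "d dvd k"
  shows "cis (2 * pi / real d) ^ k = 1"
proof -
  obtain j where "k = d * j" using assms(2) by blast
  moreover have "cis (2 * pi / real d) ^ d = 1" using assms(1) by (simp add: DeMoivre)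
  ultimately show ?thesis by (simp add: power_mult)
qed

lemma cis_fraction_neq_1:
  assumes "d > 1"
  shows "cis (2 * pi / real d) \<noteq> 1"
proof -
  have "cos (2 * pi / real d) < cos 0 \<or> d < 2"
  proof (cases "d < 2")
    case False
    then have "2 * pi / real d \<le> pi" by (simp add: field_simps)
    then show ?thesis using False by (intro disjI1 cos_monotone_0_pi) auto
  qed simp
  then show ?thesis using assms by (auto simp: complex_eq_iff)
qed

lemma triple_set_eq_zero:
  assumes "\<And>x y z. (x, y, z) \<in> K \<Longrightarrow> x = 0 \<and> y = 0 \<and> z = 0" "(0, 0, 0) \<in> K"
  shows "K = {(0, 0, 0)}"
  using assms by auto

text \<open>The symbol matrix written row by row for the orbits \<open>x\<close>, \<open>y\<close>,
  \<open>z\<close>; the reciprocals in the second row belong to the edges between \<open>x\<close>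
  and \<open>y\<close> read backwards.\<close>

definition T1_symbol_kernel :: "nat \<Rightarrow> nat \<Rightarrow> nat \<Rightarrow> complex \<Rightarrow> (complex \<times> complex \<times> complex) set" where
  "T1_symbol_kernel n a b w = {(x, y, z). (w ^ a + w ^ b) * y + z = 0 \<and>
     (1 / w ^ a + 1 / w ^ b) * x + z = 0 \<and> x + y + w ^ (n div 2) * z = 0}"

definition T4_symbol_kernel :: "nat \<Rightarrow> nat \<Rightarrow> nat \<Rightarrow> complex \<Rightarrow> (complex \<times> complex \<times> complex) set" where
  "T4_symbol_kernel n a b w = {(x, y, z). (w ^ a + 1 / w ^ a) * x + z = 0 \<and>
     (w ^ b + 1 / w ^ b) * y + z = 0 \<and> x + y + w ^ (n div 2) * z = 0}"

text \<open>Elimination leaves the product \<open>(u + v) (1 - e u) (1 - e v)\<close>. Conditions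
  (i) and (ii) together say that \<open>n / 2 + a\<close> and \<open>n / 2 + b\<close> are coprime
  to \<open>n\<close>, so neither \<open>e u\<close> nor \<open>e v\<close> is \<open>1\<close>;
  condition (iii) prevents \<open>w ^ (b - a) = - 1\<close>, that is,
  \<open>u + v = 0\<close>.\<close>

lemma T1_symbol_kernel_trivial:
  assumes n: "even n" "n > 0" and ab: "a < b"
    and gcd: "gcd (n div 2) a = 1" "gcd (n div 2) b = 1"
    and par: "\<not> [a = n div 2] (mod 2)" "\<not> [b = n div 2] (mod 2)"
    and mult: "multiplicity 2 (b - a) \<ge> multiplicity 2 n"
    and w: "w ^ n = 1" "w \<noteq> 1"
  shows "T1_symbol_kernel n a b w = {(0, 0, 0)}"
proof -
  define h where "h = n div 2"
  have nh: "n = 2 * h" using n by (simp add: h_def)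
  have w0: "w \<noteq> 0" using w n by (auto simp: zero_power)
  define e where "e = w ^ h"
  define u where "u = w ^ a"
  define v where "v = w ^ b"
  have uv0: "u \<noteq> 0" "v \<noteq> 0" using w0 by (simp_all add: u_def v_def)
  have ee: "e * e = 1" using w(1) unfolding nh e_def by (metis mult_2 power_add)
  have neq: "w ^ (h + c) \<noteq> 1" if c: "gcd h c = 1" "\<not> [c = h] (mod 2)" for c
  proof
    assume "w ^ (h + c) = 1"
    then have "w ^ gcd (h + c) n = 1" using w(1) by (rule root_of_unity_gcd)
    moreover have "odd (h + c)" using c(2) by (auto simp: cong_def) presburger+
    then have "coprime (h + c) 2" by simp
    moreover have "gcd (h + c) h = gcd h c" by (metis add.commute gcd.commute gcd_add1)
    then have "coprime (h + c) h" using c(1) by (metis coprime_iff_gcd_eq_1)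
    ultimately have "w = 1" unfolding nh by simp
    with w show False by simp
  qed
  have eu: "e * u \<noteq> 1" "e * v \<noteq> 1"
    using neq[of a] neq[of b] gcd par by (simp_all add: e_def u_def v_def power_add h_def)
  have suv: "u + v \<noteq> 0"
  proof
    assume "u + v = 0"
    moreover have "v = u * w ^ (b - a)" using ab by (simp add: u_def v_def power_add[symmetric])
    ultimately have "u * (1 + w ^ (b - a)) = 0" by (simp add: algebra_simps)
    then have neg: "w ^ (b - a) = - 1" using uv0 by (simp add: add_eq_0_iff)
    \<comment> \<open>\<open>q\<close> is the odd part of \<open>n\<close>. As \<open>b - a\<close>
      contains the full power of 2 in \<open>n\<close>, the \<open>q\<close>-th power of
      \<open>w ^ (b - a)\<close> is \<open>1\<close>, whereas an odd power of \<open>- 1\<close> is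
      not.\<close>
    obtain q where q: "n = 2 ^ multiplicity 2 n * q" "\<not> 2 dvd q"
      using multiplicity_decompose'[of n 2] n by auto
    have "2 ^ multiplicity 2 n dvd b - a" using mult by (rule multiplicity_dvd')
    then obtain t where t: "b - a = 2 ^ multiplicity 2 n * t" by blast
    have "(w ^ (b - a)) ^ q = w ^ (n * t)" unfolding t
      by (subst (2) q(1)) (simp add: power_mult[symmetric] ac_simps)
    also have "\<dots> = 1" using w by (simp add: power_mult)
    finally show False unfolding neg using q(2) by simp
  qed
  have "x = 0 \<and> y = 0 \<and> z = 0" if "(x, y, z) \<in> T1_symbol_kernel n a b w" for x y z
  proof -
    have 1: "(u + v) * y + z = 0" and 2: "(1 / u + 1 / v) * x + z = 0" and 3: "x + y + e * z = 0"
      using that by (simp_all add: T1_symbol_kernel_def u_def v_def e_def h_def)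
    have z: "z = - ((u + v) * y)" using 1 by (simp add: add_eq_0_iff)
    have "(u + v) * (x - u * v * y) = u * v * ((1 / u + 1 / v) * x + z)"
      unfolding z using uv0 by (simp add: field_simps)
    then have x: "x = u * v * y" using 2 suv by simp
    have "(1 - e * u) * (1 - e * v) * y = (x + y + e * z) + (e * e - 1) * u * v * y"
      unfolding x z by (simp add: algebra_simps)
    then have "y = 0" using 3 ee eu by simp
    then show ?thesis using x z by simp
  qed
  moreover have "(0, 0, 0) \<in> T1_symbol_kernel n a b w" unfolding T1_symbol_kernel_def by simp
  ultimately show ?thesis by (rule triple_set_eq_zero)
qed

text \<open>Each failing condition makes a factor of the determinant vanish at an explicit root: a
  common divisor \<open>p > 1\<close> of \<open>n / 2 + c\<close> and \<open>n\<close> gives a root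
  of order \<open>p\<close> with \<open>e w ^ c = 1\<close>, and too small a power of 2 in
  \<open>b - a\<close> gives a root of order \<open>2 ^ (k + 1)\<close> with
  \<open>w ^ (b - a) = - 1\<close>.\<close>

lemma T1_symbol_kernel_nontrivial:
  assumes n: "even n" "n > 0" and ab: "a < b"
    and fails: "\<not> (gcd (n div 2) a = 1 \<and> gcd (n div 2) b = 1 \<and>
       \<not> [a = n div 2] (mod 2) \<and> \<not> [b = n div 2] (mod 2) \<and>
       multiplicity 2 (b - a) \<ge> multiplicity 2 n)"
  obtains w where "w ^ n = 1" "w \<noteq> 1" "T1_symbol_kernel n a b w \<noteq> {(0, 0, 0)}"
proof -
  define h where "h = n div 2"
  have nh: "n = 2 * h" using n by (simp add: h_def)
  note witness = that
  have fin: thesis if c: "c = a \<or> c = b" "\<not> (gcd h c = 1 \<and> \<not> [c = h] (mod 2))" for c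
  proof -
    have "\<not> coprime (h + c) n"
    proof
      assume cop: "coprime (h + c) n"
      then have "odd (h + c)" unfolding nh by simp
      then have "\<not> [c = h] (mod 2)" by (auto simp: cong_def)
      moreover have "gcd (h + c) h = gcd h c" by (metis add.commute gcd.commute gcd_add1)
      moreover have "coprime (h + c) h" using cop unfolding nh by simp
      ultimately have "\<not> [c = h] (mod 2)" "gcd h c = 1" by (metis coprime_iff_gcd_eq_1)+
      then show False using c(2) by simp
    qed
    then obtain p where p: "p dvd h + c" "p dvd n" "p \<noteq> 1"
      by (metis gcd_dvd1 gcd_dvd2 coprime_iff_gcd_eq_1)
    then have p1: "p > 1" using n by (cases "p = 0") auto
    define w where "w = cis (2 * pi / real p)"
    have w: "w ^ n = 1" "w \<noteq> 1" "w ^ (h + c) = 1"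
      using cis_fraction_power_eq_1[of p] cis_fraction_neq_1[OF p1] p p1 by (simp_all add: w_def)
    have w0: "w \<noteq> 0" by (simp add: w_def)
    define e where "e = w ^ h"
    define u where "u = w ^ a"
    define v where "v = w ^ b"
    have uv0: "u \<noteq> 0" "v \<noteq> 0" using w0 by (simp_all add: u_def v_def)
    have ee: "e * e = 1" using w(1) unfolding nh e_def by (metis mult_2 power_add)
    have "e * u = 1 \<or> e * v = 1" using w(3) c(1) by (auto simp: e_def u_def v_def power_add)
    then have "(1 - e * u) * (1 - e * v) - (e * e - 1) * u * v = 0" using ee by auto
    then have "u * v + 1 + e * - (u + v) = 0" by (simp add: algebra_simps)
    moreover have "(1 / u + 1 / v) * (u * v) + - (u + v) = 0" using uv0 by (simp add: field_simps)
    ultimately have "(u * v, 1, - (u + v)) \<in> T1_symbol_kernel n a b w"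
      by (simp add: T1_symbol_kernel_def u_def v_def e_def h_def)
    then have "T1_symbol_kernel n a b w \<noteq> {(0, 0, 0)}" by auto
    then show thesis using witness w by blast
  qed
  show thesis
  proof (cases "gcd h a = 1 \<and> gcd h b = 1 \<and> \<not> [a = h] (mod 2) \<and> \<not> [b = h] (mod 2)")
    case False
    then show ?thesis using fin by blast
  next
    case True
    define k where "k = multiplicity 2 (b - a)"
    have k: "k < multiplicity 2 n" using True fails unfolding k_def h_def by auto
    obtain q where q: "b - a = 2 ^ k * q" "\<not> 2 dvd q"
      using multiplicity_decompose'[of "b - a" 2] ab unfolding k_def by auto
    define w where "w = cis (2 * pi / real (2 ^ (k + 1)))"
    have "2 ^ (k + 1) dvd n" using k by (intro multiplicity_dvd') simp
    then have wn: "w ^ n = 1" unfolding w_def by (intro cis_fraction_power_eq_1) auto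
    have w1: "w \<noteq> 1" unfolding w_def by (intro cis_fraction_neq_1) (metis add.commute one_less_power one_less_numeral_iff semiring_norm(76) zero_less_Suc plus_1_eq_Suc)
    have "w ^ (2 ^ k) = cis pi" unfolding w_def DeMoivre by (simp add: field_simps)
    then have "w ^ (b - a) = - 1" unfolding q(1) power_mult using q(2) by simp
    then have "w ^ a + w ^ b = 0"
      using ab by (metis add.right_inverse le_add_diff_inverse less_imp_le mult_minus1_right power_add)
    moreover from this have "1 / w ^ a + 1 / w ^ b = 0"
      by (simp add: add_eq_0_iff)
    ultimately have "(1, - 1, 0) \<in> T1_symbol_kernel n a b w" by (simp add: T1_symbol_kernel_def)
    then have "T1_symbol_kernel n a b w \<noteq> {(0, 0, 0)}" by auto
    then show ?thesis using that wn w1 by blast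
  qed
qed

text \<open>Conditions (iv) and (v) alone exclude the solutions of the cosine relation with \<open>u = v = 1\<close>.\<close>

lemma T4_trivial_solution:
  fixes w :: complex
  assumes "gcd h (gcd a b) = 1" "odd h \<Longrightarrow> even a \<or> even b"
    and "w ^ (2 * h) = 1" "w ^ (h + a) = 1" "w ^ (h + b) = 1"
  shows "w = 1"
proof (cases "w ^ h = 1")
  case True
  then have "w ^ a = 1" "w ^ b = 1" using assms(4,5) by (simp_all add: power_add)
  then have "w ^ gcd h (gcd a b) = 1" using True by (intro root_of_unity_gcd)
  then show ?thesis using assms(1) by simp
next
  case False
  have "(w ^ h)\<^sup>2 = 1" using assms(3) by (simp add: power_mult[symmetric] mult.commute)
  then have h: "w ^ h = - 1" using False by (simp add: power2_eq_1_iff)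
  \<comment> \<open>Here all three powers of \<open>w\<close> are \<open>- 1\<close>. Squaring
    removes the signs, so the gcd condition leaves only \<open>w = - 1\<close>, and then
    \<open>h\<close>, \<open>a\<close> and \<open>b\<close> are all odd.\<close>
  then have "- (w ^ a) = 1" "- (w ^ b) = 1" using assms(4,5) by (simp_all add: power_add)
  then have ab: "w ^ a = - 1" "w ^ b = - 1" by (metis minus_minus)+
  have "(w\<^sup>2) ^ k = (w ^ k)\<^sup>2" for k by (metis mult.commute power_mult)
  then have "(w\<^sup>2) ^ h = 1" "(w\<^sup>2) ^ a = 1" "(w\<^sup>2) ^ b = 1" using h ab by simp_all
  then have "(w\<^sup>2) ^ gcd h (gcd a b) = 1" by (intro root_of_unity_gcd)
  then have "w = 1 \<or> w = - 1" using assms(1) by (simp add: power2_eq_1_iff)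
  then have "w = - 1" using False by auto
  then have "odd h" "odd a" "odd b" using h ab by (auto simp: minus_one_power_iff split: if_splits)
  then show ?thesis using assms(2) by blast
qed

text \<open>With \<open>A = w ^ a + 1 / w ^ a\<close> and \<open>B = w ^ b + 1 / w ^ b\<close> the
  matrix is singular iff \<open>e A B = A + B\<close>, and \<open>e e = 1\<close> turns this into
  the cosine relation for \<open>e w ^ a\<close> and \<open>e w ^ b\<close>. Of its solutions,
  \<open>u = v = 1\<close> contradicts (iv) and (v), squares equal to \<open>- 1\<close> contradict
  (iv) and (vi), and order 5 contradicts (vii) once \<open>w\<close> itself is known to have order
  5.\<close>

lemma T4_symbol_kernel_trivial:
  assumes n: "even n" "n > 0"
    and gcd: "gcd (n div 2) (gcd a b) = 1"
    and par: "\<not> 4 dvd n \<longrightarrow> even a \<or> even b" "4 dvd n \<longrightarrow> even a \<noteq> even b"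
    and five: "10 dvd n \<longrightarrow> 5 dvd int a \<or> 5 dvd int b \<or> 5 dvd int a - int b \<or> 5 dvd int a + int b"
    and w: "w ^ n = 1" "w \<noteq> 1"
  shows "T4_symbol_kernel n a b w = {(0, 0, 0)}"
proof -
  define h where "h = n div 2"
  have nh: "n = 2 * h" using n by (simp add: h_def)
  have g: "gcd h (gcd a b) = 1" using gcd by (simp add: h_def)
  have par': "odd h \<Longrightarrow> even a \<or> even b" "even h \<Longrightarrow> even a \<noteq> even b"
    using par unfolding nh by auto
  have w0: "w \<noteq> 0" using w n by (auto simp: zero_power)
  define e where "e = w ^ h"
  define u where "u = w ^ a"
  define v where "v = w ^ b"
  have uv0: "u \<noteq> 0" "v \<noteq> 0" using w0 by (simp_all add: u_def v_def)
  have ee: "e * e = 1" using w(1) unfolding nh e_def by (metis mult_2 power_add)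
  have not_rel: "\<not> cosine_relation (w ^ (h + a)) (w ^ (h + b))"
  proof
    assume "cosine_relation (w ^ (h + a)) (w ^ (h + b))"
    then consider (one) "w ^ (h + a) = 1" "w ^ (h + b) = 1"
      | (four) "(w ^ (h + a))\<^sup>2 = - 1" "(w ^ (h + b))\<^sup>2 = - 1"
      | (five) "(w ^ (h + a)) ^ 5 = 1" "w ^ (h + a) \<noteq> 1"
         "w ^ (h + b) = (w ^ (h + a))\<^sup>2 \<or> w ^ (h + b) = 1 / (w ^ (h + a))\<^sup>2"
      using cosine_relation_roots_of_unity[OF n(2) w(1)] by blast
    then show False
    proof cases
      case one
      then show False using T4_trivial_solution[OF g par'(1)] w nh by blast
    next
      case four
      have h1: "(w\<^sup>2) ^ h = 1" using w(1) unfolding nh by (simp add: power_mult)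
      have sq: "(w ^ k)\<^sup>2 = (w\<^sup>2) ^ k" for k by (metis mult.commute power_mult)
      have "(w\<^sup>2) ^ (h + a) = - 1" "(w\<^sup>2) ^ (h + b) = - 1" using four sq by metis+
      then have ab: "(w\<^sup>2) ^ a = - 1" "(w\<^sup>2) ^ b = - 1" unfolding power_add h1 by simp_all
      have "((w\<^sup>2)\<^sup>2) ^ k = ((w\<^sup>2) ^ k)\<^sup>2" for k by (metis mult.commute power_mult)
      then have "((w\<^sup>2)\<^sup>2) ^ gcd h (gcd a b) = 1" using h1 ab by (intro root_of_unity_gcd) simp_all
      then have "w\<^sup>2 = 1 \<or> w\<^sup>2 = - 1" unfolding g power_one_right power2_eq_1_iff .
      then have "w\<^sup>2 = - 1" using ab by auto
      then show False using h1 ab par' by (auto simp: minus_one_power_iff split: if_splits)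
    next
      case five
      have c: "(w ^ 5) ^ k = (w ^ k) ^ 5" for k by (metis mult.commute power_mult)
      have "(w ^ (h + b)) ^ 5 = 1"
        using five(1,3) by (metis mult.commute power_mult power_one power_one_over)
      moreover have "(w ^ 5) ^ (2 * h) = 1" unfolding c using w(1) nh by simp
      \<comment> \<open>The first case, applied to \<open>w ^ 5\<close> instead of \<open>w\<close>,
        shows that \<open>w\<close> has order 5; from here on exponents may be read modulo
        5.\<close>
      ultimately have w5: "w ^ 5 = 1" using T4_trivial_solution[OF g par'(1), of "w ^ 5"] five(1) c by simp
      have dv: "5 dvd k" if "w ^ k = 1" for k
      proof (rule ccontr)
        assume "\<not> 5 dvd k"
        then have "coprime k 5" by (intro prime_imp_coprime[THEN coprime_commute[THEN iffD1]]) auto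
        then show False using root_of_unity_gcd[OF that w5] w(2) by simp
      qed
      have dv': "w ^ k = 1" if "5 dvd k" for k using that w5 by (auto simp: power_mult elim!: dvdE)
      have "5 dvd h" using dv[OF w(1)] unfolding nh by presburger
      then have e1: "w ^ h = 1" and "10 dvd n" using dv' unfolding nh by auto
      have na: "\<not> 5 dvd a" using five(2) dv' e1 by (auto simp: power_add)
      \<comment> \<open>Now \<open>b\<close> is congruent to \<open>2 a\<close> or
        \<open>- 2 a\<close> modulo 5 while 5 does not divide \<open>a\<close>, which is what (vii)
        forbids. Below, \<open>3 a\<close> stands for \<open>- 2 a\<close>, which keeps the
        exponents natural.\<close>
      have "w ^ b = w ^ (2 * a) \<or> w ^ b = 1 / w ^ (2 * a)" using five(3) e1
        by (simp add: power_add power_mult[symmetric] mult.commute)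
      moreover have "w ^ (3 * a) * w ^ (2 * a) = 1" using dv'[of "5 * a"] by (simp add: power_add[symmetric])
      ultimately have "w ^ (b + 3 * a) = 1 \<or> w ^ (b + 2 * a) = 1"
        using w0 by (auto simp: power_add field_simps)
      then have "5 dvd b + 3 * a \<or> 5 dvd b + 2 * a" using dv by blast
      with na \<open>10 dvd n\<close> assms(6) show False by presburger
    qed
  qed
  have "x = 0 \<and> y = 0 \<and> z = 0" if "(x, y, z) \<in> T4_symbol_kernel n a b w" for x y z
  proof -
    define A where "A = u + 1 / u"
    define B where "B = v + 1 / v"
    have 1: "A * x + z = 0" and 2: "B * y + z = 0" and 3: "x + y + e * z = 0"
      using that by (simp_all add: T4_symbol_kernel_def u_def v_def e_def h_def A_def B_def)
    have ne: "e * A * B \<noteq> A + B"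
    proof
      assume eq: "e * A * B = A + B"
      have e0: "e \<noteq> 0" using ee by auto
      have uA: "u * A = u\<^sup>2 + 1" and vB: "v * B = v\<^sup>2 + 1"
        using uv0 by (simp_all add: A_def B_def field_simps power2_eq_square)
      have "((e * u)\<^sup>2 - e * u + 1) * ((e * v)\<^sup>2 - e * v + 1) = (u\<^sup>2 + 1 - e * u) * (v\<^sup>2 + 1 - e * v)"
        using ee by (simp add: power_mult_distrib power2_eq_square[of e] algebra_simps)
      also have "\<dots> = u * v * (A * B - e * (A + B) + e * e)"
        unfolding uA[symmetric] vB[symmetric] by (simp add: algebra_simps)
      also have "\<dots> = (e * u) * (e * v)" unfolding eq[symmetric] using ee by (simp add: algebra_simps)
      finally have "cosine_relation (e * u) (e * v)" by (simp add: cosine_relation_def)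
      then show False using not_rel by (simp add: power_add e_def u_def v_def)
    qed
    have "z * (e * A * B - (A + B)) = A * B * (x + y + e * z) - B * (A * x + z) - A * (B * y + z)"
      by (simp add: algebra_simps)
    then have "z = 0" using 1 2 3 ne by simp
    moreover from this have "A \<noteq> 0 \<Longrightarrow> x = 0" "B \<noteq> 0 \<Longrightarrow> y = 0" "x = - y"
      using 1 2 3 by (auto simp: add_eq_0_iff2)
    ultimately show ?thesis using ne by (cases "A = 0"; cases "B = 0") auto
  qed
  moreover have "(0, 0, 0) \<in> T4_symbol_kernel n a b w" unfolding T4_symbol_kernel_def by simp
  ultimately show ?thesis by (rule triple_set_eq_zero)
qed

text \<open>The hypothesis is the vanishing of the determinant. It makes \<open>A\<close> and
  \<open>B\<close> vanish together; if they do, the \<open>x\<close> and \<open>y\<close> orbits can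
  carry opposite values, and otherwise the first two rows dictate the vector.\<close>

lemma T4_symbol_kernel_nontrivialI:
  assumes "w ^ (n div 2) * ((w ^ a + 1 / w ^ a) * (w ^ b + 1 / w ^ b)) = (w ^ a + 1 / w ^ a) + (w ^ b + 1 / w ^ b)"
  shows "T4_symbol_kernel n a b w \<noteq> {(0, 0, 0)}"
proof -
  define A B e where "A = w ^ a + 1 / w ^ a" and "B = w ^ b + 1 / w ^ b" and "e = w ^ (n div 2)"
  have eq: "e * (A * B) = A + B" using assms by (simp add: A_def B_def e_def)
  have K: "(x, y, z) \<in> T4_symbol_kernel n a b w \<longleftrightarrow> A * x + z = 0 \<and> B * y + z = 0 \<and> x + y + e * z = 0" for x y z
    by (simp add: T4_symbol_kernel_def A_def B_def e_def)
  show ?thesis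
  proof (cases "A = 0 \<and> B = 0")
    case True
    then have "(1, - 1, 0) \<in> T4_symbol_kernel n a b w" unfolding K by simp
    then show ?thesis by auto
  next
    case False
    then have "A \<noteq> 0" "B \<noteq> 0" using eq by auto
    then have "e = 1 / A + 1 / B" using eq by (simp add: field_simps)
    then have "(1 / A, 1 / B, - 1) \<in> T4_symbol_kernel n a b w" unfolding K using \<open>A \<noteq> 0\<close> \<open>B \<noteq> 0\<close> by simp
    then show ?thesis by auto
  qed
qed

text \<open>If (iv) fails, a root whose order divides \<open>n / 2\<close>, \<open>a\<close> and
  \<open>b\<close> gives \<open>A = B = 2\<close>. If (v) fails, or (vi) with \<open>a\<close> and
  \<open>b\<close> even, \<open>w = - 1\<close> works; if (vi) fails with both odd,
  \<open>w = \<i>\<close> gives \<open>A = B = 0\<close>. If (vii) fails, \<open>w\<close> of order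
  5 makes \<open>A\<close> and \<open>B\<close> the two different roots of
  \<open>X^2 + X - 1\<close>, so \<open>A B = A + B = - 1\<close>.\<close>

lemma T4_symbol_kernel_nontrivial:
  assumes n: "even n" "n > 0"
    and fails: "\<not> (gcd (n div 2) (gcd a b) = 1 \<and>
       (\<not> 4 dvd n \<longrightarrow> even a \<or> even b) \<and> (4 dvd n \<longrightarrow> even a \<noteq> even b) \<and>
       (10 dvd n \<longrightarrow> 5 dvd int a \<or> 5 dvd int b \<or> 5 dvd int a - int b \<or> 5 dvd int a + int b))"
  obtains w where "w ^ n = 1" "w \<noteq> 1" "T4_symbol_kernel n a b w \<noteq> {(0, 0, 0)}"
proof -
  define h where "h = n div 2"
  have nh: "n = 2 * h" using n by (simp add: h_def)
  consider (iv) "gcd h (gcd a b) \<noteq> 1" | (v) "odd h" "odd a" "odd b" | (vi) "even h" "even a = even b"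
    | (vii) "10 dvd n" "\<not> 5 dvd int a" "\<not> 5 dvd int b" "\<not> 5 dvd int a - int b" "\<not> 5 dvd int a + int b"
    using fails unfolding h_def[symmetric] nh by fastforce
  then show thesis
  proof cases
    case iv
    define d where "d = gcd h (gcd a b)"
    have d: "d dvd h" "d dvd a" "d dvd b"
      unfolding d_def by (meson gcd_dvd1 gcd_dvd2 dvd_trans)+
    have d1: "d > 1" using iv d(1) n nh
      by (cases "d = 0") (auto simp: d_def[symmetric])
    define w where "w = cis (2 * pi / real d)"
    have w: "w ^ k = 1" if "d dvd k" for k unfolding w_def using that d1 by (intro cis_fraction_power_eq_1) auto
    show thesis
    proof (rule that[of w])
      show "w \<noteq> 1" unfolding w_def by (rule cis_fraction_neq_1[OF d1])
      show "T4_symbol_kernel n a b w \<noteq> {(0, 0, 0)}"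
        using w d by (intro T4_symbol_kernel_nontrivialI) (simp add: h_def)
    qed (use w d in \<open>simp add: nh\<close>)
  next
    case v
    then have "T4_symbol_kernel n a b (- 1) \<noteq> {(0, 0, 0)}"
      by (intro T4_symbol_kernel_nontrivialI) (simp add: h_def)
    then show thesis using that[of "- 1"] n by simp
  next
    case vi
    show thesis
    proof (cases "even a")
      case True
      then have "T4_symbol_kernel n a b (- 1) \<noteq> {(0, 0, 0)}"
        using vi by (intro T4_symbol_kernel_nontrivialI) (simp add: h_def)
      then show thesis using that[of "- 1"] n by simp
    next
      case False
      have odd: "\<i> ^ k + 1 / \<i> ^ k = 0" if "odd k" for k
        using that by (auto elim!: oddE simp: power_add power_mult minus_one_power_iff)
      have "odd b" using vi False by simp
      then have "T4_symbol_kernel n a b \<i> \<noteq> {(0, 0, 0)}"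
        by (intro T4_symbol_kernel_nontrivialI) (simp only: odd[OF False] odd[OF \<open>odd b\<close>] mult_zero_left mult_zero_right add_0_left add_0_right)
      moreover have "\<i> ^ n = 1" unfolding nh power_mult using vi by simp
      ultimately show thesis using that[of \<i>] by (metis complex_i_not_one)
    qed
  next
    case vii
    define w where "w = cis (2 * pi / real (5 :: nat))"
    have w5: "w ^ 5 = 1" unfolding w_def by (rule cis_fraction_power_eq_1) auto
    have w1: "w \<noteq> 1" unfolding w_def by (rule cis_fraction_neq_1) simp
    have w0: "w \<noteq> 0" by (simp add: w_def)
    have dv: "5 dvd k" if "w ^ k = 1" for k
    proof (rule ccontr)
      assume "\<not> 5 dvd k"
      then have "coprime k 5" by (intro prime_imp_coprime[THEN coprime_commute[THEN iffD1]]) auto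
      then show False using root_of_unity_gcd[OF that w5] w1 by simp
    qed
    have dv': "w ^ k = 1" if "5 dvd k" for k using that w5 by (auto simp: power_mult elim!: dvdE)
    have quad: "(w ^ k + 1 / w ^ k)\<^sup>2 + (w ^ k + 1 / w ^ k) = 1" if "\<not> 5 dvd k" for k
    proof -
      define z where "z = w ^ k"
      have z: "z \<noteq> 0" "z \<noteq> 1" using that dv w0 by (auto simp: z_def)
      have "z ^ 5 = 1" unfolding z_def by (metis w5 mult.commute power_mult power_one)
      moreover have "(z - 1) * (z^4 + z^3 + z^2 + z + 1) = z ^ 5 - 1"
        by (simp add: algebra_simps eval_nat_numeral)
      ultimately have "z^4 + z^3 + z^2 + z + 1 = 0" using z by simp
      moreover have "(z + 1 / z)\<^sup>2 + (z + 1 / z) - 1 = (z^4 + z^3 + z^2 + z + 1) / z\<^sup>2"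
        using z by (simp add: field_simps power2_eq_square power3_eq_cube power4_eq_xxxx)
      ultimately show ?thesis by (simp add: z_def)
    qed
    define A B where "A = w ^ a + 1 / w ^ a" and "B = w ^ b + 1 / w ^ b"
    have A: "A\<^sup>2 + A = 1" and B: "B\<^sup>2 + B = 1" using quad[of a] quad[of b] vii int_dvd_int_iff[of 5 a] int_dvd_int_iff[of 5 b] unfolding A_def B_def by simp_all
    \<comment> \<open>Equality would make \<open>a\<close> congruent to \<open>b\<close> or
      \<open>- b\<close> modulo 5; the exponent \<open>4 * b\<close> stands for
      \<open>- b\<close>.\<close>
    have "A \<noteq> B"
    proof
      assume "A = B"
      then have "w ^ a = w ^ b \<or> w ^ a = 1 / w ^ b"
        unfolding A_def B_def using w0 by (intro add_inverse_eq_imp) auto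
      moreover have "w ^ b * w ^ (4 * b) = 1" using dv'[of "5 * b"] by (simp add: power_add[symmetric])
      ultimately have "w ^ (a + 4 * b) = 1 \<or> w ^ (a + b) = 1"
        using w0 by (auto simp: power_add)
      then have "5 dvd a + 4 * b \<or> 5 dvd a + b" using dv by blast
      with vii show False by presburger
    qed
    have "(A - B) * (A + B + 1) = (A\<^sup>2 + A) - (B\<^sup>2 + B)" by (simp add: algebra_simps power2_eq_square)
    then have "A + B + 1 = 0" using A B \<open>A \<noteq> B\<close> by simp
    then have AB: "B = - 1 - A" by (simp add: algebra_simps eq_neg_iff_add_eq_0)
    have "w ^ h * (A * B) = A + B" unfolding AB using A dv'[of h] vii(1) nh
      by (simp add: algebra_simps power2_eq_square)
    then have "T4_symbol_kernel n a b w \<noteq> {(0, 0, 0)}"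
      by (intro T4_symbol_kernel_nontrivialI) (simp add: h_def A_def B_def)
    moreover have "w ^ n = 1" using dv' vii(1) by (metis dvd_trans dvd_triv_right mult_2 numeral_Bit0 numeral_times_numeral dvd_def)
    ultimately show thesis using that w1 by blast
  qed
qed

subsection \<open>Nut graphs via null functions\<close>

text \<open>The kernel of the adjacency matrix without an enumeration of the vertices. The value
  type is left open because real and complex functions are both used.\<close>

definition null_function :: "'a pair_pre_digraph \<Rightarrow> ('a \<Rightarrow> 'b :: comm_monoid_add) \<Rightarrow> bool" where
  "null_function G f \<longleftrightarrow> (\<forall>u \<in> pverts G. (\<Sum>v | v \<in> pverts G \<and> (u, v) \<in> parcs G. f v) = 0)"

lemma kernel_dim_eq_1I:
  fixes A :: "'a :: field mat"
  assumes A: "A \<in> carrier_mat n n" and x: "x \<in> carrier_vec n" "i < n" "x $ i \<noteq> 0"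
    and ker: "mat_kernel A = range (\<lambda>c. c \<cdot>\<^sub>v x)"
  shows "kernel_dim A = 1"
proof -
  interpret kernel n n A by unfold_locales (rule A)
  have xk: "{x} \<subseteq> mat_kernel A" unfolding ker by (auto intro: image_eqI[of _ _ 1])
  have idx: "lincomb a {x} $ j = a x * x $ j" if "j < n" for a j
    using lincomb_index[OF that xk] by simp
  have lc: "lincomb a {x} \<in> mat_kernel A" for a using xk by (intro Ker.lincomb_closed) auto
  have "\<not> Ker.lin_dep {x}"
  proof
    assume "Ker.lin_dep {x}"
    then obtain a B y where "B \<subseteq> {x}" "y \<in> B" "a y \<noteq> 0" "lincomb a B = 0\<^sub>v n"
      unfolding Ker.lin_dep_def by auto
    then have "lincomb a {x} = 0\<^sub>v n" "a x \<noteq> 0" by (auto simp: subset_singleton_iff)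
    then show False using idx[OF x(2), of a] x by simp
  qed
  moreover have "span {x} = mat_kernel A"
  proof
    show "span {x} \<subseteq> mat_kernel A" using xk by (rule Ker.span_is_subset2)
    show "mat_kernel A \<subseteq> span {x}"
    proof
      fix y assume "y \<in> mat_kernel A"
      then obtain c where y: "y = c \<cdot>\<^sub>v x" unfolding ker by blast
      have "dim_vec (lincomb (\<lambda>_. c) {x}) = n"
        using lc[of "\<lambda>_. c"] unfolding mat_kernel[OF A] by auto
      then have "y = lincomb (\<lambda>_. c) {x}" using idx x by (intro eq_vecI) (auto simp: y)
      then show "y \<in> span {x}" unfolding Ker.span_def by auto
    qed
  qed
  ultimately have "basis {x}" unfolding Ker.basis_def using xk by auto
  then have "dim = card {x}" by (intro Ker.dim_basis) auto
  then show ?thesis by simp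
qed

text \<open>An enumeration \<open>vs\<close> identifies vectors with the restrictions of functions
  to the vertices. The vertex set must be nonempty: on the empty one the right-hand side holds
  vacuously, while the nullity is zero.\<close>

lemma nut_graph_iff_null_function:
  assumes fin: "finite (pverts G)" and ne: "pverts G \<noteq> {}"
  shows "nut_graph G \<longleftrightarrow> (\<exists>g :: 'a \<Rightarrow> real. null_function G g \<and> (\<forall>u \<in> pverts G. g u \<noteq> 0) \<and>
     (\<forall>f :: 'a \<Rightarrow> real. null_function G f \<longrightarrow> (\<exists>c. \<forall>u \<in> pverts G. f u = c * g u)))"
proof -
  define fv where "fv vs f = vec (length vs) (\<lambda>i. f (vs ! i))" for vs :: "'a list" and f :: "'a \<Rightarrow> real"
  have fvc [simp]: "fv vs f \<in> carrier_vec (length vs)" for vs f by (simp add: fv_def)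
  have A [simp]: "adjacency_matrix G vs \<in> carrier_mat (length vs) (length vs)" for vs
    by (simp add: adjacency_matrix_def)
  have ker: "fv vs f \<in> mat_kernel (adjacency_matrix G vs) \<longleftrightarrow> null_function G f"
    if vs: "distinct vs" "set vs = pverts G" for vs f
  proof -
    have inj: "inj_on ((!) vs) {..<length vs}" using vs(1) by (simp add: inj_on_nth)
    have im: "(!) vs ` {..<length vs} = pverts G" using vs(2) by (auto simp: set_conv_nth)
    define y where "y = adjacency_matrix G vs *\<^sub>v fv vs f"
    have dim: "dim_vec y = length vs" by (simp add: y_def adjacency_matrix_def)
    have y: "y $ i = (\<Sum>v | v \<in> pverts G \<and> (vs ! i, v) \<in> parcs G. f v)"
      if i: "i < length vs" for i
    proof -
      have "y $ i = (\<Sum>j<length vs. if (vs ! i, vs ! j) \<in> parcs G then f (vs ! j) else 0)"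
        using i by (auto simp: y_def adjacency_matrix_def fv_def scalar_prod_def lessThan_atLeast0 intro!: sum.cong)
      also have "\<dots> = (\<Sum>v\<in>pverts G. if (vs ! i, v) \<in> parcs G then f v else 0)"
        unfolding im[symmetric] sum.reindex[OF inj] by simp
      also have "\<dots> = (\<Sum>v | v \<in> pverts G \<and> (vs ! i, v) \<in> parcs G. f v)"
        using fin by (subst sum.inter_filter[symmetric]) auto
      finally show ?thesis .
    qed
    have "y = 0\<^sub>v (length vs) \<longleftrightarrow> (\<forall>i < length vs. y $ i = 0)" using dim by (auto simp: vec_eq_iff)
    also have "\<dots> \<longleftrightarrow> null_function G f"
      unfolding null_function_def vs(2)[symmetric] all_set_conv_all_nth using y vs(2) by simp
    finally show ?thesis unfolding mat_kernel[OF A] y_def by simp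
  qed
  have ext: "\<exists>f. x = fv vs f" if "x \<in> carrier_vec (length vs)" "distinct vs" for x vs
  proof
    show "x = fv vs (\<lambda>u. x $ inv_into {..<length vs} ((!) vs) u)"
      using that by (intro eq_vecI) (auto simp: fv_def inv_into_f_f inj_on_nth)
  qed
  have scal: "fv vs f = c \<cdot>\<^sub>v fv vs g \<longleftrightarrow> (\<forall>u \<in> pverts G. f u = c * g u)" if "set vs = pverts G" for vs f g c
    unfolding that[symmetric] all_set_conv_all_nth by (auto simp: fv_def vec_eq_iff)
  have nz: "(\<forall>i < length vs. fv vs g $ i \<noteq> 0) \<longleftrightarrow> (\<forall>u \<in> pverts G. g u \<noteq> 0)" if "set vs = pverts G" for vs g
    unfolding that[symmetric] all_set_conv_all_nth by (auto simp: fv_def)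
  show ?thesis
  proof
    assume "nut_graph G"
    then obtain vs x where vs: "distinct vs" "set vs = pverts G" and x: "x \<in> carrier_vec (length vs)"
      and k: "mat_kernel (adjacency_matrix G vs) = range (\<lambda>c. c \<cdot>\<^sub>v x)"
      and x0: "\<forall>i < length vs. x $ i \<noteq> 0" unfolding nut_graph_def by blast
    obtain g where g: "x = fv vs g" using ext[OF x vs(1)] by blast
    have "fv vs g \<in> mat_kernel (adjacency_matrix G vs)"
      unfolding k g[symmetric] by (auto intro: image_eqI[of _ _ 1])
    then have "null_function G g" using ker[OF vs] by simp
    moreover have "\<exists>c. \<forall>u \<in> pverts G. f u = c * g u" if "null_function G f" for f :: "'a \<Rightarrow> real"
      using that unfolding ker[OF vs, symmetric] k g by (auto simp: scal[OF vs(2)])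
    ultimately show "\<exists>g :: 'a \<Rightarrow> real. null_function G g \<and> (\<forall>u \<in> pverts G. g u \<noteq> 0) \<and>
     (\<forall>f :: 'a \<Rightarrow> real. null_function G f \<longrightarrow> (\<exists>c. \<forall>u \<in> pverts G. f u = c * g u))"
      using x0 nz[OF vs(2)] g by blast
  next
    assume "\<exists>g :: 'a \<Rightarrow> real. null_function G g \<and> (\<forall>u \<in> pverts G. g u \<noteq> 0) \<and>
     (\<forall>f :: 'a \<Rightarrow> real. null_function G f \<longrightarrow> (\<exists>c. \<forall>u \<in> pverts G. f u = c * g u))"
    then obtain g :: "'a \<Rightarrow> real" where g: "null_function G g" "\<forall>u \<in> pverts G. g u \<noteq> 0"
      and gf: "\<And>f :: 'a \<Rightarrow> real. null_function G f \<Longrightarrow> \<exists>c. \<forall>u \<in> pverts G. f u = c * g u" by blast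
    obtain vs where vs: "distinct vs" "set vs = pverts G" using finite_distinct_list[OF fin] by blast
    have k: "mat_kernel (adjacency_matrix G vs) = range (\<lambda>c. c \<cdot>\<^sub>v fv vs g)"
    proof (intro equalityI subsetI)
      fix y assume y: "y \<in> mat_kernel (adjacency_matrix G vs)"
      then obtain f where f: "y = fv vs f" using ext vs mat_kernel_carrier[OF A] by blast
      then have "null_function G f" using y ker[OF vs] by simp
      then obtain c where "\<forall>u \<in> pverts G. f u = c * g u" using gf by blast
      then have "fv vs f = c \<cdot>\<^sub>v fv vs g" using scal[OF vs(2)] by blast
      then show "y \<in> range (\<lambda>c. c \<cdot>\<^sub>v fv vs g)" unfolding f by blast
    next
      fix y assume "y \<in> range (\<lambda>c. c \<cdot>\<^sub>v fv vs g)"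
      then show "y \<in> mat_kernel (adjacency_matrix G vs)"
        using mat_kernel_smult[OF A] ker[OF vs, of g] g(1) by auto
    qed
    have "length vs > 0" using vs(2) ne by auto
    then have "kernel_dim (adjacency_matrix G vs) = 1"
      using g(2) nz[OF vs(2)] by (intro kernel_dim_eq_1I[OF A fvc _ _ k]) auto
    then show "nut_graph G" unfolding nut_graph_def
      using vs k nz[OF vs(2), of g, THEN iffD2, OF g(2)]
      by (intro exI[of _ vs] conjI bexI[of _ "fv vs g"]) (assumption | simp)+
  qed
qed

text \<open>The adjacency relation is real, so real and imaginary parts of a complex null function
  are null functions. Complex test functions are what Fourier coefficients require, while the
  spanning function \<open>g\<close> stays real.\<close>

lemma nut_graph_iff_complex:
  assumes fin: "finite (pverts G)" and ne: "pverts G \<noteq> {}"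
  shows "nut_graph G \<longleftrightarrow> (\<exists>g :: 'a \<Rightarrow> real. null_function G g \<and> (\<forall>u \<in> pverts G. g u \<noteq> 0) \<and>
     (\<forall>f :: 'a \<Rightarrow> complex. null_function G f \<longrightarrow> (\<exists>c. \<forall>u \<in> pverts G. f u = c * of_real (g u))))"
proof -
  have "(\<forall>f :: 'a \<Rightarrow> real. null_function G f \<longrightarrow> (\<exists>c. \<forall>u \<in> pverts G. f u = c * g u)) \<longleftrightarrow>
    (\<forall>f :: 'a \<Rightarrow> complex. null_function G f \<longrightarrow> (\<exists>c. \<forall>u \<in> pverts G. f u = c * of_real (g u)))"
    (is "?R \<longleftrightarrow> ?C") for g :: "'a \<Rightarrow> real"
  proof
    assume R: ?R
    show ?C
    proof (intro allI impI)
      fix f :: "'a \<Rightarrow> complex" assume f: "null_function G f"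
      have "null_function G (\<lambda>u. Re (f u))" "null_function G (\<lambda>u. Im (f u))"
        using f unfolding null_function_def by (simp_all flip: Re_sum Im_sum)
      then obtain c d where "\<forall>u \<in> pverts G. Re (f u) = c * g u" "\<forall>u \<in> pverts G. Im (f u) = d * g u"
        using R by blast
      then have "\<forall>u \<in> pverts G. f u = Complex c d * of_real (g u)" by (simp add: complex_eq_iff)
      then show "\<exists>c. \<forall>u \<in> pverts G. f u = c * of_real (g u)" by blast
    qed
  next
    assume C: ?C
    show ?R
    proof (intro allI impI)
      fix f :: "'a \<Rightarrow> real" assume f: "null_function G f"
      have "null_function G (\<lambda>u. complex_of_real (f u))"
        using f unfolding null_function_def by (simp flip: of_real_sum)
      then obtain c where "\<forall>u \<in> pverts G. complex_of_real (f u) = c * of_real (g u)" using C by blast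
      then have "\<forall>u \<in> pverts G. f u = Re c * g u" by (simp add: complex_eq_iff)
      then show "\<exists>c. \<forall>u \<in> pverts G. f u = c * g u" by blast
    qed
  qed
  then show ?thesis unfolding nut_graph_iff_null_function[OF assms] by simp
qed

subsection \<open>Fourier analysis of periodic functions\<close>

lemma sum_periodic_shift:
  fixes g :: "int \<Rightarrow> 'a :: ab_group_add"
  assumes "\<And>j. g (j + int n) = g j"
  shows "(\<Sum>j<n. g (int j + d)) = (\<Sum>j<n. g (int j))"
proof -
  have step: "(\<Sum>j<n. g (int j + (e + 1))) = (\<Sum>j<n. g (int j + e))" for e
  proof -
    have "(\<Sum>j<n. g (int (Suc j) + e) - g (int j + e)) = g (int n + e) - g (int 0 + e)"
      by (rule sum_lessThan_telescope)
    also have "\<dots> = 0" using assms[of e] by (simp add: add.commute)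
    finally show ?thesis by (simp add: sum_subtractf algebra_simps)
  qed
  show ?thesis
  proof (induction d rule: int_induct[of _ 0])
    case (step2 i)
    then show ?case using step[of "i - 1"] by simp
  qed (use step in auto)
qed

lemma power_int_periodic:
  fixes w :: "'a :: field"
  assumes "n > 0" "w ^ n = 1"
  shows "w powi (j + int n) = w powi j"
proof -
  have "w \<noteq> 0" using assms by (auto simp: zero_power)
  then show ?thesis using assms(2) by (simp add: power_int_add)
qed

text \<open>Orthogonality of characters: multiplication by the primitive root \<open>z\<close>
  permutes the \<open>n\<close>-th roots of unity and scales the sum by \<open>z powi d\<close>,
  which differs from \<open>1\<close> unless \<open>n\<close> divides \<open>d\<close>.\<close>

lemma sum_roots_unity_power_int:
  assumes n: "n > 0"
  shows "(\<Sum>w | w ^ n = 1. w powi d) = (if int n dvd d then of_nat n else (0 :: complex))"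
proof -
  define R where "R = {w :: complex. w ^ n = 1}"
  have cR: "card R = n" unfolding R_def using n by (rule card_roots_unity_eq)
  show ?thesis
  proof (cases "int n dvd d")
    case True
    then obtain e where "d = int n * e" by blast
    then have "w powi d = 1" if "w \<in> R" for w
      using that by (simp add: power_int_mult R_def)
    then have "(\<Sum>w\<in>R. w powi d) = of_nat n" using cR by simp
    then show ?thesis using True by (simp add: R_def)
  next
    case False
    define z where "z = cis (2 * pi / real n)"
    have z0: "z \<noteq> 0" by (simp add: z_def)
    have zn: "z ^ n = 1" using n by (simp add: z_def DeMoivre)
    have zd: "z powi d \<noteq> 1"
    proof
      assume a: "z powi d = 1"
      define r where "r = nat (d mod int n)"
      have dm: "0 \<le> d mod int n" "d mod int n < int n" "d mod int n \<noteq> 0"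
        using n False by (simp_all add: dvd_eq_mod_eq_0)
      then have r: "int r = d mod int n" "r < n" "r > 0" unfolding r_def by linarith+
      have "d = int r + int n * (d div int n)" unfolding r by simp
      then have "z powi d = z powi int r * (z powi int n) powi (d div int n)"
        using z0 by (metis power_int_add power_int_mult)
      then have "z ^ r = 1" using a zn by simp
      moreover have "z ^ r = cis (2 * pi * real r / real n)" by (simp add: z_def DeMoivre mult.commute)
      moreover have "inj_on (\<lambda>k. cis (2 * pi * real k / real n)) {..<n}"
        using bij_betw_roots_unity[OF n] by (rule bij_betw_imp_inj_on)
      then have "cis (2 * pi * real r / real n) \<noteq> cis (2 * pi * real 0 / real n)"
        using inj_onD[of _ "{..<n}" r 0] r n by fastforce
      ultimately show False by simp
    qed
    have "bij_betw ((*) z) R R"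
      by (rule bij_betwI[where g = "\<lambda>w. w / z"]) (auto simp: R_def power_mult_distrib power_divide zn z0)
    then have "(\<Sum>w\<in>R. w powi d) = (\<Sum>w\<in>R. (z * w) powi d)"
      by (rule sum.reindex_bij_betw[symmetric])
    also have "\<dots> = z powi d * (\<Sum>w\<in>R. w powi d)"
      by (simp add: power_int_mult_distrib sum_distrib_left)
    finally have "(1 - z powi d) * (\<Sum>w\<in>R. w powi d) = 0" by (simp add: algebra_simps)
    then show ?thesis using zd False by (simp add: R_def)
  qed
qed

definition dft :: "nat \<Rightarrow> (int \<Rightarrow> complex) \<Rightarrow> complex \<Rightarrow> complex" where
  "dft n h w = (\<Sum>j<n. h (int j) * w powi (- int j))"

lemma dft_shift:
  assumes "n > 0" "w ^ n = 1" "\<And>j. h (j + int n) = h j"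
  shows "dft n (\<lambda>j. h (j + d)) w = w powi d * dft n h w"
proof -
  have w0: "w \<noteq> 0" using assms by (auto simp: zero_power)
  define g where "g j = h j * w powi (- j)" for j
  have "g (j + int n) = g j" for j
    using assms(3) power_int_periodic[OF assms(1,2), of "- j - int n"] by (simp add: g_def)
  then have "(\<Sum>j<n. g (int j + d)) = (\<Sum>j<n. g (int j))" by (rule sum_periodic_shift)
  moreover have "h (int j + d) * w powi (- int j) = w powi d * g (int j + d)" for j
  proof -
    have "w powi d * w powi (- (int j + d)) = w powi (- int j)"
      using w0 by (subst power_int_add[symmetric]) auto
    then show ?thesis by (simp add: g_def mult.left_commute)
  qed
  then have "dft n (\<lambda>j. h (j + d)) w = w powi d * (\<Sum>j<n. g (int j + d))"
    by (simp only: dft_def sum_distrib_left)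
  ultimately show ?thesis by (simp only: dft_def g_def)
qed

text \<open>Fourier inversion writes \<open>n\<close> times \<open>h i\<close> as the sum of
  \<open>w powi i * dft n h w\<close> over all roots; only \<open>w = 1\<close> survives, and its
  contribution does not depend on \<open>i\<close>.\<close>

lemma periodic_const_if_dft_eq_0:
  assumes n: "n > 0" and per: "\<And>j. h (j + int n) = h j"
    and zero: "\<And>w. w ^ n = 1 \<Longrightarrow> w \<noteq> 1 \<Longrightarrow> dft n h w = 0"
  shows "h i = h 0"
proof -
  define R where "R = {w :: complex. w ^ n = 1}"
  have fR: "finite R" unfolding R_def using n by (intro finite_roots_unity) simp
  have pm: "h (j mod int n) = h j" for j
  proof -
    have "h (k + int n * m) = h k" for k m
    proof (induction m rule: int_induct[of _ 0])
      case (step1 m)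
      then show ?case using per[of "k + int n * m"] by (simp add: algebra_simps)
    next
      case (step2 m)
      then show ?case using per[of "k + int n * (m - 1)"] by (simp add: algebra_simps)
    qed simp
    then show ?thesis by (metis mod_mult_div_eq)
  qed
  have "of_nat n * h i = dft n h 1" for i
  proof -
    have R0: "w \<noteq> 0" if "w \<in> R" for w using that n by (auto simp: R_def zero_power)
    have "(\<Sum>w\<in>R. w powi i * dft n h w) = (\<Sum>w\<in>{1}. w powi i * dft n h w)"
      using zero fR by (intro sum.mono_neutral_right) (auto simp: R_def)
    then have "dft n h 1 = (\<Sum>w\<in>R. w powi i * dft n h w)" by simp
    also have "\<dots> = (\<Sum>w\<in>R. \<Sum>j<n. h (int j) * w powi (i - int j))"
      by (intro sum.cong refl) (simp add: dft_def sum_distrib_left R0 power_int_diff power_int_minus field_simps)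
    also have "\<dots> = (\<Sum>j<n. h (int j) * (\<Sum>w\<in>R. w powi (i - int j)))"
      by (subst sum.swap) (simp add: sum_distrib_left)
    also have "\<dots> = (\<Sum>j<n. h (int j) * (if int n dvd i - int j then of_nat n else 0))"
      unfolding R_def using sum_roots_unity_power_int[OF n] by simp
    also have "\<dots> = (\<Sum>j<n. if j = nat (i mod int n) then h (int j) * of_nat n else 0)"
    proof (intro sum.cong refl)
      fix j assume "j \<in> {..<n}"
      then have "int n dvd i - int j \<longleftrightarrow> i mod int n = int j"
        by (metis lessThan_iff mod_eq_dvd_iff mod_less of_nat_mod)
      then show "h (int j) * (if int n dvd i - int j then of_nat n else 0)
          = (if j = nat (i mod int n) then h (int j) * of_nat n else 0)"
        using n by auto
    qed
    also have "\<dots> = h (i mod int n) * of_nat n"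
      using n by (simp add: nat_less_iff)
    finally show ?thesis using pm[of i] by (simp add: mult.commute)
  qed
  then have "of_nat n * h i = of_nat n * h 0" by metis
  then show ?thesis using n by simp
qed

subsection \<open>Orbit frames\<close>

text \<open>A labelling \<open>v i j\<close> (\<open>i < m\<close>, \<open>j\<close> an integer modulo \<open>n\<close>) of the vertices under which the shift
  \<open>v i j \<mapsto> v i (j + 1)\<close> is an automorphism; \<open>D i i'\<close> is the connection set from the \<open>i\<close>-th
  to the \<open>i'\<close>-th orbit.\<close>

locale orbit_frame =
  fixes G :: "'a pair_pre_digraph" and m n :: nat and v :: "nat \<Rightarrow> int \<Rightarrow> 'a"
    and D :: "nat \<Rightarrow> nat \<Rightarrow> int set"
  assumes n_pos: "n > 0"
    and verts: "pverts G = {v i j |i j. i < m}"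
    and v_eq_iff: "i < m \<Longrightarrow> i' < m \<Longrightarrow> v i j = v i' j' \<longleftrightarrow> i = i' \<and> [j = j'] (mod int n)"
    and D_subset: "i < m \<Longrightarrow> i' < m \<Longrightarrow> D i i' \<subseteq> {0..<int n}"
    and arc_iff: "i < m \<Longrightarrow> i' < m \<Longrightarrow> (v i j, v i' j') \<in> parcs G \<longleftrightarrow> (j' - j) mod int n \<in> D i i'"
begin

lemma v_periodic: "i < m \<Longrightarrow> v i (j + int n) = v i j"
  by (simp add: v_eq_iff cong_def)

lemma v_mod: "i < m \<Longrightarrow> v i (j mod int n) = v i j"
  by (simp add: v_eq_iff cong_def)

lemma finite_D: "i < m \<Longrightarrow> i' < m \<Longrightarrow> finite (D i i')"
  using D_subset by (rule finite_subset) auto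

lemma finite_verts: "finite (pverts G)"
proof -
  have "pverts G \<subseteq> (\<lambda>(i, j). v i j) ` ({..<m} \<times> {0..<int n})"
  proof
    fix u assume "u \<in> pverts G"
    then obtain i j where "i < m" "u = v i j" unfolding verts by blast
    then have "u = v i (j mod int n)" by (simp add: v_mod)
    then show "u \<in> (\<lambda>(i, j). v i j) ` ({..<m} \<times> {0..<int n})"
      using \<open>i < m\<close> n_pos by (intro image_eqI[of _ _ "(i, j mod int n)"]) auto
  qed
  then show ?thesis by (rule finite_subset) auto
qed

text \<open>Every vertex has infinitely many labels. \<open>P\<close> chooses one of them, and the
  hypothesis makes the value independent of this choice.\<close>

lemma function_on_frame:
  fixes F :: "nat \<Rightarrow> int \<Rightarrow> 'b"
  assumes "\<And>i j j'. i < m \<Longrightarrow> [j = j'] (mod int n) \<Longrightarrow> F i j = F i j'"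
  obtains f where "\<And>i j. i < m \<Longrightarrow> f (v i j) = F i j"
proof -
  define P where "P u = (SOME p. fst p < m \<and> v (fst p) (snd p) = u)" for u
  define f where "f u = F (fst (P u)) (snd (P u))" for u
  have "f (v i j) = F i j" if i: "i < m" for i j
  proof -
    have "fst (P (v i j)) < m \<and> v (fst (P (v i j))) (snd (P (v i j))) = v i j"
      unfolding P_def by (rule someI[of _ "(i, j)"]) (simp add: i)
    then show ?thesis unfolding f_def using i assms v_eq_iff by metis
  qed
  then show thesis using that by blast
qed

lemma neighbours:
  assumes i: "i < m"
  shows "{w \<in> pverts G. (v i j, w) \<in> parcs G} = (\<lambda>(i', d). v i' (j + d)) ` Sigma {..<m} (D i)"
proof (intro equalityI subsetI)
  fix w assume "w \<in> {w \<in> pverts G. (v i j, w) \<in> parcs G}"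
  then obtain i' j' where w: "i' < m" "w = v i' j'" and a: "(v i j, v i' j') \<in> parcs G"
    unfolding verts by blast
  have "w = v i' (j + (j' - j) mod int n)" using w by (simp add: v_eq_iff cong_def mod_simps)
  then show "w \<in> (\<lambda>(i', d). v i' (j + d)) ` Sigma {..<m} (D i)"
    using a w i arc_iff by (intro image_eqI[of _ _ "(i', (j' - j) mod int n)"]) auto
next
  fix w assume "w \<in> (\<lambda>(i', d). v i' (j + d)) ` Sigma {..<m} (D i)"
  then obtain i' d where w: "i' < m" "d \<in> D i i'" "w = v i' (j + d)" by auto
  then have "d mod int n = d" using D_subset[OF i, of i'] by auto
  then show "w \<in> {w \<in> pverts G. (v i j, w) \<in> parcs G}" using w i arc_iff verts by auto
qed

lemma inj_neighbours:
  assumes "i < m"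
  shows "inj_on (\<lambda>(i', d). v i' (j + d)) (Sigma {..<m} (D i))"
proof (rule inj_onI)
  fix p q assume pq: "p \<in> Sigma {..<m} (D i)" "q \<in> Sigma {..<m} (D i)"
    and "(\<lambda>(i', d). v i' (j + d)) p = (\<lambda>(i', d). v i' (j + d)) q"
  then have "fst p = fst q" "[j + snd p = j + snd q] (mod int n)"
    by (auto simp: v_eq_iff split: prod.splits)
  moreover have "fst p < m" "snd p \<in> D i (fst p)" "fst q < m" "snd q \<in> D i (fst q)"
    using pq by auto
  then have "snd p \<in> {0..<int n}" "snd q \<in> {0..<int n}" using D_subset[OF assms] by blast+
  ultimately show "p = q" by (simp add: prod_eq_iff cong_add_lcancel) (simp add: cong_def)
qed

lemma sum_neighbours:
  assumes "i < m"
  shows "(\<Sum>w | w \<in> pverts G \<and> (v i j, w) \<in> parcs G. f w) = (\<Sum>i'<m. \<Sum>d\<in>D i i'. f (v i' (j + d)))"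
proof -
  have "(\<Sum>w | w \<in> pverts G \<and> (v i j, w) \<in> parcs G. f w) = (\<Sum>(i', d)\<in>Sigma {..<m} (D i). f (v i' (j + d)))"
    unfolding neighbours[OF assms] sum.reindex[OF inj_neighbours[OF assms]]
    by (simp add: case_prod_unfold comp_def)
  also have "\<dots> = (\<Sum>i'<m. \<Sum>d\<in>D i i'. f (v i' (j + d)))"
    using finite_D[OF assms] by (intro sum.Sigma[symmetric]) auto
  finally show ?thesis .
qed

lemma card_neighbours:
  assumes "i < m"
  shows "card {w \<in> pverts G. (v i j, w) \<in> parcs G} = (\<Sum>i'<m. card (D i i'))"
  unfolding neighbours[OF assms] card_image[OF inj_neighbours[OF assms]]
  using finite_D[OF assms] by (simp add: card_SigmaI)

lemma null_function_iff:
  "null_function G f \<longleftrightarrow> (\<forall>i<m. \<forall>j. (\<Sum>i'<m. \<Sum>d\<in>D i i'. f (v i' (j + d))) = 0)"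
proof -
  have "(\<forall>u \<in> pverts G. P u) \<longleftrightarrow> (\<forall>i<m. \<forall>j. P (v i j))" for P unfolding verts by blast
  then show ?thesis unfolding null_function_def by (simp add: sum_neighbours)
qed

text \<open>The Fourier transform of a connection set. The field is left open: patterns are excluded
  over the reals, at \<open>1\<close> and \<open>- 1\<close>, and the nullity criteria need the
  complex roots of unity.\<close>

definition symbol :: "'b :: field \<Rightarrow> nat \<Rightarrow> nat \<Rightarrow> 'b" where
  "symbol w i i' = (\<Sum>d\<in>D i i'. w powi d)"

definition symbol_kernel :: "'b :: field \<Rightarrow> (nat \<Rightarrow> 'b) set" where
  "symbol_kernel w = {W. \<forall>i<m. (\<Sum>i'<m. symbol w i i' * W i') = 0}"

lemma power_int_cong:
  fixes w :: "'b :: field"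
  assumes "w ^ n = 1" "[j = j'] (mod int n)"
  shows "w powi j = w powi j'"
proof -
  have "w \<noteq> 0" using assms n_pos by (auto simp: zero_power)
  moreover obtain k where "j' = j + int n * k" using assms(2) cong_iff_lin by blast
  ultimately show ?thesis using assms(1) by (simp add: power_int_add power_int_mult)
qed

text \<open>A function that gains the factor \<open>w\<close> with each shift has neighbourhood sums
  equal to \<open>w powi j\<close> times the rows of the symbol matrix.\<close>

lemma symbol_kernel_null_function:
  fixes w :: "'b :: field"
  assumes w: "w ^ n = 1" and W: "W \<in> symbol_kernel w" and f: "\<And>i j. i < m \<Longrightarrow> f (v i j) = W i * w powi j"
  shows "null_function G f"
proof -
  have w0: "w \<noteq> 0" using w n_pos by (auto simp: zero_power)
  have "(\<Sum>i'<m. \<Sum>d\<in>D i i'. f (v i' (j + d))) = w powi j * (\<Sum>i'<m. symbol w i i' * W i')" for i j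
    using w0 by (simp add: f symbol_def sum_distrib_left sum_distrib_right power_int_add mult_ac)
  then show ?thesis using W by (simp add: null_function_iff symbol_kernel_def)
qed

text \<open>A kernel vector at some \<open>w \<noteq> 1\<close> would give a null function
  proportional to \<open>g0\<close>, which is constant on orbits; this forces the vector to be zero.
  Conversely, if these kernels are trivial, the transforms of a null function vanish away from
  \<open>w = 1\<close>, so it is constant on orbits and lies in the line spanned by
  \<open>W0\<close>.\<close>

lemma nut_graph_iff_symbol_kernel:
  fixes W0 :: "nat \<Rightarrow> real"
  assumes m: "m > 0" and W0: "\<And>i. i < m \<Longrightarrow> W0 i \<noteq> 0"
    and k1: "(\<lambda>i. complex_of_real (W0 i)) \<in> symbol_kernel 1"
    and k1': "\<And>W :: nat \<Rightarrow> complex. W \<in> symbol_kernel 1 \<Longrightarrow> \<exists>c. \<forall>i<m. W i = c * complex_of_real (W0 i)"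
  shows "nut_graph G \<longleftrightarrow> (\<forall>w :: complex. w ^ n = 1 \<longrightarrow> w \<noteq> 1 \<longrightarrow> (\<forall>W \<in> symbol_kernel w. \<forall>i<m. W i = 0))"
proof -
  have ne: "pverts G \<noteq> {}" using verts m by auto
  obtain g0 :: "'a \<Rightarrow> real" where g0: "\<And>i j. i < m \<Longrightarrow> g0 (v i j) = W0 i"
    using function_on_frame[of "\<lambda>i j. W0 i"] by auto
  have g0_null': "null_function G (\<lambda>u. complex_of_real (g0 u))"
    using k1 g0 by (intro symbol_kernel_null_function[of 1]) auto
  then have g0_null: "null_function G g0"
    unfolding null_function_def by (simp flip: of_real_sum)
  show ?thesis
  proof (intro iffI allI impI ballI)
    fix w :: complex and W i
    assume "nut_graph G" and w: "w ^ n = 1" "w \<noteq> 1" and W: "W \<in> symbol_kernel w" and i: "i < m"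
    obtain f where f: "\<And>i j. i < m \<Longrightarrow> f (v i j) = W i * w powi j"
      using function_on_frame[of "\<lambda>i j. W i * w powi j"] power_int_cong[OF w(1)] by metis
    have "null_function G f" using symbol_kernel_null_function[OF w(1) W] f by blast
    obtain g :: "'a \<Rightarrow> real" where gf: "\<And>f :: 'a \<Rightarrow> complex. null_function G f \<Longrightarrow> \<exists>c. \<forall>u \<in> pverts G. f u = c * of_real (g u)"
      using \<open>nut_graph G\<close> unfolding nut_graph_iff_complex[OF finite_verts ne] by blast
    obtain c where c: "\<forall>u \<in> pverts G. f u = c * of_real (g u)"
      using gf[OF \<open>null_function G f\<close>] by blast
    obtain c0 where c0: "\<forall>u \<in> pverts G. of_real (g0 u) = c0 * complex_of_real (g u)"
      using gf[OF g0_null'] by blast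
    have V: "v i j \<in> pverts G" for j using i verts by auto
    have "of_real (W0 i) = c0 * complex_of_real (g (v i 0))" using c0 V g0 i by metis
    then have "c0 \<noteq> 0" using W0[OF i] by auto
    then have "complex_of_real (g (v i 0)) = complex_of_real (g (v i 1))"
      using c0 V g0[OF i] by (metis mult_left_cancel)
    then have "f (v i 0) = f (v i 1)" using c V by simp
    then show "W i = 0" using f[OF i] w(2) by (simp add: power_int_def)
  next
    assume triv: "\<forall>w :: complex. w ^ n = 1 \<longrightarrow> w \<noteq> 1 \<longrightarrow> (\<forall>W \<in> symbol_kernel w. \<forall>i<m. W i = 0)"
    have "\<exists>c. \<forall>u \<in> pverts G. f u = c * of_real (g0 u)" if f: "null_function G f" for f :: "'a \<Rightarrow> complex"
    proof -
      define h where "h i j = f (v i j)" for i j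
      have per: "h i (j + int n) = h i j" if "i < m" for i j using that by (simp add: h_def v_periodic)
      have null: "(\<Sum>i'<m. \<Sum>d\<in>D i i'. h i' (j + d)) = 0" if "i < m" for i j
        using f that unfolding null_function_iff h_def by blast
      have "dft n (h i) w = 0" if w: "w ^ n = 1" "w \<noteq> 1" and i: "i < m" for i w
      proof -
        have mem: "(\<lambda>i. dft n (h i) w) \<in> symbol_kernel w"
          unfolding symbol_kernel_def
        proof (intro CollectI allI impI)
          fix i assume i: "i < m"
          \<comment> \<open>By the shift rule, multiplication by the symbol yields the transform of
            the neighbourhood sums, and these vanish.\<close>
          have "(\<Sum>i'<m. symbol w i i' * dft n (h i') w) = (\<Sum>i'<m. \<Sum>d\<in>D i i'. dft n (\<lambda>j. h i' (j + d)) w)"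
            by (intro sum.cong refl) (simp add: symbol_def sum_distrib_right dft_shift[OF n_pos w(1)] per)
          also have "\<dots> = (\<Sum>j<n. (\<Sum>i'<m. \<Sum>d\<in>D i i'. h i' (int j + d)) * w powi (- int j))"
            unfolding dft_def sum_distrib_right
            by (subst (2) sum.swap, subst sum.swap, intro sum.cong refl)
          also have "\<dots> = 0" using null[OF i] by simp
          finally show "(\<Sum>i'<m. symbol w i i' * dft n (h i') w) = 0" .
        qed
        then show ?thesis using triv[rule_format, OF w mem i] by simp
      qed
      then have const: "h i j = h i 0" if "i < m" for i j
        using periodic_const_if_dft_eq_0[OF n_pos, of "h i" j] per that by blast
      have "(\<lambda>i. h i 0) \<in> symbol_kernel 1"
        unfolding symbol_kernel_def
      proof (intro CollectI allI impI)
        fix i assume "i < m"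
        have "symbol 1 i i' * h i' 0 = (\<Sum>d\<in>D i i'. h i' (0 + d))" if "i' < m" for i'
        proof -
          have "(\<Sum>d\<in>D i i'. h i' (0 + d)) = (\<Sum>d\<in>D i i'. h i' 0)"
            by (intro sum.cong refl const[OF that])
          then show ?thesis by (simp add: symbol_def)
        qed
        then have "(\<Sum>i'<m. symbol 1 i i' * h i' 0) = (\<Sum>i'<m. \<Sum>d\<in>D i i'. h i' (0 + d))"
          by (intro sum.cong refl) simp
        then show "(\<Sum>i'<m. symbol 1 i i' * h i' 0) = 0" using null[OF \<open>i < m\<close>, of 0] by simp
      qed
      then obtain c where c: "\<forall>i<m. h i 0 = c * complex_of_real (W0 i)" using k1' by blast
      have "f u = c * complex_of_real (g0 u)" if u: "u \<in> pverts G" for u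
      proof -
        obtain i j where ij: "i < m" "u = v i j" using u unfolding verts by blast
        have "f u = h i 0" using const[OF ij(1), of j] ij(2) by (simp add: h_def)
        then show ?thesis using c ij g0[OF ij(1), of j] by simp
      qed
      then show ?thesis by (intro exI[of _ c]) simp
    qed
    moreover have "g0 u \<noteq> 0" if u: "u \<in> pverts G" for u
    proof -
      obtain i j where ij: "i < m" "u = v i j" using u unfolding verts by blast
      then show ?thesis using g0[OF ij(1), of j] W0[OF ij(1)] by simp
    qed
    ultimately show "nut_graph G" unfolding nut_graph_iff_complex[OF finite_verts ne]
      using g0_null by (intro exI[of _ g0]) simp
  qed
qed

text \<open>The null vector of a nut graph is an eigenvector of the shift, with a real eigenvalue of
  finite order.\<close>

lemma nut_graph_sign_eigenvector:
  assumes "m > 0" "nut_graph G"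
  obtains s :: real and W where "s = 1 \<or> s = - 1" "W \<in> symbol_kernel s" "\<And>i. i < m \<Longrightarrow> W i \<noteq> 0"
proof -
  have ne: "pverts G \<noteq> {}" using verts assms(1) by auto
  obtain g :: "'a \<Rightarrow> real" where g: "null_function G g" "\<forall>u \<in> pverts G. g u \<noteq> 0"
    and gf: "\<And>f :: 'a \<Rightarrow> real. null_function G f \<Longrightarrow> \<exists>c. \<forall>u \<in> pverts G. f u = c * g u"
    using assms(2) unfolding nut_graph_iff_null_function[OF finite_verts ne] by blast
  \<comment> \<open>\<open>f\<close> is \<open>g\<close> moved by one step along the orbits. It is
    again a null function, hence equals \<open>s g\<close>; as \<open>g\<close> has no zeros,
    periodicity will give \<open>s ^ n = 1\<close>.\<close>
  have "g (v i (j + 1)) = g (v i (j' + 1))" if "i < m" "[j = j'] (mod int n)" for i j j'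
    using that v_eq_iff[of i i "j + 1" "j' + 1"] by (simp add: cong_add_rcancel)
  then obtain f where f: "\<And>i j. i < m \<Longrightarrow> f (v i j) = g (v i (j + 1))"
    using function_on_frame[of "\<lambda>i j. g (v i (j + 1))"] by blast
  have "(\<Sum>i'<m. \<Sum>d\<in>D i i'. f (v i' (j + d))) = (\<Sum>i'<m. \<Sum>d\<in>D i i'. g (v i' ((j + 1) + d)))" for i j
    by (intro sum.cong refl) (simp add: f algebra_simps)
  then have "null_function G f" using g(1) unfolding null_function_iff by simp
  then obtain s where s: "\<forall>u \<in> pverts G. f u = s * g u" using gf by blast
  have V: "v i j \<in> pverts G" if "i < m" for i j using that verts by auto
  have step: "g (v i (j + 1)) = s * g (v i j)" if "i < m" for i j
    using s V f that by metis
  have s0: "s \<noteq> 0" using step[OF assms(1), of 0] g(2) V[OF assms(1)] by auto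
  have pow: "g (v i j) = s powi j * g (v i 0)" if i: "i < m" for i j
  proof (induction j rule: int_induct[of _ 0])
    case (step1 j)
    then show ?case using step[OF i, of j] s0 by (simp add: power_int_add)
  next
    case (step2 j)
    have "s * g (v i (j - 1)) = s * (s powi (j - 1) * g (v i 0))"
      using step[OF i, of "j - 1"] step2 s0 by (simp add: power_int_diff)
    then show ?case using s0 by simp
  qed simp
  have "s ^ n = 1"
    using pow[OF assms(1), of "int n"] v_periodic[OF assms(1), of 0] g(2) V[OF assms(1), of 0] by simp
  then have "\<bar>s\<bar> = 1" using power_eq_1_iff[of s n] n_pos by simp
  then have s1: "s = 1 \<or> s = - 1" by linarith
  have "(\<lambda>i. g (v i 0)) \<in> symbol_kernel s"
    unfolding symbol_kernel_def
  proof (intro CollectI allI impI)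
    fix i assume i: "i < m"
    have "symbol s i i' * g (v i' 0) = (\<Sum>d\<in>D i i'. g (v i' (0 + d)))" if "i' < m" for i'
      unfolding symbol_def sum_distrib_right
      by (intro sum.cong refl) (simp only: pow[OF that, symmetric] add_0)
    then have "(\<Sum>i'<m. symbol s i i' * g (v i' 0)) = (\<Sum>i'<m. \<Sum>d\<in>D i i'. g (v i' (0 + d)))"
      by (intro sum.cong refl) simp
    also have "\<dots> = 0" using g(1) i unfolding null_function_iff by blast
    finally show "(\<Sum>i'<m. symbol s i i' * g (v i' 0)) = 0" .
  qed
  then show thesis using that[of s] s1 g(2) V by blast
qed

lemma nut_graph_null_function_eq_0:
  fixes f :: "'a \<Rightarrow> real"
  assumes "nut_graph G" "null_function G f" "u \<in> pverts G" "f u = 0" "w \<in> pverts G"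
  shows "f w = 0"
proof -
  have ne: "pverts G \<noteq> {}" using assms(3) by auto
  obtain g :: "'a \<Rightarrow> real" and c where "\<forall>u \<in> pverts G. g u \<noteq> 0" "\<forall>u \<in> pverts G. f u = c * g u"
    using assms(1,2) unfolding nut_graph_iff_null_function[OF finite_verts ne] by blast
  then show ?thesis using assms(3-5) by auto
qed

end

section \<open>Isomorphisms and changes of labelling\<close>

text \<open>The arcs of \<open>with_proj\<close> are pairs whose ends are the projections, so the
  vertex map of an isomorphism determines its arc map.\<close>

lemma digraph_iso_with_proj_iff:
  assumes "pair_wf_digraph G"
  shows "digraph_iso (with_proj G) (with_proj H) \<longleftrightarrow>
    (\<exists>\<phi>. inj_on \<phi> (pverts G) \<and> pverts H = \<phi> ` pverts G \<and> parcs H = map_prod \<phi> \<phi> ` parcs G)"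
proof
  assume "digraph_iso (with_proj G) (with_proj H)"
  then obtain f where f: "pre_digraph.digraph_isomorphism (with_proj G) f"
    and H: "with_proj H = app_iso f (with_proj G)" unfolding digraph_iso_def by blast
  have proj: "iso_tail f = fst" "iso_head f = snd" and pv: "pverts H = iso_verts f ` pverts G"
    and pa: "parcs H = iso_arcs f ` parcs G"
    using H by (auto simp: with_proj_def app_iso_def)
  have "iso_arcs f a = map_prod (iso_verts f) (iso_verts f) a" if "a \<in> parcs G" for a
    using f that proj by (auto simp: pre_digraph.digraph_isomorphism_def prod_eq_iff)
  then have "parcs H = map_prod (iso_verts f) (iso_verts f) ` parcs G" unfolding pa by (intro image_cong) auto
  moreover have "inj_on (iso_verts f) (pverts G)"
    using f by (simp add: pre_digraph.digraph_isomorphism_def)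
  ultimately show "\<exists>\<phi>. inj_on \<phi> (pverts G) \<and> pverts H = \<phi> ` pverts G \<and> parcs H = map_prod \<phi> \<phi> ` parcs G"
    using pv by blast
next
  assume "\<exists>\<phi>. inj_on \<phi> (pverts G) \<and> pverts H = \<phi> ` pverts G \<and> parcs H = map_prod \<phi> \<phi> ` parcs G"
  then obtain \<phi> where \<phi>: "inj_on \<phi> (pverts G)" "pverts H = \<phi> ` pverts G" "parcs H = map_prod \<phi> \<phi> ` parcs G"
    by blast
  define f where "f = \<lparr>iso_verts = \<phi>, iso_arcs = map_prod \<phi> \<phi>, iso_head = snd, iso_tail = fst\<rparr>"
  have wf: "parcs G \<subseteq> pverts G \<times> pverts G" using assms by (auto simp: pair_wf_digraph_def)
  then have "inj_on (map_prod \<phi> \<phi>) (parcs G)"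
    using map_prod_inj_on[OF \<phi>(1) \<phi>(1)] by (rule inj_on_subset[rotated])
  then have "pre_digraph.digraph_isomorphism (with_proj G) f"
    using \<phi>(1) assms by (simp add: f_def pre_digraph.digraph_isomorphism_def wf_digraph_wp_iff)
  moreover have "with_proj H = app_iso f (with_proj G)"
    using \<phi> by (simp add: with_proj_def app_iso_def f_def)
  ultimately show "digraph_iso (with_proj G) (with_proj H)" unfolding digraph_iso_def by blast
qed

text \<open>The inverse isomorphism carries the labels back and leaves the connection sets
  unchanged; so a criterion in terms of connection sets passes from a model graph to
  \<open>G\<close>.\<close>

lemma orbit_frame_pullback:
  assumes G: "pair_wf_digraph G" and iso: "digraph_iso (with_proj G) (with_proj H)"
    and H: "orbit_frame H m n v D"
  obtains v' where "orbit_frame G m n v' D"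
proof -
  interpret H: orbit_frame H m n v D by (rule H)
  obtain \<phi> where \<phi>: "inj_on \<phi> (pverts G)" "pverts H = \<phi> ` pverts G" "parcs H = map_prod \<phi> \<phi> ` parcs G"
    using iso unfolding digraph_iso_with_proj_iff[OF G] by blast
  have wf: "parcs G \<subseteq> pverts G \<times> pverts G" using G by (auto simp: pair_wf_digraph_def)
  define \<psi> where "\<psi> = the_inv_into (pverts G) \<phi>"
  define v' where "v' i j = \<psi> (v i j)" for i j
  have V: "v i j \<in> \<phi> ` pverts G" if "i < m" for i j using that H.verts \<phi>(2) by blast
  have v': "v' i j \<in> pverts G" "\<phi> (v' i j) = v i j" if "i < m" for i j
    using V[OF that] \<phi>(1) unfolding v'_def \<psi>_def
    by (simp_all add: the_inv_into_into f_the_inv_into_f)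
  have "orbit_frame G m n v' D"
  proof
    show "n > 0" by (rule H.n_pos)
    show "pverts G = {v' i j |i j. i < m}"
    proof (intro equalityI subsetI)
      fix u assume u: "u \<in> pverts G"
      then obtain i j where ij: "i < m" "\<phi> u = v i j" using H.verts \<phi>(2) by blast
      then have "u = v' i j" using v'[OF ij(1), of j] u \<phi>(1) by (metis inj_onD)
      then show "u \<in> {v' i j |i j. i < m}" using ij(1) by blast
    qed (use v' in auto)
  next
    fix i i' j j' assume i: "i < m" "i' < m"
    have "v' i j = v' i' j' \<longleftrightarrow> v i j = v i' j'" using v' i \<phi>(1) by (metis inj_onD)
    then show "v' i j = v' i' j' \<longleftrightarrow> i = i' \<and> [j = j'] (mod int n)" using H.v_eq_iff[OF i] by simp
    have "(v' i j, v' i' j') \<in> parcs G \<longleftrightarrow> (v i j, v i' j') \<in> parcs H"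
    proof
      assume "(v i j, v i' j') \<in> parcs H"
      then obtain u w where uw: "(u, w) \<in> parcs G" "\<phi> u = v i j" "\<phi> w = v i' j'" unfolding \<phi>(3) by auto
      then have "u = v' i j" "w = v' i' j'"
        using wf v'[OF i(1), of j] v'[OF i(2), of j'] \<phi>(1) by (metis SigmaD1 SigmaD2 inj_onD subsetD)+
      then show "(v' i j, v' i' j') \<in> parcs G" using uw by simp
    next
      assume "(v' i j, v' i' j') \<in> parcs G"
      then have "map_prod \<phi> \<phi> (v' i j, v' i' j') \<in> parcs H" unfolding \<phi>(3) by (rule imageI)
      then show "(v i j, v i' j') \<in> parcs H" using v' i by simp
    qed
    then show "(v' i j, v' i' j') \<in> parcs G \<longleftrightarrow> (j' - j) mod int n \<in> D i i'" using H.arc_iff[OF i] by simp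
  next
    show "D i i' \<subseteq> {0..<int n}" if "i < m" "i' < m" for i i' using H.D_subset that .
  qed
  then show thesis by (rule that)
qed

text \<open>The connection sets, together with \<open>m\<close> and \<open>n\<close>, determine a
  graph up to isomorphism: equal labels are matched.\<close>

lemma digraph_iso_if_orbit_frames:
  assumes G: "pair_wf_digraph G" "orbit_frame G m n v D"
    and H: "parcs H \<subseteq> pverts H \<times> pverts H" "orbit_frame H m n v' D"
  shows "digraph_iso (with_proj G) (with_proj H)"
proof -
  interpret G: orbit_frame G m n v D by (rule G)
  interpret H: orbit_frame H m n v' D by (rule H)
  have wf: "parcs G \<subseteq> pverts G \<times> pverts G" using G(1) by (auto simp: pair_wf_digraph_def)
  obtain \<phi> where \<phi>: "\<And>i j. i < m \<Longrightarrow> \<phi> (v i j) = v' i j"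
    using G.function_on_frame[of v'] H.v_eq_iff by blast
  have "inj_on \<phi> (pverts G)"
  proof (rule inj_onI)
    fix x y assume "x \<in> pverts G" "y \<in> pverts G" and eq: "\<phi> x = \<phi> y"
    then obtain i j i' j' where "i < m" "i' < m" "x = v i j" "y = v i' j'" unfolding G.verts by blast
    then show "x = y" using eq \<phi> G.v_eq_iff H.v_eq_iff by simp
  qed
  moreover have "pverts H = \<phi> ` pverts G" unfolding G.verts H.verts using \<phi> by (force simp: image_iff)
  moreover have "parcs H = map_prod \<phi> \<phi> ` parcs G"
  proof (intro equalityI subsetI)
    fix e assume e: "e \<in> parcs H"
    then obtain i j i' j' where ij: "i < m" "i' < m" "e = (v' i j, v' i' j')"
      using H(1) unfolding H.verts by blast
    then have "(v i j, v i' j') \<in> parcs G" using e G.arc_iff H.arc_iff by simp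
    then show "e \<in> map_prod \<phi> \<phi> ` parcs G" using ij
      by (intro image_eqI[of _ _ "(v i j, v i' j')"]) (simp_all add: \<phi>)
  next
    fix e assume "e \<in> map_prod \<phi> \<phi> ` parcs G"
    then obtain a where a: "e = map_prod \<phi> \<phi> a" "a \<in> parcs G" by (rule imageE)
    have "a \<in> pverts G \<times> pverts G" using a(2) wf by (rule subsetD[rotated])
    then have "fst a \<in> pverts G" "snd a \<in> pverts G" by (simp_all add: mem_Times_iff)
    then obtain i j i' j' where ij: "i < m" "i' < m" "fst a = v i j" "snd a = v i' j'"
      unfolding G.verts by blast
    then have ija: "a = (v i j, v i' j')" by (simp add: prod_eq_iff)
    have "e = (v' i j, v' i' j')" using a(1) ij(1,2) ija by (simp add: \<phi>)
    then show "e \<in> parcs H" using a(2) ija G.arc_iff[OF ij(1,2)] H.arc_iff[OF ij(1,2)] by simp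
  qed
  ultimately show ?thesis unfolding digraph_iso_with_proj_iff[OF G(1)] by blast
qed

lemma (in orbit_frame) cong_D:
  assumes "\<And>i i'. i < m \<Longrightarrow> i' < m \<Longrightarrow> D i i' = D' i i'"
  shows "orbit_frame G m n v D'"
proof
  show "D' i i' \<subseteq> {0..<int n}" if "i < m" "i' < m" for i i'
    using D_subset[OF that] assms[OF that] by simp
  show "(v i j, v i' j') \<in> parcs G \<longleftrightarrow> (j' - j) mod int n \<in> D' i i'" if "i < m" "i' < m" for i i' j j'
    using arc_iff[OF that] assms[OF that] by simp
qed (fact n_pos, fact verts, fact v_eq_iff)

lemma (in orbit_frame) permute:
  assumes "bij_betw p {..<m} {..<m}"
  shows "orbit_frame G m n (\<lambda>i. v (p i)) (\<lambda>i i'. D (p i) (p i'))"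
proof
  have p: "p i < m" if "i < m" for i using assms that bij_betwE by blast
  have pinj: "p i = p i' \<longleftrightarrow> i = i'" if "i < m" "i' < m" for i i'
    using assms that by (meson bij_betw_imp_inj_on inj_on_eq_iff lessThan_iff)
  show "pverts G = {v (p i) j |i j. i < m}"
  proof (intro equalityI subsetI)
    fix u assume "u \<in> pverts G"
    then obtain i j where ij: "i < m" "u = v i j" unfolding verts by blast
    then obtain k where "k < m" "i = p k" using assms by (metis bij_betw_iff_bijections lessThan_iff)
    then show "u \<in> {v (p i) j |i j. i < m}" using ij by blast
  qed (use p verts in blast)
  show "v (p i) j = v (p i') j' \<longleftrightarrow> i = i' \<and> [j = j'] (mod int n)" if "i < m" "i' < m" for i i' j j'
    using v_eq_iff[OF p p] pinj that by simp
  show "D (p i) (p i') \<subseteq> {0..<int n}" if "i < m" "i' < m" for i i'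
    using D_subset[OF p p] that by simp
  show "(v (p i) j, v (p i') j') \<in> parcs G \<longleftrightarrow> (j' - j) mod int n \<in> D (p i) (p i')"
    if "i < m" "i' < m" for i i' j j'
    using arc_iff[OF p p] that by simp
qed (rule n_pos)

text \<open>Moving the origin of orbit \<open>i\<close> by \<open>s i\<close> translates the
  connection set from \<open>i\<close> to \<open>i'\<close> by \<open>s i - s i'\<close>. This
  freedom later turns the edges to the \<open>z\<close> orbit into \<open>x_j z_j\<close> and
  \<open>y_j z_j\<close>.\<close>

lemma (in orbit_frame) shift:
  "orbit_frame G m n (\<lambda>i j. v i (j + s i)) (\<lambda>i i'. {d \<in> {0..<int n}. (d + s i' - s i) mod int n \<in> D i i'})"
proof
  show "pverts G = {v i (j + s i) |i j. i < m}"
  proof (intro equalityI subsetI)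
    fix u assume "u \<in> pverts G"
    then obtain i j where ij: "i < m" "u = v i j" unfolding verts by blast
    then have "u = v i ((j - s i) + s i)" by simp
    then show "u \<in> {v i (j + s i) |i j. i < m}" using ij by blast
  qed (use verts in blast)
  show "v i (j + s i) = v i' (j' + s i') \<longleftrightarrow> i = i' \<and> [j = j'] (mod int n)" if "i < m" "i' < m" for i i' j j'
    using v_eq_iff[OF that] by (auto simp: cong_add_rcancel)
  show "(v i (j + s i), v i' (j' + s i')) \<in> parcs G \<longleftrightarrow>
      (j' - j) mod int n \<in> {d \<in> {0..<int n}. (d + s i' - s i) mod int n \<in> D i i'}" if "i < m" "i' < m" for i i' j j'
  proof -
    have "((j' - j) mod int n + (s i' - s i)) mod int n = ((j' - j) + (s i' - s i)) mod int n"
      by (rule mod_add_left_eq)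
    then have "((j' - j) mod int n + s i' - s i) mod int n = (j' + s i' - (j + s i)) mod int n"
      by (simp add: algebra_simps)
    then show ?thesis using arc_iff[OF that] n_pos by simp
  qed
qed (use n_pos in auto)

subsection \<open>Nullity of the two families\<close>

lemma sum_lessThan_3: "(\<Sum>i<3. f i) = f 0 + f 1 + f (2::nat)"
  by (simp add: numeral_3_eq_3 numeral_2_eq_2)

lemma less_3_cases: "i < 3 \<Longrightarrow> i = 0 \<or> i = 1 \<or> i = (2::nat)"
  by auto

definition tri_label :: "nat \<Rightarrow> nat \<Rightarrow> int \<Rightarrow> tri_vertex" where
  "tri_label n i j = (if i = 0 then VX else if i = 1 then VY else VZ) (nat (j mod int n))"

text \<open>The indices 0, 1, 2 stand for the orbits \<open>x\<close>, \<open>y\<close>,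
  \<open>z\<close>. Connection sets consist of representatives in \<open>{0..<int n}\<close>; since
  \<open>a\<close> may be \<open>0\<close>, the reversed differences are reduced modulo
  \<open>n\<close> rather than written as \<open>int n - int a\<close>.\<close>

definition T1_conn :: "nat \<Rightarrow> nat \<Rightarrow> nat \<Rightarrow> nat \<Rightarrow> nat \<Rightarrow> int set" where
  "T1_conn n a b i i' =
     (if i = 0 \<and> i' = 1 then {int a, int b}
      else if i = 1 \<and> i' = 0 then {(- int a) mod int n, (- int b) mod int n}
      else if i = 2 \<and> i' = 2 then {int (n div 2)}
      else if i \<noteq> i' then {0} else {})"

definition T4_conn :: "nat \<Rightarrow> nat \<Rightarrow> nat \<Rightarrow> nat \<Rightarrow> nat \<Rightarrow> int set" where
  "T4_conn n a b i i' =
     (if i = i' then (if i = 0 then {int a, int n - int a} else if i = 1 then {int b, int n - int b}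
        else {int (n div 2)})
      else if i = 2 \<or> i' = 2 then {0} else {})"

lemma nat_mod_eq_iff:
  assumes "n > 0"
  shows "nat (j mod int n) = nat (j' mod int n) \<longleftrightarrow> (j' - j) mod int n = 0"
proof -
  have "nat (j mod int n) = nat (j' mod int n) \<longleftrightarrow> j mod int n = j' mod int n"
    using assms by (simp add: eq_nat_nat_iff)
  also have "\<dots> \<longleftrightarrow> (j' - j) mod int n = 0"
    by (simp add: mod_eq_dvd_iff dvd_diff_commute mod_eq_0_iff_dvd)
  finally show ?thesis .
qed

lemma nat_mod_add_eq_iff:
  assumes "n > 0"
  shows "nat (j' mod int n) = (nat (j mod int n) + a) mod n \<longleftrightarrow> (j' - j) mod int n = int a mod int n"
proof -
  have "nat (j' mod int n) = (nat (j mod int n) + a) mod n \<longleftrightarrow>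
      int (nat (j' mod int n)) = int ((nat (j mod int n) + a) mod n)" by (simp only: of_nat_eq_iff)
  also have "\<dots> \<longleftrightarrow> j' mod int n = (j + int a) mod int n"
    using assms by (simp add: of_nat_mod mod_add_left_eq)
  also have "\<dots> \<longleftrightarrow> (j' - j) mod int n = int a mod int n"
    by (simp add: mod_eq_dvd_iff algebra_simps)
  finally show ?thesis .
qed

lemma mod_swap_eq_iff:
  fixes j j' :: int
  assumes "c < n"
  shows "(j - j') mod int n = int c \<longleftrightarrow> (j' - j) mod int n = (- int c) mod int n"
proof -
  have "(j - j') mod int n = int c mod int n \<longleftrightarrow> (- (j - j')) mod int n = (- int c) mod int n"
    by (metis mod_minus_cong minus_minus)
  then show ?thesis using assms by simp
qed

lemma neg_half_mod:
  assumes "even n" "n > 0"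
  shows "(- int (n div 2)) mod int n = int (n div 2)"
proof -
  obtain h where "n = 2 * h" using assms(1) by blast
  then show ?thesis using assms(2) by (simp add: zmod_zminus1_eq_if)
qed

lemma T1_arcs:
  "(VX p, VY q) \<in> parcs (T1 n a b) \<longleftrightarrow> p < n \<and> (q = (p + a) mod n \<or> q = (p + b) mod n)"
  "(VY q, VX p) \<in> parcs (T1 n a b) \<longleftrightarrow> p < n \<and> (q = (p + a) mod n \<or> q = (p + b) mod n)"
  "(VX p, VZ q) \<in> parcs (T1 n a b) \<longleftrightarrow> p < n \<and> p = q"
  "(VZ p, VX q) \<in> parcs (T1 n a b) \<longleftrightarrow> p < n \<and> p = q"
  "(VY p, VZ q) \<in> parcs (T1 n a b) \<longleftrightarrow> p < n \<and> p = q"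
  "(VZ p, VY q) \<in> parcs (T1 n a b) \<longleftrightarrow> p < n \<and> p = q"
  "(VZ p, VZ q) \<in> parcs (T1 n a b) \<longleftrightarrow>
     p < n \<and> q = (p + n div 2) mod n \<or> q < n \<and> p = (q + n div 2) mod n"
  "(VX p, VX q) \<notin> parcs (T1 n a b)" "(VY p, VY q) \<notin> parcs (T1 n a b)"
  by (auto simp: T1_def tri_graph_def)

lemma T4_arcs:
  "(VX p, VX q) \<in> parcs (T4 n a b) \<longleftrightarrow> p < n \<and> q = (p + a) mod n \<or> q < n \<and> p = (q + a) mod n"
  "(VY p, VY q) \<in> parcs (T4 n a b) \<longleftrightarrow> p < n \<and> q = (p + b) mod n \<or> q < n \<and> p = (q + b) mod n"
  "(VX p, VZ q) \<in> parcs (T4 n a b) \<longleftrightarrow> p < n \<and> p = q"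
  "(VZ p, VX q) \<in> parcs (T4 n a b) \<longleftrightarrow> p < n \<and> p = q"
  "(VY p, VZ q) \<in> parcs (T4 n a b) \<longleftrightarrow> p < n \<and> p = q"
  "(VZ p, VY q) \<in> parcs (T4 n a b) \<longleftrightarrow> p < n \<and> p = q"
  "(VZ p, VZ q) \<in> parcs (T4 n a b) \<longleftrightarrow>
     p < n \<and> q = (p + n div 2) mod n \<or> q < n \<and> p = (q + n div 2) mod n"
  "(VX p, VY q) \<notin> parcs (T4 n a b)" "(VY p, VX q) \<notin> parcs (T4 n a b)"
  by (auto simp: T4_def tri_graph_def)

lemma tri_graph_orbit_frame:
  assumes n: "n > 0" and verts: "pverts G = pverts (tri_graph n {})"
    and sub: "\<And>i i'. i < 3 \<Longrightarrow> i' < 3 \<Longrightarrow> D i i' \<subseteq> {0..<int n}"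
    and arc: "\<And>i i' j j'. i < 3 \<Longrightarrow> i' < 3 \<Longrightarrow>
      (tri_label n i j, tri_label n i' j') \<in> parcs G \<longleftrightarrow> (j' - j) mod int n \<in> D i i'"
  shows "orbit_frame G 3 n (tri_label n) D"
proof
  have pos: "0 \<le> j mod int n" "nat (j mod int n) < n" for j
    using n by (simp_all add: nat_less_iff)
  show "pverts G = {tri_label n i j |i j. i < 3}"
  proof (intro equalityI subsetI)
    fix u assume "u \<in> pverts G"
    then obtain k where k: "k < n" "u = VX k \<or> u = VY k \<or> u = VZ k"
      unfolding verts by (auto simp: tri_graph_def)
    then have "u = tri_label n 0 (int k) \<or> u = tri_label n 1 (int k) \<or> u = tri_label n 2 (int k)"
      by (auto simp: tri_label_def)
    then show "u \<in> {tri_label n i j |i j. i < 3}" by fastforce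
  next
    fix u assume "u \<in> {tri_label n i j |i j. i < 3}"
    then show "u \<in> pverts G" unfolding verts using pos by (auto simp: tri_label_def tri_graph_def)
  qed
  show "tri_label n i j = tri_label n i' j' \<longleftrightarrow> i = i' \<and> [j = j'] (mod int n)"
    if "i < 3" "i' < 3" for i i' j j'
  proof -
    have "nat (j mod int n) = nat (j' mod int n) \<longleftrightarrow> [j = j'] (mod int n)"
      by (metis pos(1) cong_def eq_nat_nat_iff)
    then show ?thesis using less_3_cases[OF that(1)] less_3_cases[OF that(2)]
      by (auto simp: tri_label_def)
  qed
qed (use assms in auto)

lemma T1_orbit_frame:
  assumes n: "even n" and ab: "a < b" "b < n"
  shows "orbit_frame (T1 n a b) 3 n (tri_label n) (T1_conn n a b)"
proof (rule tri_graph_orbit_frame)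
  show "T1_conn n a b i i' \<subseteq> {0..<int n}" for i i' using ab by (auto simp: T1_conn_def)
  fix i i' :: nat and j j' assume i: "i < 3" "i' < 3"
  have n0: "n > 0" using ab by simp
  have lt: "nat (j mod int n) < n" "nat (j' mod int n) < n" using n0 by (simp_all add: nat_less_iff)
  have small: "int a mod int n = int a" "int b mod int n = int b" "int (n div 2) mod int n = int (n div 2)"
    using ab by simp_all
  have swap: "(j - j') mod int n = int c \<longleftrightarrow> (j' - j) mod int n = (- int c) mod int n"
    if "c \<in> {a, b, n div 2}" for c
    using that ab n0 by (intro mod_swap_eq_iff) auto
  show "(tri_label n i j, tri_label n i' j') \<in> parcs (T1 n a b) \<longleftrightarrow> (j' - j) mod int n \<in> T1_conn n a b i i'"
    using less_3_cases[OF i(1)] less_3_cases[OF i(2)]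
    by (elim disjE; simp add: tri_label_def T1_conn_def T1_arcs lt nat_mod_eq_iff[OF n0] nat_mod_add_eq_iff[OF n0]
      swap small neg_half_mod[OF n n0])
qed (use ab in \<open>auto simp: T1_def tri_graph_def\<close>)

lemma T4_orbit_frame:
  assumes n: "even n" and ab: "0 < a" "a \<le> b" "b < n div 2"
  shows "orbit_frame (T4 n a b) 3 n (tri_label n) (T4_conn n a b)"
proof (rule tri_graph_orbit_frame)
  show "T4_conn n a b i i' \<subseteq> {0..<int n}" for i i' using ab by (auto simp: T4_conn_def)
  fix i i' :: nat and j j' assume i: "i < 3" "i' < 3"
  have n0: "n > 0" using ab by simp
  have lt: "nat (j mod int n) < n" "nat (j' mod int n) < n" using n0 by (simp_all add: nat_less_iff)
  have small: "int a mod int n = int a" "int b mod int n = int b" "int (n div 2) mod int n = int (n div 2)"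
    using ab by simp_all
  have neg: "(- int c) mod int n = int n - int c" if "0 < c" "c < n" for c
    using that by (simp add: zmod_zminus1_eq_if)
  have negs: "(- int a) mod int n = int n - int a" "(- int b) mod int n = int n - int b"
    using ab by (auto intro!: neg)
  have swap: "(j - j') mod int n = int c \<longleftrightarrow> (j' - j) mod int n = (- int c) mod int n"
    if "c \<in> {a, b, n div 2}" for c
    using that ab n0 by (intro mod_swap_eq_iff) auto
  show "(tri_label n i j, tri_label n i' j') \<in> parcs (T4 n a b) \<longleftrightarrow> (j' - j) mod int n \<in> T4_conn n a b i i'"
    using less_3_cases[OF i(1)] less_3_cases[OF i(2)]
    by (elim disjE; simp add: tri_label_def T4_conn_def T4_arcs lt nat_mod_eq_iff[OF n0] nat_mod_add_eq_iff[OF n0]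
      swap small neg_half_mod[OF n n0] negs)
qed (use ab in \<open>auto simp: T4_def tri_graph_def\<close>)

text \<open>Both families have the kernel spanned by \<open>(1, 1, - 2)\<close> at
  \<open>w = 1\<close>: an \<open>x\<close> or \<open>y\<close> vertex has one \<open>z\<close>
  neighbour and two others, and a \<open>z\<close> vertex has one neighbour in each orbit.\<close>

lemma (in orbit_frame) nut_graph_iff_triple_kernel:
  fixes K :: "complex \<Rightarrow> (complex \<times> complex \<times> complex) set"
  assumes m: "m = 3"
    and ker: "\<And>w W. w ^ n = 1 \<Longrightarrow> W \<in> symbol_kernel w \<longleftrightarrow> (W 0, W 1, W 2) \<in> K w"
    and K1: "\<And>x y z. (x, y, z) \<in> K 1 \<longleftrightarrow> y = x \<and> z = - 2 * x"
  shows "nut_graph G \<longleftrightarrow> (\<forall>w. w ^ n = 1 \<longrightarrow> w \<noteq> 1 \<longrightarrow> K w = {(0, 0, 0)})"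
proof -
  define W0 :: "nat \<Rightarrow> real" where "W0 i = (if i = 2 then - 2 else 1)" for i
  have "nut_graph G \<longleftrightarrow> (\<forall>w :: complex. w ^ n = 1 \<longrightarrow> w \<noteq> 1 \<longrightarrow> (\<forall>W \<in> symbol_kernel w. \<forall>i<m. W i = 0))"
  proof (rule nut_graph_iff_symbol_kernel[of W0])
    show "(\<lambda>i. complex_of_real (W0 i)) \<in> symbol_kernel 1"
      by (simp add: ker K1 W0_def)
    fix W :: "nat \<Rightarrow> complex" assume "W \<in> symbol_kernel 1"
    then have "W 1 = W 0" "W 2 = - 2 * W 0" by (simp_all add: ker K1)
    then have "\<forall>i<m. W i = W 0 * complex_of_real (W0 i)" unfolding m by (auto simp: W0_def dest!: less_3_cases)
    then show "\<exists>c. \<forall>i<m. W i = c * complex_of_real (W0 i)" by blast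
  qed (simp_all add: W0_def m)
  also have "\<dots> \<longleftrightarrow> (\<forall>w. w ^ n = 1 \<longrightarrow> w \<noteq> 1 \<longrightarrow> K w = {(0, 0, 0)})"
  proof -
    have "(\<forall>W \<in> symbol_kernel w. \<forall>i<m. W i = 0) \<longleftrightarrow> K w = {(0, 0, 0)}" if w: "w ^ n = 1" for w :: complex
    proof
      assume triv: "\<forall>W \<in> symbol_kernel w. \<forall>i<m. W i = 0"
      have "x = 0 \<and> y = 0 \<and> z = 0" if xyz: "(x, y, z) \<in> K w" for x y z
      proof -
        define W where "W i = (if i = 0 then x else if i = 1 then y else z)" for i :: nat
        have "W \<in> symbol_kernel w" using xyz by (simp add: ker[OF w] W_def)
        then have "W 0 = 0" "W 1 = 0" "W 2 = 0" using triv m by auto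
        then show ?thesis by (simp add: W_def)
      qed
      moreover have "(\<lambda>i. 0) \<in> symbol_kernel w" by (simp add: symbol_kernel_def)
      then have "(0, 0, 0) \<in> K w" unfolding ker[OF w] .
      ultimately show "K w = {(0, 0, 0)}" by (rule triple_set_eq_zero)
    next
      assume K: "K w = {(0, 0, 0)}"
      show "\<forall>W \<in> symbol_kernel w. \<forall>i<m. W i = 0"
      proof (intro ballI allI impI)
        fix W :: "nat \<Rightarrow> complex" and i assume "W \<in> symbol_kernel w" and i: "i < m"
        then have "W 0 = 0" "W 1 = 0" "W 2 = 0" unfolding ker[OF w] K by simp_all
        then show "W i = 0" using less_3_cases[of i] i m by auto
      qed
    qed
    then show ?thesis by simp
  qed
  finally show ?thesis .
qed

lemma (in orbit_frame) symbol_kernel_3: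
  assumes "m = 3"
  shows "W \<in> symbol_kernel w \<longleftrightarrow> (\<forall>i\<in>{0, 1, 2}. symbol w i 0 * W 0 + symbol w i 1 * W 1 + symbol w i 2 * W 2 = 0)"
proof -
  have "(\<forall>i<m. P i) \<longleftrightarrow> (\<forall>i\<in>{0, 1, 2}. P i)" for P using assms by (auto dest: less_3_cases)
  then show ?thesis unfolding symbol_kernel_def mem_Collect_eq by (simp add: assms sum_lessThan_3)
qed

lemma nut_graph_T1_frame:
  assumes fr: "orbit_frame G 3 n v (T1_conn n a b)" and n: "even n" and ab: "a < b" "b < n"
  shows "nut_graph G \<longleftrightarrow> gcd (n div 2) a = 1 \<and> gcd (n div 2) b = 1 \<and>
       \<not> [a = n div 2] (mod 2) \<and> \<not> [b = n div 2] (mod 2) \<and>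
       multiplicity 2 (b - a) \<ge> multiplicity 2 n" (is "_ \<longleftrightarrow> ?C")
proof -
  interpret orbit_frame G 3 n v "T1_conn n a b" by (rule fr)
  have n0: "n > 0" using ab by simp
  \<comment> \<open>The symbol is a sum over a set, so the two reversed differences must be distinct
    to contribute two terms.\<close>
  have neg_ne: "(- int a) mod int n \<noteq> (- int b) mod int n"
    using ab by (auto simp: mod_eq_dvd_iff dest!: zdvd_imp_le)
  have "nut_graph G \<longleftrightarrow> (\<forall>w. w ^ n = 1 \<longrightarrow> w \<noteq> 1 \<longrightarrow> T1_symbol_kernel n a b w = {(0, 0, 0)})"
  proof (rule nut_graph_iff_triple_kernel)
    fix w :: complex and W assume w: "w ^ n = 1"
    have "w powi ((- int c) mod int n) = 1 / w ^ c" for c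
      using power_int_cong[OF w, of "(- int c) mod int n" "- int c"] by (simp add: power_int_minus divide_inverse)
    then have sym: "symbol w 0 0 = 0" "symbol w 0 1 = w ^ a + w ^ b" "symbol w 0 2 = 1"
      "symbol w 1 0 = 1 / w ^ a + 1 / w ^ b" "symbol w 1 1 = 0" "symbol w 1 2 = 1"
      "symbol w 2 0 = 1" "symbol w 2 1 = 1" "symbol w 2 2 = w ^ (n div 2)"
      using ab neg_ne by (simp_all add: symbol_def T1_conn_def)
    show "W \<in> symbol_kernel w \<longleftrightarrow> (W 0, W 1, W 2) \<in> T1_symbol_kernel n a b w"
      unfolding symbol_kernel_3[OF refl] by (simp add: sym[unfolded One_nat_def] T1_symbol_kernel_def add.assoc)
  next
    fix x y z :: complex
    show "(x, y, z) \<in> T1_symbol_kernel n a b 1 \<longleftrightarrow> y = x \<and> z = - 2 * x"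
      by (auto simp: T1_symbol_kernel_def add_eq_0_iff)
  qed simp
  also have "\<dots> \<longleftrightarrow> ?C"
  proof
    assume triv: "\<forall>w. w ^ n = 1 \<longrightarrow> w \<noteq> 1 \<longrightarrow> T1_symbol_kernel n a b w = {(0, 0, 0)}"
    show ?C by (rule ccontr, erule T1_symbol_kernel_nontrivial[OF n n0 ab(1)]) (use triv in blast)
  next
    assume ?C
    then show "\<forall>w. w ^ n = 1 \<longrightarrow> w \<noteq> 1 \<longrightarrow> T1_symbol_kernel n a b w = {(0, 0, 0)}"
      by (intro allI impI T1_symbol_kernel_trivial[OF n n0 ab(1)]) simp_all
  qed
  finally show ?thesis .
qed

lemma nut_graph_T4_frame:
  assumes fr: "orbit_frame G 3 n v (T4_conn n a b)" and n: "even n" and ab: "0 < a" "a \<le> b" "b < n div 2"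
  shows "nut_graph G \<longleftrightarrow> gcd (n div 2) (gcd a b) = 1 \<and>
       (\<not> 4 dvd n \<longrightarrow> even a \<or> even b) \<and>
       (4 dvd n \<longrightarrow> even a \<noteq> even b) \<and>
       (10 dvd n \<longrightarrow> 5 dvd int a \<or> 5 dvd int b \<or> 5 dvd int a - int b \<or> 5 dvd int a + int b)" (is "_ \<longleftrightarrow> ?C")
proof -
  interpret orbit_frame G 3 n v "T4_conn n a b" by (rule fr)
  have n0: "n > 0" using ab by simp
  have "nut_graph G \<longleftrightarrow> (\<forall>w. w ^ n = 1 \<longrightarrow> w \<noteq> 1 \<longrightarrow> T4_symbol_kernel n a b w = {(0, 0, 0)})"
  proof (rule nut_graph_iff_triple_kernel)
    fix w :: complex and W assume w: "w ^ n = 1"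
    have "w powi (int n - int c) = 1 / w ^ c" for c
      using power_int_cong[OF w, of "int n - int c" "- int c"]
      by (simp add: cong_def power_int_minus divide_inverse)
    moreover have "int a \<noteq> int n - int a" "int b \<noteq> int n - int b" using ab by auto
    ultimately have sym: "symbol w 0 0 = w ^ a + 1 / w ^ a" "symbol w 0 1 = 0" "symbol w 0 2 = 1"
      "symbol w 1 0 = 0" "symbol w 1 1 = w ^ b + 1 / w ^ b" "symbol w 1 2 = 1"
      "symbol w 2 0 = 1" "symbol w 2 1 = 1" "symbol w 2 2 = w ^ (n div 2)"
      by (simp_all add: symbol_def T4_conn_def)
    show "W \<in> symbol_kernel w \<longleftrightarrow> (W 0, W 1, W 2) \<in> T4_symbol_kernel n a b w"
      unfolding symbol_kernel_3[OF refl] by (simp add: sym[unfolded One_nat_def] T4_symbol_kernel_def add.assoc)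
  next
    fix x y z :: complex
    show "(x, y, z) \<in> T4_symbol_kernel n a b 1 \<longleftrightarrow> y = x \<and> z = - 2 * x"
      by (auto simp: T4_symbol_kernel_def add_eq_0_iff)
  qed simp
  also have "\<dots> \<longleftrightarrow> ?C"
  proof
    assume triv: "\<forall>w. w ^ n = 1 \<longrightarrow> w \<noteq> 1 \<longrightarrow> T4_symbol_kernel n a b w = {(0, 0, 0)}"
    show ?C by (rule ccontr, erule T4_symbol_kernel_nontrivial[OF n n0]) (use triv in blast)
  next
    assume ?C
    then show "\<forall>w. w ^ n = 1 \<longrightarrow> w \<noteq> 1 \<longrightarrow> T4_symbol_kernel n a b w = {(0, 0, 0)}"
      by (intro allI impI T4_symbol_kernel_trivial[OF n n0]) simp_all
  qed
  finally show ?thesis .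
qed

subsection \<open>Frames of tricirculant graphs\<close>

lemma group_automorphism_group: "group (automorphism_group G)"
proof -
  let ?S = "pverts G"
  let ?K = "{\<sigma> \<in> Bij ?S. \<forall>u \<in> ?S. \<forall>v \<in> ?S. (\<sigma> u, \<sigma> v) \<in> parcs G \<longleftrightarrow> (u, v) \<in> parcs G}"
  interpret B: group "BijGroup ?S" by (rule group_BijGroup)
  have Bij: "\<sigma> u \<in> ?S" if "\<sigma> \<in> Bij ?S" "u \<in> ?S" for \<sigma> u
    using that Bij_imp_funcset by blast
  have inv: "inv\<^bsub>BijGroup ?S\<^esub> \<sigma> = (\<lambda>u\<in>?S. inv_into ?S \<sigma> u)" if "\<sigma> \<in> Bij ?S" for \<sigma>
    using that by (rule inv_BijGroup)
  have "subgroup ?K (BijGroup ?S)"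
  proof (rule B.subgroupI)
    show "?K \<subseteq> carrier (BijGroup ?S)" by (auto simp: BijGroup_def)
    have "(\<lambda>u\<in>?S. u) \<in> ?K" using id_Bij by auto
    then show "?K \<noteq> {}" by blast
  next
    fix \<sigma> assume s: "\<sigma> \<in> ?K"
    then have sB: "\<sigma> \<in> Bij ?S" by simp
    have sarc: "\<forall>u \<in> ?S. \<forall>v \<in> ?S. (\<sigma> u, \<sigma> v) \<in> parcs G \<longleftrightarrow> (u, v) \<in> parcs G" using s by simp
    have i: "\<sigma> (inv_into ?S \<sigma> u) = u" "inv_into ?S \<sigma> u \<in> ?S" if "u \<in> ?S" for u
      using sB that by (auto simp: Bij_def bij_betw_def f_inv_into_f inv_into_into)
    have "(inv_into ?S \<sigma> u, inv_into ?S \<sigma> w) \<in> parcs G \<longleftrightarrow> (u, w) \<in> parcs G" if "u \<in> ?S" "w \<in> ?S" for u w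
      using sarc[rule_format, OF i(2)[OF that(1)] i(2)[OF that(2)]] i(1) that by simp
    then show "inv\<^bsub>BijGroup ?S\<^esub> \<sigma> \<in> ?K"
      using restrict_inv_into_Bij[OF sB] unfolding inv[OF sB] by simp
  next
    fix \<sigma> \<tau> assume s: "\<sigma> \<in> ?K" "\<tau> \<in> ?K"
    then have B: "\<sigma> \<in> Bij ?S" "\<tau> \<in> Bij ?S" by auto
    have "\<sigma> \<otimes>\<^bsub>BijGroup ?S\<^esub> \<tau> = compose ?S \<sigma> \<tau>" using B by (simp add: BijGroup_def)
    then show "\<sigma> \<otimes>\<^bsub>BijGroup ?S\<^esub> \<tau> \<in> ?K"
      using s compose_Bij[OF B] Bij[OF B(2)] by (simp add: compose_def)
  qed
  then show ?thesis unfolding automorphism_group_def by (rule subgroup.subgroup_is_group) (rule group_BijGroup)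
qed

section \<open>Integer actions with finite orbits\<close>

locale int_action =
  fixes S :: "'a set" and \<rho> :: "int \<Rightarrow> 'a \<Rightarrow> 'a"
  assumes closed: "u \<in> S \<Longrightarrow> \<rho> k u \<in> S"
    and add: "u \<in> S \<Longrightarrow> \<rho> (j + k) u = \<rho> j (\<rho> k u)"
    and zero: "u \<in> S \<Longrightarrow> \<rho> 0 u = u"
begin

lemma eq_iff_period:
  assumes "u \<in> S"
  shows "\<rho> j u = \<rho> k u \<longleftrightarrow> \<rho> (j - k) u = u"
proof
  assume "\<rho> j u = \<rho> k u"
  then have "\<rho> (- k) (\<rho> j u) = \<rho> (- k) (\<rho> k u)" by simp
  then show "\<rho> (j - k) u = u" using assms by (simp add: add[symmetric] zero)
next
  assume "\<rho> (j - k) u = u"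
  then have "\<rho> k (\<rho> (j - k) u) = \<rho> k u" by simp
  then show "\<rho> j u = \<rho> k u" using assms by (simp add: add[symmetric])
qed

text \<open>Finiteness forces a collision and hence a positive period of \<open>u\<close>. The least
  one, \<open>t\<close>, divides every period, and the residues modulo \<open>t\<close> enumerate
  the orbit without repetition.\<close>

lemma eq_iff_cong_card_orbit:
  assumes u: "u \<in> S" and fin: "finite (range (\<lambda>k. \<rho> k u))"
  shows "\<rho> j u = \<rho> k u \<longleftrightarrow> [j = k] (mod int (card (range (\<lambda>k. \<rho> k u))))"
    and "card (range (\<lambda>k. \<rho> k u)) > 0"
proof -
  have "\<not> inj (\<lambda>k. \<rho> k u)" using fin finite_imageD infinite_UNIV_int by blast
  then obtain j0 k0 where "\<rho> j0 u = \<rho> k0 u" "j0 \<noteq> k0" unfolding inj_def by blast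
  then obtain d where d: "\<rho> d u = u" "d \<noteq> 0" using eq_iff_period[OF u] by (metis eq_iff_diff_eq_0)
  have neg: "\<rho> (- e) u = u" if "\<rho> e u = u" for e
    using eq_iff_period[OF u, of 0 e] that u by (simp add: zero)
  have "\<rho> (int (nat \<bar>d\<bar>)) u = u" using d neg by (auto simp: abs_if)
  then have ex: "\<exists>t. t > 0 \<and> \<rho> (int t) u = u" using d(2) by (intro exI[of _ "nat \<bar>d\<bar>"]) auto
  define t where "t = (LEAST t. t > 0 \<and> \<rho> (int t) u = u)"
  have t: "t > 0" "\<rho> (int t) u = u" using LeastI_ex[OF ex] by (simp_all add: t_def)
  have tmin: "t \<le> r" if "r > 0" "\<rho> (int r) u = u" for r
    unfolding t_def using that by (intro Least_le) auto
  have mult: "\<rho> (int t * q) u = u" for q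
  proof (induction q rule: int_induct[of _ 0])
    case (step1 q)
    then show ?case using add[OF u, of "int t * q" "int t"] t(2) by (simp add: algebra_simps)
  next
    case (step2 q)
    then show ?case using add[OF u, of "int t * q" "- int t"] neg[OF t(2)] by (simp add: algebra_simps)
  qed (simp add: zero u)
  have mod: "\<rho> e u = \<rho> (e mod int t) u" for e
    using add[OF u, of "e mod int t" "int t * (e div int t)"] mult by simp
  have period: "\<rho> e u = u \<longleftrightarrow> int t dvd e" for e
  proof
    assume "\<rho> e u = u"
    then have "\<rho> (int (nat (e mod int t))) u = u" using mod t(1) by simp
    moreover have "nat (e mod int t) < t" using t(1) by (simp add: nat_less_iff)
    ultimately have "nat (e mod int t) = 0" using tmin by (meson gr0I not_le)
    moreover have "e mod int t \<ge> 0" using t(1) by simp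
    ultimately have "e mod int t = 0" by linarith
    then show "int t dvd e" by (simp add: dvd_eq_mod_eq_0)
  qed (use mult in auto)
  have "range (\<lambda>k. \<rho> k u) = (\<lambda>k. \<rho> k u) ` {0..<int t}"
    using mod t(1) by (auto intro!: image_eqI[of _ _ "_ mod int t"])
  moreover have "inj_on (\<lambda>k. \<rho> k u) {0..<int t}"
  proof (rule inj_onI)
    fix x y assume xy: "x \<in> {0..<int t}" "y \<in> {0..<int t}" and "\<rho> x u = \<rho> y u"
    then have "x mod int t = y mod int t"
      by (simp only: eq_iff_period[OF u] period mod_eq_dvd_iff)
    then show "x = y" using xy by simp
  qed
  ultimately have "card (range (\<lambda>k. \<rho> k u)) = t" by (simp add: card_image)
  then show "\<rho> j u = \<rho> k u \<longleftrightarrow> [j = k] (mod int (card (range (\<lambda>k. \<rho> k u))))"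
    and "card (range (\<lambda>k. \<rho> k u)) > 0"
    using t(1) by (simp_all add: eq_iff_period[OF u] period cong_iff_dvd_diff)
qed

end

text \<open>Every orbit receives a base point \<open>p i\<close>, and \<open>v i j\<close> is its
  image under \<open>\<rho> j\<close>. Equal orbit sizes provide one modulus \<open>n\<close> for
  all orbits. Translating an arc back to the base point shows that only the difference of the labels
  matters.\<close>

lemma orbit_frame_of_int_action:
  assumes act: "int_action (pverts G) \<rho>" and fin: "finite (pverts G)"
    and aut: "\<And>k u w. u \<in> pverts G \<Longrightarrow> w \<in> pverts G \<Longrightarrow> (\<rho> k u, \<rho> k w) \<in> parcs G \<longleftrightarrow> (u, w) \<in> parcs G"
    and card: "card ((\<lambda>u. range (\<lambda>k. \<rho> k u)) ` pverts G) = m" "m > 0"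
    and size: "\<And>u. u \<in> pverts G \<Longrightarrow> card (range (\<lambda>k. \<rho> k u)) = n"
  obtains v D where "orbit_frame G m n v D"
proof -
  interpret int_action "pverts G" \<rho> by (rule act)
  define orb where "orb u = range (\<lambda>k. \<rho> k u)" for u
  have finorb: "finite (orb u)" if "u \<in> pverts G" for u
    using that closed by (intro finite_subset[OF _ fin]) (auto simp: orb_def)
  have "finite (orb ` pverts G)" using fin by simp
  then obtain e where e: "bij_betw e {..<m} (orb ` pverts G)"
    using ex_bij_betw_nat_finite[of "orb ` pverts G"] card by (auto simp: orb_def lessThan_atLeast0)
  have "\<exists>u. u \<in> pverts G \<and> e i = orb u" if "i < m" for i
    using bij_betwE[OF e] that by blast
  then obtain p where p: "\<And>i. i < m \<Longrightarrow> p i \<in> pverts G" "\<And>i. i < m \<Longrightarrow> e i = orb (p i)" by metis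
  have orb_shift: "orb (\<rho> k u) = orb u" if "u \<in> pverts G" for k u
  proof -
    have "\<rho> j u \<in> orb (\<rho> k u)" for j
      using add[OF that, of "j - k" k] by (auto simp: orb_def)
    moreover have "\<rho> j (\<rho> k u) \<in> orb u" for j
      unfolding orb_def add[OF that, symmetric] by (rule rangeI)
    ultimately show ?thesis by (auto simp: orb_def)
  qed
  define v where "v i j = \<rho> j (p i)" for i j
  define D where "D i i' = {d \<in> {0..<int n}. (p i, \<rho> d (p i')) \<in> parcs G}" for i i'
  have eq: "v i j = v i j' \<longleftrightarrow> [j = j'] (mod int n)" if "i < m" for i j j'
    using eq_iff_cong_card_orbit(1)[OF p(1)[OF that]] finorb[OF p(1)[OF that]] size[OF p(1)[OF that]]
    by (simp add: v_def orb_def)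
  have "orbit_frame G m n v D"
  proof
    show "n > 0"
      using eq_iff_cong_card_orbit(2)[of "p 0"] p(1)[OF card(2)] finorb size by (simp add: orb_def)
    then have n: "int n > 0" by simp
    show "pverts G = {v i j |i j. i < m}"
    proof (intro equalityI subsetI)
      fix u assume u: "u \<in> pverts G"
      then obtain i where i: "i < m" "e i = orb u" using e by (metis bij_betw_iff_bijections image_eqI lessThan_iff)
      have "u \<in> orb u" using zero[OF u] by (metis orb_def rangeI)
      then have "u \<in> orb (p i)" using i p(2) by simp
      then obtain j where "u = v i j" by (auto simp: orb_def v_def)
      then show "u \<in> {v i j |i j. i < m}" using i by blast
    qed (use closed p in \<open>auto simp: v_def\<close>)
    show "v i j = v i' j' \<longleftrightarrow> i = i' \<and> [j = j'] (mod int n)" if i: "i < m" "i' < m" for i i' j j'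
    proof (cases "i = i'")
      case False
      have "v i j \<noteq> v i' j'"
      proof
        assume "v i j = v i' j'"
        then have "orb (p i) = orb (p i')" using orb_shift p(1) i unfolding v_def by metis
        then show False using False e i p(2) by (metis bij_betw_imp_inj_on inj_on_eq_iff lessThan_iff)
      qed
      then show ?thesis using False by simp
    qed (use eq i in simp)
    show "(v i j, v i' j') \<in> parcs G \<longleftrightarrow> (j' - j) mod int n \<in> D i i'" if i: "i < m" "i' < m" for i i' j j'
    proof -
      have "v i' j' = \<rho> j (\<rho> (j' - j) (p i'))" using add[OF p(1)[OF i(2)], of j "j' - j"] by (simp add: v_def)
      then have "(v i j, v i' j') \<in> parcs G \<longleftrightarrow> (p i, v i' (j' - j)) \<in> parcs G"
        using aut[OF p(1)[OF i(1)] closed[OF p(1)[OF i(2)]]] by (simp add: v_def)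
      also have "v i' (j' - j) = v i' ((j' - j) mod int n)" using eq[OF i(2)] by (simp add: cong_def)
      finally show ?thesis using n by (simp add: D_def v_def)
    qed
  qed (auto simp: D_def)
  then show thesis by (rule that)
qed

lemma tricirculant_orbit_frame:
  assumes tri: "tricirculant G" and fin: "finite (pverts G)"
  obtains n v D where "orbit_frame G 3 n v D"
proof -
  define A where "A = automorphism_group G"
  obtain H where H0: "subgroup H A \<and> cyclic_group (A\<lparr>carrier := H\<rparr>) \<and>
     card (Group_Action.orbits (A\<lparr>carrier := H\<rparr>) (pverts G) (\<lambda>\<sigma>. \<sigma>)) = 3 \<and>
     (\<forall>P \<in> Group_Action.orbits (A\<lparr>carrier := H\<rparr>) (pverts G) (\<lambda>\<sigma>. \<sigma>).
        \<forall>Q \<in> Group_Action.orbits (A\<lparr>carrier := H\<rparr>) (pverts G) (\<lambda>\<sigma>. \<sigma>). card P = card Q)"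
    using tri unfolding tricirculant_def Let_def A_def by (rule exE)
  note H = H0[THEN conjunct1] and cyc = H0[THEN conjunct2, THEN conjunct1]
    and c3 = H0[THEN conjunct2, THEN conjunct2, THEN conjunct1]
    and sz = H0[THEN conjunct2, THEN conjunct2, THEN conjunct2]
  define A' where "A' = A\<lparr>carrier := H\<rparr>"
  interpret A': group A' unfolding A'_def A_def
    by (rule subgroup.subgroup_is_group[OF H[unfolded A_def] group_automorphism_group])
  have cA: "carrier A' = H" by (simp add: A'_def)
  have "\<exists>x \<in> carrier A'. carrier A' = range (\<lambda>k :: int. x [^]\<^bsub>A'\<^esub> k)"
    using cyc A'.cyclic_group unfolding A'_def[symmetric] by simp
  then obtain x where x: "x \<in> H" "H = range (\<lambda>k :: int. x [^]\<^bsub>A'\<^esub> k)"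
    unfolding cA by (rule bexE)
  define \<rho> where "\<rho> k = x [^]\<^bsub>A'\<^esub> k" for k :: int
  have rH: "\<rho> k \<in> H" for k using x(2) by (auto simp: \<rho>_def)
  have HA: "H \<subseteq> {\<sigma> \<in> Bij (pverts G). \<forall>u \<in> pverts G. \<forall>v \<in> pverts G. (\<sigma> u, \<sigma> v) \<in> parcs G \<longleftrightarrow> (u, v) \<in> parcs G}"
    using subgroup.subset[OF H] by (simp add: A_def automorphism_group_def)
  then have rB: "\<rho> k \<in> Bij (pverts G)" for k using rH by blast
  have mult: "\<sigma> \<otimes>\<^bsub>A'\<^esub> \<tau> = compose (pverts G) \<sigma> \<tau>" if "\<sigma> \<in> Bij (pverts G)" "\<tau> \<in> Bij (pverts G)" for \<sigma> \<tau>
    using that by (simp add: A'_def A_def automorphism_group_def BijGroup_def)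
  have one: "\<one>\<^bsub>A'\<^esub> = (\<lambda>u\<in>pverts G. u)"
    by (simp add: A'_def A_def automorphism_group_def BijGroup_def)
  have act: "int_action (pverts G) \<rho>"
  proof
    fix u j k assume u: "u \<in> pverts G"
    show "\<rho> k u \<in> pverts G" using Bij_imp_funcset[OF rB] u by blast
    have "x \<in> carrier A'" using x(1) by (simp add: A'_def)
    then have "\<rho> (j + k) = \<rho> j \<otimes>\<^bsub>A'\<^esub> \<rho> k" unfolding \<rho>_def by (rule A'.int_pow_mult)
    then show "\<rho> (j + k) u = \<rho> j (\<rho> k u)" using u by (simp add: mult rB compose_def)
    show "\<rho> 0 u = u" using u by (simp add: \<rho>_def one)
  qed
  have orbs: "Group_Action.orbits (A\<lparr>carrier := H\<rparr>) (pverts G) (\<lambda>\<sigma>. \<sigma>) = (\<lambda>u. range (\<lambda>k. \<rho> k u)) ` pverts G"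
  proof -
    have "Group_Action.orbit (A\<lparr>carrier := H\<rparr>) (\<lambda>\<sigma>. \<sigma>) u = range (\<lambda>k. \<rho> k u)" for u
      unfolding Group_Action.orbit_def by (subst x(2)) (auto simp: \<rho>_def)
    then show ?thesis unfolding Group_Action.orbits_def by auto
  qed
  \<comment> \<open>Having three orbits implies that there is a vertex; the size of its orbit serves
    as \<open>n\<close>.\<close>
  have "(\<lambda>u. range (\<lambda>k. \<rho> k u)) ` pverts G \<noteq> {}" using c3 unfolding orbs by auto
  then obtain u0 where u0: "u0 \<in> pverts G" by blast
  define n where "n = card (range (\<lambda>k. \<rho> k u0))"
  have "card (range (\<lambda>k. \<rho> k u)) = n" if "u \<in> pverts G" for u
    using sz that u0 unfolding orbs n_def by blast
  moreover have "(\<rho> k u, \<rho> k w) \<in> parcs G \<longleftrightarrow> (u, w) \<in> parcs G" if "u \<in> pverts G" "w \<in> pverts G" for k u w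
    using rH[of k] HA that by blast
  ultimately show thesis
    using orbit_frame_of_int_action[OF act fin, of 3 n] c3 unfolding orbs by (metis that zero_less_numeral)
qed

subsection \<open>Patterns of connection sets\<close>

lemma sign_power_int:
  fixes s :: "'a :: field"
  assumes "s = 1 \<or> s = - 1"
  shows "s powi d = 1 \<or> s powi d = - 1"
  using assms by (auto simp: power_int_minus_left split: if_splits)

locale cubic_orbit_frame = orbit_frame G 3 n v D for G :: "'a pair_pre_digraph" and n v D +
  assumes pair_graph: "pair_graph G" and cubic: "cubic G"
begin

lemma card_D_sum:
  assumes "i < 3"
  shows "card (D i 0) + card (D i 1) + card (D i 2) = 3"
proof -
  interpret pair_graph G by (rule pair_graph)
  have u: "v i 0 \<in> pverts G" using assms verts by auto
  have "out_degree (with_proj G) (v i 0) = 3" using cubic u by (simp add: cubic_def)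
  moreover have "{e \<in> parcs G. fst e = v i 0} = Pair (v i 0) ` {w \<in> pverts G. (v i 0, w) \<in> parcs G}"
    using in_arcsD2 by force
  then have "out_degree (with_proj G) (v i 0) = card {w \<in> pverts G. (v i 0, w) \<in> parcs G}"
    unfolding out_degree_def out_arcs_def by (simp add: card_image inj_on_def)
  ultimately show ?thesis by (simp add: card_neighbours[OF assms] sum_lessThan_3)
qed

lemma neg_mod_D_iff:
  assumes "i < 3" "i' < 3" "d \<in> {0..<int n}"
  shows "(- d) mod int n \<in> D i' i \<longleftrightarrow> d \<in> D i i'"
proof -
  interpret pair_graph G by (rule pair_graph)
  have sym: "(u, w) \<in> parcs G \<longleftrightarrow> (w, u) \<in> parcs G" for u w
    using pair_sym_arcs by (auto simp: symmetric_def dest: symD)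
  have "(v i 0, v i' d) \<in> parcs G \<longleftrightarrow> d mod int n \<in> D i i'" using arc_iff[OF assms(1,2), of 0 d] by simp
  moreover have "(v i' d, v i 0) \<in> parcs G \<longleftrightarrow> (- d) mod int n \<in> D i' i" using arc_iff[OF assms(2,1), of d 0] by simp
  ultimately show ?thesis using sym assms(3) by simp
qed

lemma D_swap:
  assumes "i < 3" "i' < 3"
  shows "D i' i = (\<lambda>d. (- d) mod int n) ` D i i'"
proof (intro equalityI subsetI)
  fix e assume e: "e \<in> D i' i"
  then have r: "e \<in> {0..<int n}" using D_subset[OF assms(2,1)] by blast
  then have "(- e) mod int n \<in> D i i'" using e neg_mod_D_iff[OF assms(2,1)] by simp
  moreover have "e = (- ((- e) mod int n)) mod int n" using r by (simp add: mod_minus_eq)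
  ultimately show "e \<in> (\<lambda>d. (- d) mod int n) ` D i i'" by (rule rev_image_eqI)
next
  fix e assume "e \<in> (\<lambda>d. (- d) mod int n) ` D i i'"
  then obtain d where "e = (- d) mod int n" "d \<in> D i i'" by (rule imageE)
  then show "e \<in> D i' i" using neg_mod_D_iff[OF assms] D_subset[OF assms] by blast
qed

lemma card_D_swap:
  assumes "i < 3" "i' < 3"
  shows "card (D i' i) = card (D i i')"
  using card_image_le[OF finite_D[OF assms], of "\<lambda>d. (- d) mod int n"]
    card_image_le[OF finite_D[OF assms(2,1)], of "\<lambda>d. (- d) mod int n"]
  unfolding D_swap[OF assms, symmetric] D_swap[OF assms(2,1), symmetric] by simp

lemma zero_notin_D:
  assumes "i < 3"
  shows "0 \<notin> D i i"
proof -
  interpret pair_graph G by (rule pair_graph)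
  show ?thesis using arc_iff[OF assms assms, of 0 0] pair_no_loops by fastforce
qed

lemma neg_mod_self:
  assumes "d \<in> {0<..<int n}"
  shows "(- d) mod int n = int n - d"
  using assms by (simp add: zmod_zminus1_eq_if)

lemma D_diag:
  assumes i: "i < 3" and d: "d \<in> D i i"
  shows "0 < d" "d < int n" "int n - d \<in> D i i"
proof -
  have r: "d \<in> {0..<int n}" using D_subset[OF i i] d by blast
  moreover have "d \<noteq> 0" using zero_notin_D[OF i] d by blast
  ultimately show "0 < d" "d < int n" by auto
  then show "int n - d \<in> D i i" using neg_mod_D_iff[OF i i r] neg_mod_self d by simp
qed

text \<open>A connection set within one orbit omits \<open>0\<close> and is closed under negation,
  so its only element is the involution of the cyclic group.\<close>

lemma D_diag_card_1:
  assumes i: "i < 3" and c: "card (D i i) = 1"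
  shows "even n" "D i i = {int (n div 2)}"
proof -
  obtain d where d: "D i i = {d}" using c by (auto simp: card_1_singleton_iff)
  then have "int n - d = d" using D_diag(3)[OF i, of d] by simp
  then have n: "int n = 2 * d" by simp
  then have "even (int n)" by simp
  then show "even n" by simp
  then show "D i i = {int (n div 2)}" using d n by (simp add: zdiv_int)
qed

text \<open>At most one nonzero residue is its own negative, so two distinct elements are exchanged
  by negation, and \<open>a\<close> is the smaller one.\<close>

lemma D_diag_card_2:
  assumes i: "i < 3" and c: "card (D i i) = 2"
  obtains a where "0 < a" "2 * a < n" "D i i = {int a, int n - int a}"
proof -
  obtain d e where de: "D i i = {d, e}" "d \<noteq> e" using c by (auto simp: card_2_iff)
  have d: "0 < d" "d < int n" "int n - d \<in> {d, e}" and e: "0 < e" "e < int n" "int n - e \<in> {d, e}"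
    using D_diag[OF i, of d] D_diag[OF i, of e] de(1) by auto
  then have sum: "d + e = int n" using de(2) by auto
  show thesis
  proof (cases "d < e")
    case True
    have "int n - d = e" using sum by simp
    then have "D i i = {int (nat d), int n - int (nat d)}" using d(1) by (simp add: de(1))
    then show thesis using that[of "nat d"] d(1) True sum by linarith
  next
    case False
    have "int n - e = d" using sum by simp
    then have "D i i = {int (nat e), int n - int (nat e)}" using e(1) by (simp add: de(1) insert_commute)
    then show thesis using that[of "nat e"] e(1) False de(2) sum by linarith
  qed
qed

text \<open>At \<open>1\<close> or \<open>- 1\<close> the symbol is a sum of as many signs as the
  connection set has elements; in particular three signs never cancel.\<close>

lemma symbol_sign_cases:
  assumes s: "s = 1 \<or> s = (- 1 :: real)" and i: "i < 3" "i' < 3"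
  shows "card (D i i') = 0 \<Longrightarrow> symbol s i i' = 0"
    and "card (D i i') = 1 \<Longrightarrow> symbol s i i' = 1 \<or> symbol s i i' = - 1"
    and "card (D i i') = 2 \<Longrightarrow> symbol s i i' = 2 \<or> symbol s i i' = 0 \<or> symbol s i i' = - 2"
    and "card (D i i') = 3 \<Longrightarrow> symbol s i i' \<noteq> 0"
proof -
  have pw: "s powi d = 1 \<or> s powi d = - 1" for d
    using sign_power_int[OF s] .
  show "card (D i i') = 0 \<Longrightarrow> symbol s i i' = 0"
    using finite_D[OF i] by (simp add: symbol_def)
  show "card (D i i') = 1 \<Longrightarrow> symbol s i i' = 1 \<or> symbol s i i' = - 1"
  proof -
    assume "card (D i i') = 1"
    then obtain d where "D i i' = {d}" by (auto simp: card_1_singleton_iff)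
    then show ?thesis using pw[of d] by (simp add: symbol_def)
  qed
  show "symbol s i i' = 2 \<or> symbol s i i' = 0 \<or> symbol s i i' = - 2" if "card (D i i') = 2"
  proof -
    obtain d e where "D i i' = {d, e}" "d \<noteq> e" using \<open>card (D i i') = 2\<close> by (auto simp: card_2_iff)
    then show ?thesis using pw[of d] pw[of e] by (auto simp: symbol_def)
  qed
  show "symbol s i i' \<noteq> 0" if "card (D i i') = 3"
  proof -
    obtain d e f where "D i i' = {d, e, f}" "d \<noteq> e" "e \<noteq> f" "d \<noteq> f"
      using \<open>card (D i i') = 3\<close> by (auto simp: card_3_iff)
    then show ?thesis using pw[of d] pw[of e] pw[of f] by (auto simp: symbol_def)
  qed
qed

text \<open>A sign is its own inverse, so negating the differences does not change their powers;
  evenness of \<open>n\<close> makes the powers well defined modulo \<open>n\<close> when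
  \<open>s = - 1\<close>.\<close>

lemma symbol_sign_swap:
  assumes s: "s = 1 \<or> s = (- 1 :: real)" and n: "even n" and i: "i < 3" "i' < 3"
  shows "symbol s i' i = symbol s i i'"
proof -
  have sn: "s ^ n = 1" using s n by auto
  have inj: "inj_on (\<lambda>d. (- d) mod int n) (D i i')"
    using card_D_swap[OF i] finite_D[OF i] unfolding D_swap[OF i] by (simp add: inj_on_iff_eq_card)
  have "s powi ((- d) mod int n) = s powi d" for d
    using power_int_cong[OF sn, of "(- d) mod int n" "- d"] s by (auto simp: power_int_minus_left)
  then show ?thesis unfolding symbol_def D_swap[OF i] sum.reindex[OF inj] by simp
qed

section \<open>Excluded patterns of connection sets\<close>

text \<open>Write \<open>p\<close>, \<open>q\<close>, \<open>r\<close>, \<open>t\<close> for the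
  symbols \<open>0 1\<close>, \<open>0 2\<close>, \<open>1 1\<close>, \<open>2 2\<close>. The rows
  reduce to \<open>(p * p * r + t / 4) W 0 = 0\<close>, where \<open>p * p\<close> is
  \<open>0\<close> or \<open>4\<close>, \<open>r\<close> is a sign and \<open>t\<close> is
  \<open>2\<close> or \<open>- 2\<close>; the bracket is never zero, so
  \<open>W 0 = 0\<close>.\<close>

lemma not_nut_graph_210:
  assumes c: "card (D 0 1) = 2" "card (D 0 2) = 1" "card (D 1 2) = 0"
  shows "\<not> nut_graph G"
proof
  assume "nut_graph G"
  then obtain s :: real and W where s: "s = 1 \<or> s = - 1" and W: "W \<in> symbol_kernel s"
    and W0: "\<And>i. i < 3 \<Longrightarrow> W i \<noteq> 0"
    using nut_graph_sign_eigenvector by (metis zero_less_numeral)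
  have c': "card (D 0 0) = 0" "card (D 1 1) = 1" "card (D 2 2) = 2"
    using card_D_sum[of 0] card_D_sum[of 1] card_D_sum[of 2] c card_D_swap[of 0 1] card_D_swap[of 0 2]
      card_D_swap[of 1 2] by simp_all
  have n: "even n" using D_diag_card_1[of 1] c' by simp
  have sw: "symbol s 1 0 = symbol s 0 1" "symbol s 2 0 = symbol s 0 2" "symbol s 2 1 = symbol s 1 2"
    using symbol_sign_swap[OF s n] by simp_all
  have z: "symbol s 0 0 = 0" "symbol s 1 2 = 0" using symbol_sign_cases(1)[OF s] c c' by simp_all
  have rows: "symbol s 0 1 * W 1 + symbol s 0 2 * W 2 = 0" "symbol s 0 1 * W 0 + symbol s 1 1 * W 1 = 0"
    "symbol s 0 2 * W 0 + symbol s 2 2 * W 2 = 0"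
    using W unfolding symbol_kernel_3[OF refl] by (auto simp: sw[unfolded One_nat_def] z[unfolded One_nat_def])
  \<comment> \<open>Since \<open>n\<close> is even, the two opposite differences give the same sign
    and cannot cancel.\<close>
  have "symbol s 2 2 = 2 \<or> symbol s 2 2 = - 2"
  proof -
    obtain a where a: "0 < a" "2 * a < n" "D 2 2 = {int a, int n - int a}"
      using D_diag_card_2[of 2] c' by auto
    have "s powi (int n - int a) = s powi int a" using s n by (auto simp: power_int_minus_left)
    moreover have "int a \<noteq> int n - int a" using a(2) by linarith
    ultimately have "symbol s 2 2 = 2 * s powi int a" using a(3) by (simp add: symbol_def)
    then show ?thesis using sign_power_int[OF s, of "int a"] by auto
  qed
  moreover have "symbol s 0 1 = 2 \<or> symbol s 0 1 = 0 \<or> symbol s 0 1 = - 2"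
    using symbol_sign_cases(3)[OF s] c by simp
  moreover have "symbol s 0 2 = 1 \<or> symbol s 0 2 = - 1" "symbol s 1 1 = 1 \<or> symbol s 1 1 = - 1"
    using symbol_sign_cases(2)[OF s] c c' by simp_all
  ultimately show False using rows W0[of 0] W0[of 1] W0[of 2] by (elim disjE) (simp; linarith)+
qed

text \<open>At \<open>w = 1\<close> all nine symbols are \<open>1\<close>, so
  \<open>(1, - 1, 0)\<close> lies in the kernel: a nonzero null function with zeros.\<close>

lemma not_nut_graph_111:
  assumes c: "card (D 0 1) = 1" "card (D 0 2) = 1" "card (D 1 2) = 1"
  shows "\<not> nut_graph G"
proof
  assume nut: "nut_graph G"
  have "card (D 0 0) = 1" "card (D 1 1) = 1" "card (D 2 2) = 1"
    using card_D_sum[of 0] card_D_sum[of 1] card_D_sum[of 2] c card_D_swap[of 0 1] card_D_swap[of 0 2]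
      card_D_swap[of 1 2] by simp_all
  then have "card (D i i') = 1" if "i < 3" "i' < 3" for i i'
    using that c card_D_swap[of 0 1] card_D_swap[of 0 2] card_D_swap[of 1 2]
    by (auto dest!: less_3_cases)
  then have sym: "symbol (1 :: real) i i' = 1" if "i < 3" "i' < 3" for i i'
    using that by (simp add: symbol_def)
  define W :: "nat \<Rightarrow> real" where "W i = (if i = 0 then 1 else if i = 1 then - 1 else 0)" for i
  have W: "W \<in> symbol_kernel 1" unfolding symbol_kernel_3[OF refl] by (auto simp: sym W_def)
  obtain f where f: "\<And>i j. i < 3 \<Longrightarrow> f (v i j) = W i" using function_on_frame[of "\<lambda>i j. W i"] by blast
  have "null_function G f" by (rule symbol_kernel_null_function[OF _ W]) (simp_all add: f)
  moreover have "f (v 2 0) = 0" using f[of 2 0] by (simp add: W_def)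
  moreover have "v i 0 \<in> pverts G" if "i < 3" for i unfolding verts using that by blast
  ultimately have "f (v 0 0) = 0"
    using nut_graph_null_function_eq_0[OF nut, of f "v 2 0" "v 0 0"] by simp
  then show False using f[of 0 0] by (simp add: W_def)
qed

text \<open>The row of the isolated orbit is a sum of three signs times \<open>W 2\<close>, which
  cannot vanish.\<close>

lemma not_nut_graph_isolated_orbit:
  assumes c: "card (D 0 2) = 0" "card (D 1 2) = 0"
  shows "\<not> nut_graph G"
proof
  assume "nut_graph G"
  then obtain s :: real and W where s: "s = 1 \<or> s = - 1" and W: "W \<in> symbol_kernel s"
    and W0: "\<And>i. i < 3 \<Longrightarrow> W i \<noteq> 0"
    using nut_graph_sign_eigenvector by (metis zero_less_numeral)
  have c': "card (D 2 0) = 0" "card (D 2 1) = 0" using c card_D_swap[of 0 2] card_D_swap[of 1 2] by simp_all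
  then have "card (D 2 2) = 3" using card_D_sum[of 2] by simp
  then have "symbol s 2 2 \<noteq> 0" using symbol_sign_cases(4)[OF s] by simp
  moreover have "symbol s 2 0 = 0" "symbol s 2 1 = 0" using symbol_sign_cases(1)[OF s] c' by simp_all
  then have "symbol s 2 2 * W 2 = 0" using W unfolding symbol_kernel_3[OF refl] by simp
  ultimately show False using W0[of 2] by simp
qed

section \<open>Normalisation of the remaining patterns to the two families\<close>

lemma permute_cubic:
  assumes "distinct [p0, p1, p2]" "{p0, p1, p2} = {..<3}"
  shows "cubic_orbit_frame G n (\<lambda>i. v ([p0, p1, p2] ! i)) (\<lambda>i i'. D ([p0, p1, p2] ! i) ([p0, p1, p2] ! i'))"
proof -
  have "bij_betw ((!) [p0, p1, p2]) {..<3} {..<3}"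
    by (rule bij_betw_nth[OF assms(1)]) (simp, simp add: assms(2))
  then show ?thesis
    by (intro cubic_orbit_frame.intro cubic_orbit_frame_axioms.intro permute pair_graph cubic)
qed

text \<open>Orbits 0 and 1 are each joined to orbit 2 by a single difference, \<open>t\<close> or
  \<open>r\<close>. Moving their origins by \<open>- t\<close> and \<open>- r\<close> makes these
  differences zero; the sizes of the connection sets are unchanged because the sets are only
  translated.\<close>

lemma align:
  assumes c: "card (D 0 2) = 1" "card (D 1 2) = 1"
  obtains v' D' where "cubic_orbit_frame G n v' D'" "\<And>i i'. i < 3 \<Longrightarrow> i' < 3 \<Longrightarrow> card (D' i i') = card (D i i')"
    "D' 0 2 = {0}" "D' 1 2 = {0}" "D' 2 0 = {0}" "D' 2 1 = {0}"
proof -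
  obtain t r where t: "D 0 2 = {t}" and r: "D 1 2 = {r}" using c by (auto simp: card_1_singleton_iff)
  have tr: "t \<in> {0..<int n}" "r \<in> {0..<int n}" using D_subset[of 0 2] D_subset[of 1 2] t r by auto
  define s where "s i = (if i = 0 then - t else if i = 1 then - r else 0)" for i :: nat
  define D' where "D' i i' = {d \<in> {0..<int n}. (d + s i' - s i) mod int n \<in> D i i'}" for i i'
  interpret F: orbit_frame G 3 n "\<lambda>i j. v i (j + s i)" D' unfolding D'_def by (rule shift)
  interpret F: cubic_orbit_frame G n "\<lambda>i j. v i (j + s i)" D'
    by (intro cubic_orbit_frame.intro cubic_orbit_frame_axioms.intro F.orbit_frame_axioms pair_graph cubic)
  have single: "{d \<in> {0..<int n}. (d + e) mod int n = e} = {0}" if e: "e \<in> {0..<int n}" for e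
  proof (intro equalityI subsetI)
    fix d assume "d \<in> {d \<in> {0..<int n}. (d + e) mod int n = e}"
    then have "(d + e) mod int n = e mod int n" "d \<in> {0..<int n}" using e by auto
    then have "d mod int n = 0" by (simp add: mod_eq_dvd_iff mod_eq_0_iff_dvd)
    then show "d \<in> {0}" using \<open>d \<in> {0..<int n}\<close> by simp
  qed (use e n_pos in auto)
  have D: "D' 0 2 = {0}" "D' 1 2 = {0}"
    using single tr by (simp_all add: D'_def s_def t r[unfolded One_nat_def])
  then have D2: "D' 2 0 = {0}" "D' 2 1 = {0}" using F.D_swap[of 0 2] F.D_swap[of 1 2] by simp_all
  have "card (D' i i') = card (D i i')" if i: "i < 3" "i' < 3" for i i'
  proof -
    define e where "e = s i' - s i"
    have D'e: "D' i i' = {d \<in> {0..<int n}. (d + e) mod int n \<in> D i i'}"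
      by (simp add: D'_def e_def add_diff_eq)
    have undo: "((d - e) mod int n + e) mod int n = d" if "d \<in> D i i'" for d
    proof -
      have "d \<in> {0..<int n}" using that D_subset[OF i] by blast
      then show ?thesis by (simp add: mod_simps)
    qed
    have "bij_betw (\<lambda>d. (d + e) mod int n) (D' i i') (D i i')"
    proof (rule bij_betwI[where g = "\<lambda>d. (d - e) mod int n"])
      show "(\<lambda>d. (d + e) mod int n) \<in> D' i i' \<rightarrow> D i i'" by (simp add: D'e)
      show "(\<lambda>d. (d - e) mod int n) \<in> D i i' \<rightarrow> D' i i'" using n_pos by (simp add: D'e undo)
      show "((d + e) mod int n - e) mod int n = d" if "d \<in> D' i i'" for d
        using that by (simp add: D'e mod_simps)
    qed (rule undo)
    then show ?thesis by (rule bij_betw_same_card)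
  qed
  then show thesis using that F.cubic_orbit_frame_axioms D D2 by blast
qed

lemma T4_frame:
  assumes c: "card (D 0 1) = 0" "card (D 0 2) = 1" "card (D 1 2) = 1"
  obtains v' a b where "even n" "0 < a" "2 * a < n" "0 < b" "2 * b < n" "orbit_frame G 3 n v' (T4_conn n a b)"
proof -
  have c2: "card (D 0 0) = 2" "card (D 1 1) = 2" "card (D 2 2) = 1"
    using card_D_sum[of 0] card_D_sum[of 1] card_D_sum[of 2] card_D_swap[of 0 1] card_D_swap[of 0 2]
      card_D_swap[of 1 2] c by simp_all
  obtain v' D' where fr: "cubic_orbit_frame G n v' D'"
    and c': "\<And>i i'. i < 3 \<Longrightarrow> i' < 3 \<Longrightarrow> card (D' i i') = card (D i i')"
    and D': "D' 0 2 = {0}" "D' 1 2 = {0}" "D' 2 0 = {0}" "D' 2 1 = {0}"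
    using align[OF c(2,3)] by metis
  interpret F: cubic_orbit_frame G n v' D' by (rule fr)
  have "card (D' 0 1) = 0" "card (D' 1 0) = 0" using c' c card_D_swap[of 0 1] by simp_all
  then have e: "D' 0 1 = {}" "D' 1 0 = {}" using F.finite_D by simp_all
  have n: "even n" and h: "D' 2 2 = {int (n div 2)}" using F.D_diag_card_1[of 2] c2 c' by simp_all
  obtain a where a: "0 < a" "2 * a < n" "D' 0 0 = {int a, int n - int a}"
    using F.D_diag_card_2[of 0] c2 c' by auto
  obtain b where b: "0 < b" "2 * b < n" "D' 1 1 = {int b, int n - int b}"
    using F.D_diag_card_2[of 1] c2 c' by auto
  have "orbit_frame G 3 n v' (T4_conn n a b)"
  proof (rule F.cong_D)
    fix i i' :: nat assume i: "i < 3" "i' < 3"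
    show "D' i i' = T4_conn n a b i i'"
      using less_3_cases[OF i(1)] less_3_cases[OF i(2)]
      by (elim disjE; simp add: T4_conn_def D'[unfolded One_nat_def] e[unfolded One_nat_def] h a(3) b(3)[unfolded One_nat_def])
  qed
  then show thesis using that n a(1,2) b(1,2) by blast
qed

text \<open>If \<open>card (D 0 2)\<close> were zero, the ordering would isolate orbit 2. So it is
  positive, and the row sums leave four patterns, two of which are excluded; in the others the row
  sums also fix the sizes on the diagonal.\<close>

lemma T1_or_T4:
  assumes nut: "nut_graph G"
    and sorted: "card (D 0 1) \<ge> card (D 0 2)" "card (D 0 2) \<ge> card (D 1 2)"
  obtains (T1) v' a b where "even n" "a < b" "b < n" "orbit_frame G 3 n v' (T1_conn n a b)"
    | (T4) v' a b where "even n" "0 < a" "a \<le> b" "b < n div 2" "orbit_frame G 3 n v' (T4_conn n a b)"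
proof -
  note witness = that
  have sums: "card (D 0 0) + card (D 0 1) + card (D 0 2) = 3" "card (D 0 1) + card (D 1 1) + card (D 1 2) = 3"
    "card (D 0 2) + card (D 1 2) + card (D 2 2) = 3"
    using card_D_sum[of 0] card_D_sum[of 1] card_D_sum[of 2] card_D_swap[of 0 1] card_D_swap[of 0 2]
      card_D_swap[of 1 2] by simp_all
  have "card (D 0 2) \<noteq> 0" using not_nut_graph_isolated_orbit nut sorted by auto
  moreover have "\<not> (card (D 0 1) = 2 \<and> card (D 0 2) = 1 \<and> card (D 1 2) = 0)"
    using not_nut_graph_210 nut by blast
  moreover have "\<not> (card (D 0 1) = 1 \<and> card (D 0 2) = 1 \<and> card (D 1 2) = 1)"
    using not_nut_graph_111 nut by blast
  ultimately consider (T1) "card (D 0 1) = 2" "card (D 0 2) = 1" "card (D 1 2) = 1"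
    | (T4) "card (D 0 1) = 1" "card (D 0 2) = 1" "card (D 1 2) = 0"
    using sums sorted by linarith
  then show thesis
  proof cases
    case T1
    then have c: "card (D 0 0) = 0" "card (D 1 1) = 0" "card (D 2 2) = 1" using sums by simp_all
    obtain v' D' where "cubic_orbit_frame G n v' D'"
      and c': "\<And>i i'. i < 3 \<Longrightarrow> i' < 3 \<Longrightarrow> card (D' i i') = card (D i i')"
      and D': "D' 0 2 = {0}" "D' 1 2 = {0}" "D' 2 0 = {0}" "D' 2 1 = {0}"
      using align[OF T1(2,3)] by metis
    then interpret F: cubic_orbit_frame G n v' D' by simp
    have e: "D' 0 0 = {}" "D' 1 1 = {}" using c c'[of 0 0] c'[of 1 1] F.finite_D[of 0 0] F.finite_D[of 1 1] by auto
    have n: "even n" and h: "D' 2 2 = {int (n div 2)}" using F.D_diag_card_1[of 2] c c'[of 2 2] by auto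
    have "card (D' 0 1) = 2" using T1 c' by simp
    then obtain p q where pq: "D' 0 1 = {p, q}" "p < q"
      by (auto simp: card_2_iff) (metis insert_commute linorder_neqE)
    then have r: "0 \<le> p" "q < int n" using F.D_subset[of 0 1] by auto
    define a b where "a = nat p" and "b = nat q"
    have ab: "p = int a" "q = int b" "a < b" "b < n" using pq r by (auto simp: a_def b_def)
    have D01: "D' 0 1 = {int a, int b}" using pq ab by simp
    then have D10: "D' 1 0 = {(- int a) mod int n, (- int b) mod int n}" using F.D_swap[of 0 1] by simp
    have "orbit_frame G 3 n v' (T1_conn n a b)"
    proof (rule F.cong_D)
      fix i i' :: nat assume i: "i < 3" "i' < 3"
      show "D' i i' = T1_conn n a b i i'"
        using less_3_cases[OF i(1)] less_3_cases[OF i(2)]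
        by (elim disjE; simp add: T1_conn_def D'[unfolded One_nat_def] e[unfolded One_nat_def] h
          D01[unfolded One_nat_def] D10[unfolded One_nat_def])
    qed
    then show thesis using witness(1) n ab by blast
  next
    case T4
    \<comment> \<open>In the descending order the orbit joined to both others comes first, whereas
      in \<open>T4\<close> it is \<open>z\<close>, the last one.\<close>
    interpret P: cubic_orbit_frame G n "\<lambda>i. v ([1, 2, 0] ! i)" "\<lambda>i i'. D ([1, 2, 0] ! i) ([1, 2, 0] ! i')"
      by (rule permute_cubic) auto
    have "card (D 1 0) = 1" "card (D 2 0) = 1" using T4 card_D_swap[of 0 1] card_D_swap[of 0 2] by simp_all
    then obtain v' a b where n: "even n" and ab: "0 < a" "2 * a < n" "0 < b" "2 * b < n"
      and fr: "orbit_frame G 3 n v' (T4_conn n a b)"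
      using P.T4_frame T4 by (simp add: numeral_2_eq_2) metis
    have half: "a < n div 2" "b < n div 2" using ab n by auto
    show thesis
    proof (cases "a \<le> b")
      case True
      then show thesis using witness(2) n ab half fr by blast
    next
      case False
      \<comment> \<open>Exchanging the orbits \<open>x\<close> and \<open>y\<close> interchanges
        \<open>a\<close> and \<open>b\<close>.\<close>
      interpret Q: orbit_frame G 3 n v' "T4_conn n a b" by (rule fr)
      have "bij_betw ((!) [1, 0, 2 :: nat]) {..<3} {..<3}"
        by (rule bij_betw_nth) auto
      then interpret R: orbit_frame G 3 n "\<lambda>i. v' ([1, 0, 2] ! i)" "\<lambda>i i'. T4_conn n a b ([1, 0, 2] ! i) ([1, 0, 2] ! i')"
        by (rule Q.permute)
      have "orbit_frame G 3 n (\<lambda>i. v' ([1, 0, 2] ! i)) (T4_conn n b a)"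
      proof (rule R.cong_D)
        fix i i' :: nat assume i: "i < 3" "i' < 3"
        show "T4_conn n a b ([1, 0, 2] ! i) ([1, 0, 2] ! i') = T4_conn n b a i i'"
          using less_3_cases[OF i(1)] less_3_cases[OF i(2)] by (elim disjE; simp add: T4_conn_def)
      qed
      then show thesis using witness(2) n ab half False by (meson nat_le_linear)
    qed
  qed
qed

text \<open>A pair of orbits is determined by the orbit that it omits, so every ordering of the
  three sizes between orbits is realised by one of the six relabellings.\<close>

lemma nut_graph_T1_or_T4:
  assumes nut: "nut_graph G"
  obtains (T1) v' a b where "even n" "a < b" "b < n" "orbit_frame G 3 n v' (T1_conn n a b)"
    | (T4) v' a b where "even n" "0 < a" "a \<le> b" "b < n div 2" "orbit_frame G 3 n v' (T4_conn n a b)"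
proof -
  have sorted: "\<exists>p0 p1 p2. distinct [p0, p1, p2] \<and> {p0, p1, p2} = {..<3::nat} \<and>
    card (D p0 p1) \<ge> card (D p0 p2) \<and> card (D p0 p2) \<ge> card (D p1 p2)"
  proof -
    have set: "{0, 1, 2} = {..<3::nat}" by auto
    have sw: "card (D 1 0) = card (D 0 1)" "card (D 2 0) = card (D 0 2)" "card (D 2 1) = card (D 1 2)"
      using card_D_swap by simp_all
    consider "card (D 0 1) \<ge> card (D 0 2)" "card (D 0 2) \<ge> card (D 1 2)"
      | "card (D 0 1) \<ge> card (D 1 2)" "card (D 1 2) \<ge> card (D 0 2)"
      | "card (D 0 2) \<ge> card (D 0 1)" "card (D 0 1) \<ge> card (D 1 2)"
      | "card (D 0 2) \<ge> card (D 1 2)" "card (D 1 2) \<ge> card (D 0 1)"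
      | "card (D 1 2) \<ge> card (D 0 1)" "card (D 0 1) \<ge> card (D 0 2)"
      | "card (D 1 2) \<ge> card (D 0 2)" "card (D 0 2) \<ge> card (D 0 1)"
      by linarith
    then show ?thesis
    proof cases
      case 1
      then show ?thesis using sw by (intro exI[of _ 0] exI[of _ 1] exI[of _ 2]) auto
    next
      case 2
      then show ?thesis using sw by (intro exI[of _ 1] exI[of _ 0] exI[of _ 2]) auto
    next
      case 3
      then show ?thesis using sw by (intro exI[of _ 0] exI[of _ 2] exI[of _ 1]) auto
    next
      case 4
      then show ?thesis using sw by (intro exI[of _ 2] exI[of _ 0] exI[of _ 1]) auto
    next
      case 5
      then show ?thesis using sw by (intro exI[of _ 1] exI[of _ 2] exI[of _ 0]) auto
    next
      case 6
      then show ?thesis using sw by (intro exI[of _ 2] exI[of _ 1] exI[of _ 0]) auto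
    qed
  qed
  then obtain p0 p1 p2 where p: "distinct [p0, p1, p2]" "{p0, p1, p2} = {..<3::nat}"
    "card (D p0 p1) \<ge> card (D p0 p2)" "card (D p0 p2) \<ge> card (D p1 p2)" by blast
  interpret P: cubic_orbit_frame G n "\<lambda>i. v ([p0, p1, p2] ! i)" "\<lambda>i i'. D ([p0, p1, p2] ! i) ([p0, p1, p2] ! i')"
    using p(1,2) by (rule permute_cubic)
  show thesis
    by (rule P.T1_or_T4[OF nut]) (use p that in \<open>auto simp: numeral_2_eq_2\<close>)
qed

end

section \<open>Recognition of the two families up to isomorphism\<close>

lemma parcs_T1_subset: "parcs (T1 n a b) \<subseteq> pverts (T1 n a b) \<times> pverts (T1 n a b)"
  by (auto simp: T1_def tri_graph_def)

lemma parcs_T4_subset: "parcs (T4 n a b) \<subseteq> pverts (T4 n a b) \<times> pverts (T4 n a b)"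
  by (auto simp: T4_def tri_graph_def)

theorem theorem1p2:
  fixes G :: "'a pair_pre_digraph"
  assumes "pair_graph G" and "cubic G" and "tricirculant G"
  shows "nut_graph G \<longleftrightarrow>
    (\<exists>n a b :: nat. even n \<and> 0 \<le> a \<and> a < b \<and> b < n \<and>
       digraph_iso (with_proj G) (with_proj (T1 n a b)) \<and>
       gcd (n div 2) a = 1 \<and> gcd (n div 2) b = 1 \<and>
       \<not> [a = n div 2] (mod 2) \<and> \<not> [b = n div 2] (mod 2) \<and>
       multiplicity 2 (b - a) \<ge> multiplicity 2 n)
    \<or>
    (\<exists>n a b :: nat. even n \<and> 0 < a \<and> a \<le> b \<and> b < n div 2 \<and>
       digraph_iso (with_proj G) (with_proj (T4 n a b)) \<and>
       gcd (n div 2) (gcd a b) = 1 \<and>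
       (\<not> 4 dvd n \<longrightarrow> even a \<or> even b) \<and>
       (4 dvd n \<longrightarrow> even a \<noteq> even b) \<and>
       (10 dvd n \<longrightarrow> 5 dvd int a \<or> 5 dvd int b \<or> 5 dvd int a - int b \<or> 5 dvd int a + int b))"
    (is "_ \<longleftrightarrow> (\<exists>n a b. ?T1 n a b) \<or> (\<exists>n a b. ?T4 n a b)")
proof -
  interpret pair_graph G by (rule assms(1))
  note wf = pair_wf_digraph
  show ?thesis
  proof
    assume nut: "nut_graph G"
    obtain n v D where "orbit_frame G 3 n v D"
      using tricirculant_orbit_frame[OF assms(3) pair_finite_verts] by blast
    then interpret cubic_orbit_frame G n v D
      by (intro cubic_orbit_frame.intro cubic_orbit_frame_axioms.intro assms)
    from nut show "(\<exists>n a b. ?T1 n a b) \<or> (\<exists>n a b. ?T4 n a b)"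
    proof (cases rule: nut_graph_T1_or_T4)
      case (T1 v' a b)
      have iso: "digraph_iso (with_proj G) (with_proj (T1 n a b))"
        using digraph_iso_if_orbit_frames[OF wf T1(4) parcs_T1_subset T1_orbit_frame[OF T1(1-3)]] .
      note C = iffD1[OF nut_graph_T1_frame[OF T1(4,1-3)] nut]
      have "?T1 n a b" by (rule conjI[OF T1(1) conjI[OF le0 conjI[OF T1(2) conjI[OF T1(3) conjI[OF iso C]]]]])
      then show ?thesis by (intro disjI1 exI[of _ n] exI[of _ a] exI[of _ b])
    next
      case (T4 v' a b)
      have iso: "digraph_iso (with_proj G) (with_proj (T4 n a b))"
        using digraph_iso_if_orbit_frames[OF wf T4(5) parcs_T4_subset T4_orbit_frame[OF T4(1-4)]] .
      note C = iffD1[OF nut_graph_T4_frame[OF T4(5,1-4)] nut]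
      have "?T4 n a b" by (rule conjI[OF T4(1) conjI[OF T4(2) conjI[OF T4(3) conjI[OF T4(4) conjI[OF iso C]]]]])
      then show ?thesis by (intro disjI2 exI[of _ n] exI[of _ a] exI[of _ b])
    qed
  next
    assume "(\<exists>n a b. ?T1 n a b) \<or> (\<exists>n a b. ?T4 n a b)"
    then show "nut_graph G"
    proof (elim disjE exE)
      fix n a b assume T: "?T1 n a b"
      note r1 = conjunct2[OF T]
      note r2 = conjunct2[OF r1]
      note r3 = conjunct2[OF r2]
      note r4 = conjunct2[OF r3]
      note r5 = conjunct2[OF r4]
      note * = conjunct1[OF T] conjunct1[OF r2] conjunct1[OF r3] conjunct1[OF r4]
      \<comment> \<open>The isomorphism is used only to transport the frame; the nullity criterion
        is then applied to \<open>G\<close> itself.\<close>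
      obtain v where "orbit_frame G 3 n v (T1_conn n a b)"
        using orbit_frame_pullback[OF wf *(4) T1_orbit_frame[OF *(1-3)]] by blast
      then show ?thesis by (rule iffD2[OF nut_graph_T1_frame[OF _ *(1-3)] r5])
    next
      fix n a b assume T: "?T4 n a b"
      note r1 = conjunct2[OF T]
      note r2 = conjunct2[OF r1]
      note r3 = conjunct2[OF r2]
      note r4 = conjunct2[OF r3]
      note r5 = conjunct2[OF r4]
      note * = conjunct1[OF T] conjunct1[OF r1] conjunct1[OF r2] conjunct1[OF r3] conjunct1[OF r4]
      obtain v where "orbit_frame G 3 n v (T4_conn n a b)"
        using orbit_frame_pullback[OF wf *(5) T4_orbit_frame[OF *(1-4)]] by blast
      then show ?thesis by (rule iffD2[OF nut_graph_T4_frame[OF _ *(1-4)] r5])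
    qed
  qed
qed


end
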